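(* Let $c,h_1,h_2\in\mathbb{C}$. The Verma module $V(c,h_1,h_2)$ for $W(2,2)$ is irreducible if and only if $$\frac{m^2-1}{12}c+2h_2\neq 0$$ for every nonzero integer $m$.
   Context: $W(2,2)$ is the complex Lie algebra with basis $L_m, W_m$ ($m\in\mathbb{Z}$), $C$, and bracket $[L_m,L_n]=(m-n)L_{m+n}+\frac{m^3-m}{12}\delta_{m+n,0}C$, $[L_m,W_n]=(m-n)W_{m+n}+\frac{m^3-m}{12}\delta_{m+n,0}C$, $[W_m,W_n]=0$, with $C$ central. For $c,h_1,h_2\in\mathbb{C}$, the Verma module is $V(c,h_1,h_2)=U(W(2,2))/I_{c,h_1,h_2}$, where $I_{c,h_1,h_2}$ is the left ideal of the universal enveloping algebra $U(W(2,2))$ generated by $L_m,W_m$ ($m>0$), $C-c$, $L_0-h_1$, $W_0-h_2$. *)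

theory Defs
  imports "HOL-Algebra.Algebra" "HOL-Algebra.Algebraic_Closure_Type" "HOL-Library.Poly_Mapping"
    Complex_Main
begin

text \<open>
  A complex vector space with basis \<open>'b\<close> is represented by \<open>'b \<Rightarrow>\<^sub>0 complex\<close>.
\<close>

definition scale :: "complex \<Rightarrow> ('b \<Rightarrow>\<^sub>0 complex) \<Rightarrow> ('b \<Rightarrow>\<^sub>0 complex)" where
  "scale k x = Poly_Mapping.map ((*) k) x"

definition lin_ext :: "('a \<Rightarrow> ('b \<Rightarrow>\<^sub>0 complex)) \<Rightarrow> ('a \<Rightarrow>\<^sub>0 complex) \<Rightarrow> ('b \<Rightarrow>\<^sub>0 complex)" where
  "lin_ext f x = (\<Sum>a\<in>Poly_Mapping.keys x. scale (Poly_Mapping.lookup x a) (f a))"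

lemma lookup_scale [simp]: "Poly_Mapping.lookup (scale k x) b = k * Poly_Mapping.lookup x b"
  by (simp add: scale_def Poly_Mapping.map.rep_eq when_def)

lemma scale_simps [simp]:
  "scale k 0 = 0" "scale 0 x = 0" "scale 1 x = x" "scale k (scale l x) = scale (k * l) x"
  by (rule poly_mapping_eqI; simp)+

lemma scale_single [simp]: "scale k (Poly_Mapping.single b l) = Poly_Mapping.single b (k * l)"
  by (rule poly_mapping_eqI) (simp add: lookup_single when_def)

lemma scale_add: "scale k (x + y) = scale k x + scale k y"
  by (rule poly_mapping_eqI) (simp add: lookup_add algebra_simps)

lemma scale_add_left: "scale (k + l) x = scale k x + scale l x"
  by (rule poly_mapping_eqI) (simp add: lookup_add algebra_simps)

lemma scale_uminus: "scale k (- x) = - scale k x"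
  by (rule poly_mapping_eqI) simp

lemma scale_uminus_left: "scale (- k) x = - scale k x"
  by (rule poly_mapping_eqI) simp

lemma scale_sum: "scale k (sum f A) = (\<Sum>a\<in>A. scale k (f a))"
  by (induction A rule: infinite_finite_induct) (auto simp: scale_add)

lemma lin_ext_superset:
  assumes "finite A" "Poly_Mapping.keys x \<subseteq> A"
  shows "lin_ext f x = (\<Sum>a\<in>A. scale (Poly_Mapping.lookup x a) (f a))"
  unfolding lin_ext_def using assms
  by (intro sum.mono_neutral_left) (auto simp: in_keys_iff)

lemma lin_ext_add: "lin_ext f (x + y) = lin_ext f x + lin_ext f y"
proof -
  have "Poly_Mapping.keys (x + y) \<subseteq> Poly_Mapping.keys x \<union> Poly_Mapping.keys y"
    by (rule Poly_Mapping.keys_add)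
  then show ?thesis
    by (simp add: lin_ext_superset[of "Poly_Mapping.keys x \<union> Poly_Mapping.keys y"] lookup_add scale_add_left sum.distrib)
qed

lemma lin_ext_scale: "lin_ext f (scale k x) = scale k (lin_ext f x)"
proof -
  have "Poly_Mapping.keys (scale k x) \<subseteq> Poly_Mapping.keys x"
    by (auto simp: in_keys_iff)
  then show ?thesis
    by (simp add: lin_ext_superset[of "Poly_Mapping.keys x"] scale_sum)
qed

lemma lin_ext_single [simp]: "lin_ext f (Poly_Mapping.single b k) = scale k (f b)"
  by (simp add: lin_ext_superset[of "{b}"])


text \<open>
  Lists form the free monoid under concatenation, so \<open>'b list \<Rightarrow>\<^sub>0 complex\<close> with the convolution
  product is the tensor algebra of the vector space \<open>'b \<Rightarrow>\<^sub>0 complex\<close>.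
\<close>

instantiation list :: (type) monoid_add
begin
definition zero_list :: "'a list" where "zero_list = []"
definition plus_list :: "'a list \<Rightarrow> 'a list \<Rightarrow> 'a list" where "plus_list xs ys = xs @ ys"
instance by standard (simp_all add: zero_list_def plus_list_def)
end

definition tensor_alg :: "('b list \<Rightarrow>\<^sub>0 complex) ring" where
  "tensor_alg = ring_of_type_algebra"

definition tensor_incl :: "('b \<Rightarrow>\<^sub>0 complex) \<Rightarrow> ('b list \<Rightarrow>\<^sub>0 complex)" where
  "tensor_incl = lin_ext (\<lambda>b. Poly_Mapping.single [b] 1)"

text \<open>
  The universal enveloping algebra of the Lie algebra \<open>'b \<Rightarrow>\<^sub>0 complex\<close> with bracket \<open>br\<close> is the
  tensor algebra modulo the two-sided ideal generated by all \<open>x \<otimes> y - y \<otimes> x - [x, y]\<close>.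
\<close>

type_synonym 'b lie_bracket = "('b \<Rightarrow>\<^sub>0 complex) \<Rightarrow> ('b \<Rightarrow>\<^sub>0 complex) \<Rightarrow> ('b \<Rightarrow>\<^sub>0 complex)"

definition uea_ideal :: "'b lie_bracket \<Rightarrow> ('b list \<Rightarrow>\<^sub>0 complex) set" where
  "uea_ideal br = Idl\<^bsub>tensor_alg\<^esub>
     {tensor_incl x * tensor_incl y - tensor_incl y * tensor_incl x - tensor_incl (br x y) | x y. True}"

definition uea :: "'b lie_bracket \<Rightarrow> ('b list \<Rightarrow>\<^sub>0 complex) set ring" where
  "uea br = tensor_alg Quot uea_ideal br"

lemma ring_tensor_alg: "ring tensor_alg"
proof (rule ringI)
  show "abelian_group tensor_alg"
  proof (rule abelian_groupI)
    fix x :: "'b list \<Rightarrow>\<^sub>0 complex"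
    show "\<exists>y\<in>carrier tensor_alg. y \<oplus>\<^bsub>tensor_alg\<^esub> x = \<zero>\<^bsub>tensor_alg\<^esub>"
      by (rule bexI[of _ "- x"]) (simp_all add: tensor_alg_def ring_of_type_algebra_def)
  qed (simp_all add: tensor_alg_def ring_of_type_algebra_def algebra_simps)
  show "Group.monoid tensor_alg"
    by (rule monoidI) (simp_all add: tensor_alg_def ring_of_type_algebra_def mult.assoc)
qed (simp_all add: tensor_alg_def ring_of_type_algebra_def algebra_simps)

lemma ring_uea: "ring (uea br)"
  unfolding uea_def uea_ideal_def
  by (intro ideal.quotient_is_ring ring.genideal_ideal ring_tensor_alg)
     (simp add: tensor_alg_def ring_of_type_algebra_def)

definition uea_incl :: "'b lie_bracket \<Rightarrow> ('b \<Rightarrow>\<^sub>0 complex) \<Rightarrow> ('b list \<Rightarrow>\<^sub>0 complex) set" where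
  "uea_incl br x = uea_ideal br +>\<^bsub>tensor_alg\<^esub> tensor_incl x"

definition uea_scalar :: "'b lie_bracket \<Rightarrow> complex \<Rightarrow> ('b list \<Rightarrow>\<^sub>0 complex) set" where
  "uea_scalar br k = uea_ideal br +>\<^bsub>tensor_alg\<^esub> scale k 1"


text \<open>
  Complex scalars act on a \<open>uea br\<close>-module through \<open>uea_scalar br\<close>, so its submodules are
  automatically complex subspaces.
  The library's \<open>module\<close> locale requires a commutative ring of scalars; its record type and
  its \<open>submodule\<close> locale do not, and are used here for left modules over arbitrary rings.
\<close>

locale left_ideal = additive_subgroup I R + ring R for I and R (structure) +
  assumes l_closed: "\<lbrakk>a \<in> I; x \<in> carrier R\<rbrakk> \<Longrightarrow> x \<otimes> a \<in> I"

definition gen_left_ideal :: "('a, 'm) ring_scheme \<Rightarrow> 'a set \<Rightarrow> 'a set" where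
  "gen_left_ideal R S = \<Inter>{I. left_ideal I R \<and> S \<subseteq> I}"

text \<open>The fields \<open>mult\<close> and \<open>one\<close> of the module record play no role for modules.\<close>

definition quot_module :: "('a, 'm) ring_scheme \<Rightarrow> 'a set \<Rightarrow> ('a, 'a set) module" where
  "quot_module R I =
    \<lparr>carrier = a_rcosets\<^bsub>R\<^esub> I, monoid.mult = undefined, one = undefined, ring.zero = I, add = set_add R,
     module.smult = (\<lambda>a A. \<Union>x\<in>A. I +>\<^bsub>R\<^esub> (a \<otimes>\<^bsub>R\<^esub> x))\<rparr>"

sublocale left_ideal \<subseteq> abelian_subgroup I R
  by (rule abelian_subgroupI3[OF additive_subgroup_axioms abelian_group_axioms])

sublocale left_ideal \<subseteq> abelian_subgroup I R
  by (rule abelian_subgroupI3[OF additive_subgroup_axioms abelian_group_axioms])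

lemma (in left_ideal) quot_module_smult:
  assumes a: "a \<in> carrier R" and x: "x \<in> carrier R"
  shows "a \<odot>\<^bsub>quot_module R I\<^esub> (I +> x) = I +> (a \<otimes> x)"
proof -
  have eq: "I +> (a \<otimes> y) = I +> (a \<otimes> x)" if y: "y \<in> I +> x" for y
  proof -
    from y have "y \<in> (\<Union>h\<in>I. {h \<oplus> x})"
      unfolding a_r_coset_def' .
    then obtain i where i: "i \<in> I" "y = i \<oplus> x"
      by blast
    have "i \<in> carrier R"
      using i(1) a_subset by (rule rev_subsetD)
    then have "a \<otimes> y = a \<otimes> i \<oplus> a \<otimes> x"
      unfolding i(2) by (rule r_distr[OF _ x a])
    moreover have "a \<otimes> i \<in> I"
      by (rule l_closed[OF i(1) a])
    ultimately have "a \<otimes> y \<in> (\<Union>h\<in>I. {h \<oplus> a \<otimes> x})"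
      by blast
    then have "a \<otimes> y \<in> I +> (a \<otimes> x)"
      unfolding a_r_coset_def' .
    then show ?thesis
      by (rule a_repr_independence'[OF _ m_closed[OF a x], symmetric])
  qed
  have "(\<Union>y\<in>I +> x. I +> (a \<otimes> y)) = I +> (a \<otimes> x)"
  proof (intro equalityI subsetI)
    fix z assume "z \<in> (\<Union>y\<in>I +> x. I +> (a \<otimes> y))"
    then obtain y where y: "y \<in> I +> x" "z \<in> I +> (a \<otimes> y)"
      by (rule UN_E)
    show "z \<in> I +> (a \<otimes> x)"
      using y(2) unfolding eq[OF y(1)] .
  next
    fix z assume "z \<in> I +> (a \<otimes> x)"
    then show "z \<in> (\<Union>y\<in>I +> x. I +> (a \<otimes> y))"
      by (rule UN_I[OF a_rcos_self[OF x]])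
  qed
  then show ?thesis
    by (simp only: quot_module_def module.simps)
qed

definition irreducible_module :: "('a, 'm) ring_scheme \<Rightarrow> ('a, 'b, 'n) module_scheme \<Rightarrow> bool" where
  "irreducible_module R M \<longleftrightarrow>
     carrier M \<noteq> {\<zero>\<^bsub>M\<^esub>} \<and> (\<forall>N. submodule N R M \<longrightarrow> N = {\<zero>\<^bsub>M\<^esub>} \<or> N = carrier M)"


datatype W22_basis = BL int | BW int | BC

abbreviation "LL m \<equiv> Poly_Mapping.single (BL m) (1 :: complex)"
abbreviation "WW m \<equiv> Poly_Mapping.single (BW m) (1 :: complex)"
abbreviation "CC \<equiv> Poly_Mapping.single BC (1 :: complex)"

definition cocycle :: "int \<Rightarrow> int \<Rightarrow> complex" where
  "cocycle m n = (if m + n = 0 then (of_int m ^ 3 - of_int m) / 12 else 0)"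

text \<open>The clause for \<open>[W\<^sub>m, L\<^sub>n]\<close> is minus the one for \<open>[L\<^sub>n, W\<^sub>m]\<close>.\<close>

fun W22_basis_bracket :: "W22_basis \<Rightarrow> W22_basis \<Rightarrow> (W22_basis \<Rightarrow>\<^sub>0 complex)" where
  "W22_basis_bracket (BL m) (BL n) = scale (of_int (m - n)) (LL (m + n)) + scale (cocycle m n) CC"
| "W22_basis_bracket (BL m) (BW n) = scale (of_int (m - n)) (WW (m + n)) + scale (cocycle m n) CC"
| "W22_basis_bracket (BW m) (BL n) =
     - (scale (of_int (n - m)) (WW (n + m)) + scale (cocycle n m) CC)"
| "W22_basis_bracket (BW m) (BW n) = 0"
| "W22_basis_bracket BC _ = 0"
| "W22_basis_bracket _ BC = 0"

definition W22_bracket :: "W22_basis lie_bracket" where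
  "W22_bracket x y = lin_ext (\<lambda>a. lin_ext (\<lambda>b. W22_basis_bracket a b) y) x"

abbreviation "UW22 \<equiv> uea W22_bracket"

definition verma_ideal ::
    "complex \<Rightarrow> complex \<Rightarrow> complex \<Rightarrow> (W22_basis list \<Rightarrow>\<^sub>0 complex) set set" where
  "verma_ideal c h1 h2 =
    (let \<iota> = uea_incl W22_bracket; \<kappa> = uea_scalar W22_bracket in
     gen_left_ideal UW22
       ({\<iota> (LL m) | m. m > 0} \<union> {\<iota> (WW m) | m. m > 0} \<union>
        {\<iota> CC \<ominus>\<^bsub>UW22\<^esub> \<kappa> c, \<iota> (LL 0) \<ominus>\<^bsub>UW22\<^esub> \<kappa> h1, \<iota> (WW 0) \<ominus>\<^bsub>UW22\<^esub> \<kappa> h2}))"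

definition verma :: "complex \<Rightarrow> complex \<Rightarrow> complex \<Rightarrow>
    ((W22_basis list \<Rightarrow>\<^sub>0 complex) set, (W22_basis list \<Rightarrow>\<^sub>0 complex) set set) module" where
  "verma c h1 h2 = quot_module UW22 (verma_ideal c h1 h2)"


text \<open>\<open>W22_bracket\<close> is indeed a Lie bracket.\<close>

lemma W22_bracket_single [simp]:
  "W22_bracket (Poly_Mapping.single a k) (Poly_Mapping.single b l) = scale (k * l) (W22_basis_bracket a b)"
  by (simp add: W22_bracket_def)

lemma W22_bracket_add_left: "W22_bracket (x + y) z = W22_bracket x z + W22_bracket y z"
  by (simp add: W22_bracket_def lin_ext_add)

lemma W22_bracket_add_right: "W22_bracket x (y + z) = W22_bracket x y + W22_bracket x z"
  by (simp add: W22_bracket_def lin_ext_add scale_add lin_ext_def[of _ x] sum.distrib)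

lemma W22_bracket_scale_left: "W22_bracket (scale k x) y = scale k (W22_bracket x y)"
  by (simp add: W22_bracket_def lin_ext_scale)

lemma W22_bracket_scale_right: "W22_bracket x (scale k y) = scale k (W22_bracket x y)"
  by (simp add: W22_bracket_def lin_ext_scale lin_ext_def[of _ x] scale_sum mult.commute)

lemma W22_induct [case_names zero single add]:
  fixes x :: "W22_basis \<Rightarrow>\<^sub>0 complex"
  assumes "P 0" "\<And>b k. P (Poly_Mapping.single b k)" "\<And>x y. P x \<Longrightarrow> P y \<Longrightarrow> P (x + y)"
  shows "P x"
proof -
  have "P (\<Sum>b\<in>A. Poly_Mapping.single b (f b))" for A f
    by (induction A rule: infinite_finite_induct) (auto simp: assms)
  moreover have "x = (\<Sum>b\<in>Poly_Mapping.keys x. Poly_Mapping.single b (Poly_Mapping.lookup x b))"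
    by (rule poly_mapping_eqI)
       (simp add: lookup_sum lookup_single when_def sum.delta' in_keys_iff)
  ultimately show ?thesis by metis
qed

lemma W22_bracket_zero [simp]: "W22_bracket 0 x = 0" "W22_bracket x 0 = 0"
  by (simp_all add: W22_bracket_def lin_ext_def)

lemma cocycle_antisym: "cocycle n m = - cocycle m n"
proof (cases "m + n = 0")
  case True
  then have "n = - m" by simp
  then show ?thesis by (simp add: cocycle_def field_simps)
qed (simp add: cocycle_def add.commute)

lemma W22_basis_bracket_antisym: "W22_basis_bracket b a = - W22_basis_bracket a b"
proof -
  have "W22_basis_bracket (BL n) (BL m) = - W22_basis_bracket (BL m) (BL n)" for m n
  proof -
    have "scale (of_int (n - m)) (LL (n + m)) = - scale (of_int (m - n)) (LL (m + n))"
      by (simp add: add.commute flip: single_uminus)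
    moreover have "scale (cocycle n m) CC = - scale (cocycle m n) CC"
      by (metis cocycle_antisym scale_uminus_left)
    ultimately show ?thesis by simp
  qed
  then show ?thesis
    by (cases a; cases b) simp_all
qed

lemma W22_bracket_antisym: "W22_bracket y x = - W22_bracket x y"
proof (induction x rule: W22_induct)
  case (single a k)
  show ?case
  proof (induction y rule: W22_induct)
    case (single b l)
    show ?case
      by (simp add: W22_basis_bracket_antisym[of b a] scale_uminus mult.commute)
  qed (simp_all add: W22_bracket_add_left W22_bracket_add_right)
qed (simp_all add: W22_bracket_add_left W22_bracket_add_right)

lemma W22_bracket_self: "W22_bracket x x = 0"
proof (rule poly_mapping_eqI)
  fix b
  have "Poly_Mapping.lookup (W22_bracket x x) b = - Poly_Mapping.lookup (W22_bracket x x) b"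
    by (metis W22_bracket_antisym lookup_uminus)
  then show "Poly_Mapping.lookup (W22_bracket x x) b = Poly_Mapping.lookup 0 b" by simp
qed

lemma W22_bracket_uminus_right: "W22_bracket x (- y) = - W22_bracket x y"
  using W22_bracket_scale_right[of x "-1" y]
  by (metis scale_simps(3) scale_uminus_left)

lemma W22_bracket_diff_right: "W22_bracket x (y - z) = W22_bracket x y - W22_bracket x z"
  using W22_bracket_add_right[of x y "- z"] by (simp add: W22_bracket_uminus_right)

lemma W22_basis_jacobi:
  "W22_bracket (Poly_Mapping.single a 1) (W22_basis_bracket b d) +
   W22_bracket (Poly_Mapping.single b 1) (W22_basis_bracket d a) +
   W22_bracket (Poly_Mapping.single d 1) (W22_basis_bracket a b) = 0"
proof -
  show ?thesis
    apply (cases a; cases b; cases d; rule poly_mapping_eqI)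
    apply (simp_all add: W22_bracket_add_right W22_bracket_scale_right W22_bracket_uminus_right
       W22_bracket_diff_right lookup_add lookup_minus scale_add scale_uminus lookup_single)
    subgoal for m n p k
    proof (cases "m + n + p = 0")
      case True
      then have p: "p = - m - n" by simp
      show ?thesis
        unfolding p by (cases k) (simp_all add: when_def cocycle_def field_simps power3_eq_cube)
    next
      case False
      then show ?thesis
        by (cases k) (auto simp: when_def cocycle_def algebra_simps)
    qed
    subgoal for m n p k
    proof (cases "m + n + p = 0")
      case True
      then have p: "p = - m - n" by simp
      show ?thesis
        unfolding p by (cases k) (simp_all add: when_def cocycle_def field_simps power3_eq_cube)
    next
      case False
      then show ?thesis
        by (cases k) (auto simp: when_def cocycle_def algebra_simps)
    qed
    subgoal for m n p k
    proof (cases "m + n + p = 0")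
      case True
      then have p: "p = - m - n" by simp
      show ?thesis
        unfolding p by (cases k) (simp_all add: when_def cocycle_def field_simps power3_eq_cube)
    next
      case False
      then show ?thesis
        by (cases k) (auto simp: when_def cocycle_def algebra_simps)
    qed
    subgoal for m n p k
    proof (cases "m + n + p = 0")
      case True
      then have p: "p = - m - n" by simp
      show ?thesis
        unfolding p by (cases k) (simp_all add: when_def cocycle_def field_simps power3_eq_cube)
    next
      case False
      then show ?thesis
        by (cases k) (auto simp: when_def cocycle_def algebra_simps)
    qed
    done
qed

lemma W22_bracket_jacobi:
  "W22_bracket x (W22_bracket y z) + W22_bracket y (W22_bracket z x) + W22_bracket z (W22_bracket x y) = 0"
proof -
  define J where "J x y z = W22_bracket x (W22_bracket y z) + W22_bracket y (W22_bracket z x) +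
    W22_bracket z (W22_bracket x y)" for x y z
  have add: "J (x + x') y z = J x y z + J x' y z" "J x (y + y') z = J x y z + J x y' z"
    "J x y (z + z') = J x y z + J x y z'" for x x' y y' z z'
    by (simp_all add: J_def W22_bracket_add_left W22_bracket_add_right)
  have scale: "J (scale k x) y z = scale k (J x y z)" "J x (scale k y) z = scale k (J x y z)"
    "J x y (scale k z) = scale k (J x y z)" for k x y z
    by (simp_all add: J_def W22_bracket_scale_left W22_bracket_scale_right scale_add)
  have zero: "J 0 y z = 0" "J x 0 z = 0" "J x y 0 = 0" for x y z
    by (simp_all add: J_def)
  have basis: "J (Poly_Mapping.single a 1) (Poly_Mapping.single b 1) (Poly_Mapping.single d 1) = 0"
    for a b d
    using W22_basis_jacobi[of a b d] by (simp add: J_def)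
  have single: "J (Poly_Mapping.single a k) (Poly_Mapping.single b l) (Poly_Mapping.single d j) = 0"
    for a b d k l j
  proof -
    have "J (scale k (Poly_Mapping.single a 1)) (scale l (Poly_Mapping.single b 1))
      (scale j (Poly_Mapping.single d 1)) = 0"
      unfolding scale basis by simp
    then show ?thesis by simp
  qed
  have "J x (Poly_Mapping.single b l) (Poly_Mapping.single d j) = 0" for b d l j
    by (induction x rule: W22_induct) (simp_all add: zero add single)
  then have "J x y (Poly_Mapping.single d j) = 0" for d j
    by (induction y rule: W22_induct) (simp_all add: zero add)
  then have "J x y z = 0"
    by (induction z rule: W22_induct) (simp_all add: zero add)
  then show ?thesis
    by (simp add: J_def)
qed

end

theory Submission
  imports Defs "HOL-Library.Product_Lexorder"
begin

text \<open>
  Write \<open>\<kappa> n = n ((n\<^sup>2 - 1) / 12 c + 2 h\<^sub>2)\<close>, the eigenvalue of \<open>[L\<^sub>n, W\<^sub>-\<^sub>n]\<close> and of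
  \<open>[W\<^sub>n, L\<^sub>-\<^sub>n]\<close> on the highest weight vector \<open>v\<close>. By rewriting with the commutation relations
  (the diamond lemma) the Verma module has the basis of ordered words in negative modes, the
  \<open>L\<close>'s to the left of the \<open>W\<close>'s.

  If no \<open>\<kappa> n\<close> vanishes, positive modes act like derivations: modulo words with fewer \<open>L\<close>'s,
  \<open>L\<^sub>-\<^sub>n W\<^sub>n\<close> multiplies a word whose \<open>L\<close>-modes are at least \<open>-n\<close> by \<open>\<kappa> n\<close> times the number of its
  factors \<open>L\<^sub>-\<^sub>n\<close>, and \<open>W\<^sub>-\<^sub>n L\<^sub>n\<close> does the same for words in the \<open>W\<close>'s. So a nonzero vector of a
  submodule can be stripped first of all its \<open>L\<close>'s, then of all its \<open>W\<close>'s, and \<open>v\<close> remains.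

  If \<open>\<kappa> m = 0\<close>, then \<open>c = - 12 \<alpha>\<^sup>2\<close> and \<open>2 h\<^sub>2 = \<alpha>\<^sup>2 (m\<^sup>2 - 1)\<close> for some \<open>\<alpha>\<close>
  (if \<open>\<alpha> = 0\<close>, take \<open>m = 1\<close>). In the free field
  realization \<open>W = a\<^sup>2 / 2 + \<alpha> \<partial>a\<close> the coefficient of \<open>a\<^sub>-\<^sub>m\<close> in \<open>W\<^sub>-\<^sub>m\<close> is zero, so \<open>W\<^sub>-\<^sub>m v\<close> is a polynomial
  in \<open>W\<^sub>-\<^sub>1, \<dots>, W\<^sub>-\<^sub>m\<^sub>+\<^sub>1\<close> there. The difference between \<open>W\<^sub>-\<^sub>m v\<close> and that polynomial is a nonzero
  singular vector of the Verma module.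
\<close>

section \<open>Linear algebra of finitely supported functions and of the tensor algebra\<close>

lemma lin_ext_cong [fundef_cong]:
  "x = y \<Longrightarrow> (\<And>a. a \<in> Poly_Mapping.keys y \<Longrightarrow> f a = g a) \<Longrightarrow> lin_ext f x = lin_ext g y"
  by (simp add: lin_ext_def)

lemma lin_ext_zero [simp]: "lin_ext f 0 = 0"
  by (simp add: lin_ext_def)

lemma lin_ext_fun_zero: "lin_ext (\<lambda>a. 0) x = 0"
  by (simp add: lin_ext_def)

lemma lin_ext_uminus: "lin_ext f (- x) = - lin_ext f x"
  using lin_ext_add[of f x "- x"] by (simp add: eq_neg_iff_add_eq_0 add.commute)

lemma lin_ext_diff: "lin_ext f (x - y) = lin_ext f x - lin_ext f y"
  using lin_ext_add[of f x "- y"] by (simp add: lin_ext_uminus)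

lemma scale_diff: "scale k (x - y) = scale k x - scale k y"
  using scale_add[of k x "- y"] by (simp add: scale_uminus)

lemma lin_ext_diff_fun: "lin_ext (\<lambda>a. f a - g a) x = lin_ext f x - lin_ext g x"
  by (simp add: lin_ext_def scale_diff sum_subtractf)

lemma lin_ext_scale_fun: "lin_ext (\<lambda>a. scale k (f a)) x = scale k (lin_ext f x)"
  by (simp add: lin_ext_def scale_sum mult.commute)

lemma lin_ext_scale_const:
  "lin_ext (\<lambda>a. scale (g a) y) x =
    scale (\<Sum>a\<in>Poly_Mapping.keys x. Poly_Mapping.lookup x a * g a) y"
  by (rule poly_mapping_eqI) (simp add: lin_ext_def lookup_sum sum_distrib_right mult.assoc)

lemma lin_ext_sum: "lin_ext f (sum g A) = (\<Sum>a\<in>A. lin_ext f (g a))"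
  by (induction A rule: infinite_finite_induct) (auto simp: lin_ext_add)

lemma lin_ext_swap:
  "lin_ext (\<lambda>a. lin_ext (f a) y) x = lin_ext (\<lambda>b. lin_ext (\<lambda>a. f a b) x) y"
  unfolding lin_ext_def scale_sum
  by (subst sum.swap) (simp add: mult.commute)

lemma lin_ext_lin_ext: "lin_ext f (lin_ext g x) = lin_ext (\<lambda>a. lin_ext f (g a)) x"
  by (simp add: lin_ext_def[of _ x] lin_ext_sum lin_ext_scale)

lemma lin_ext_basis [simp]: "lin_ext (\<lambda>a. Poly_Mapping.single a 1) x = x"
  by (rule poly_mapping_eqI)
     (simp add: lin_ext_def lookup_sum lookup_single when_def sum.delta' in_keys_iff)

lemma lookup_lin_ext:
  "Poly_Mapping.lookup (lin_ext f x) b =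
    (\<Sum>a\<in>Poly_Mapping.keys x. Poly_Mapping.lookup x a * Poly_Mapping.lookup (f a) b)"
  by (simp add: lin_ext_def lookup_sum)

lemma lin_ext_induct [case_names zero add scale basis]:
  assumes "P 0" "\<And>x y. P x \<Longrightarrow> P y \<Longrightarrow> P (x + y)" "\<And>k x. P x \<Longrightarrow> P (scale k x)"
    "\<And>a. a \<in> Poly_Mapping.keys x \<Longrightarrow> P (f a)"
  shows "P (lin_ext f x)"
proof -
  have "P (\<Sum>a\<in>A. scale (Poly_Mapping.lookup x a) (f a))" if "A \<subseteq> Poly_Mapping.keys x" for A
    using that by (induction A rule: infinite_finite_induct) (auto simp: assms)
  then show ?thesis
    by (simp add: lin_ext_def)
qed

lemma scale_conv_single: "scale k x = Poly_Mapping.single 0 k * x"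
  for x :: "'a::monoid_add \<Rightarrow>\<^sub>0 complex"
  by (simp add: scale_def mult_map_scale_conv_mult)

text \<open>Scalars are multiples of the unit of the algebra, which is why left ideals are
  automatically complex subspaces.\<close>

lemma scale_conv_mult: "scale k x = scale k 1 * x" for x :: "'a::monoid_add \<Rightarrow>\<^sub>0 complex"
  by (simp add: scale_conv_single)

lemma scale_mult_left: "scale k x * y = scale k (x * y)"
  for x :: "'a::monoid_add \<Rightarrow>\<^sub>0 complex"
  by (simp add: scale_conv_single mult.assoc)

lemma lin_ext_mult_left: "lin_ext f x * y = lin_ext (\<lambda>a. f a * y) x"
  for y :: "'a::monoid_add \<Rightarrow>\<^sub>0 complex"
  by (simp add: lin_ext_def sum_distrib_right scale_mult_left)

text \<open>The scalar sits on the neutral element of the monoid, which commutes with each basis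
  element; expanding \<open>x\<close> in the basis does the rest.\<close>

lemma scale_mult_right: "x * scale k y = scale k (x * y)"
  for x :: "'a::monoid_add \<Rightarrow>\<^sub>0 complex"
proof -
  have "Poly_Mapping.single a 1 * scale k y = scale k (Poly_Mapping.single a 1 * y)" for a
    by (simp add: scale_conv_single mult_single flip: mult.assoc)
  then show ?thesis
    using lin_ext_mult_left[of "\<lambda>a. Poly_Mapping.single a 1" x "scale k y"]
      lin_ext_mult_left[of "\<lambda>a. Poly_Mapping.single a 1" x y]
    by (simp add: lin_ext_scale_fun)
qed

lemma lin_ext_mult_right: "y * lin_ext f x = lin_ext (\<lambda>a. y * f a) x"
  for y :: "'a::monoid_add \<Rightarrow>\<^sub>0 complex"
  by (simp add: lin_ext_def sum_distrib_left scale_mult_right)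

section \<open>Rewriting words to ordered words\<close>

fun inversions :: "'a::linorder list \<Rightarrow> nat" where
  "inversions [] = 0"
| "inversions (x # xs) = length (filter (\<lambda>y. y < x) xs) + inversions xs"

text \<open>An adjacent swap leaves the relative order of all other pairs alone.\<close>

lemma inversions_swap: "y < x \<Longrightarrow> inversions (u @ y # x # t) < inversions (u @ x # y # t)"
  by (induction u) auto

lemma not_sortedE:
  assumes "\<not> sorted w"
  obtains u x y t where "w = u @ x # y # t" "y < x"
proof -
  have "\<exists>u x y t. w = u @ x # y # t \<and> y < x"
    using assms
  proof (induction w)
    case (Cons a w)
    show ?case
    proof (cases "sorted w")
      case False
      then obtain u x y t where "w = u @ x # y # t" "y < x" using Cons.IH by blast
      then show ?thesis by (metis append_Cons)
    next
      case True
      with Cons.prems obtain b t where "w = b # t" "b < a"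
        by (cases w) (auto simp: not_le intro: order_trans less_le_trans)
      then show ?thesis by (metis append_Nil)
    qed
  qed simp
  then show ?thesis using that by blast
qed

text \<open>Any descent would do: \<open>confluent\<close> shows below that the normal form does not
  depend on the choice.\<close>

definition descent :: "'a::linorder list \<Rightarrow> 'a list \<times> 'a \<times> 'a \<times> 'a list" where
  "descent w = (SOME (u, x, y, t). w = u @ x # y # t \<and> y < x)"

lemma descent_eqD:
  assumes "descent w = (u, x, y, t)" "\<not> sorted w"
  shows "w = u @ x # y # t \<and> y < x"
proof -
  have "\<exists>d. case d of (u, x, y, t) \<Rightarrow> w = u @ x # y # t \<and> y < x"
    using assms(2) by (elim not_sortedE) auto
  then have "case descent w of (u, x, y, t) \<Rightarrow> w = u @ x # y # t \<and> y < x"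
    unfolding descent_def by (rule someI_ex)
  then show ?thesis using assms(1) by simp
qed

locale lie_basis =
  fixes bb :: "'b::linorder \<Rightarrow> 'b \<Rightarrow> ('b \<Rightarrow>\<^sub>0 complex)"
  assumes antisym: "bb y x = - bb x y"
    and jacobi: "lin_ext (bb x) (bb y z) + lin_ext (bb y) (bb z x) + lin_ext (bb z) (bb x y) = 0"
begin

text \<open>Poincare-Birkhoff-Witt rewriting: \<open>x y\<close> with \<open>y < x\<close> becomes
  \<open>y x + [x, y]\<close>. The swap keeps the length and removes an inversion, and the bracket
  terms are shorter.\<close>

function nf :: "'b list \<Rightarrow> ('b list \<Rightarrow>\<^sub>0 complex)" where
  "nf w = (if sorted w then Poly_Mapping.single w 1
     else case descent w of (u, x, y, t) \<Rightarrow>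
       nf (u @ y # x # t) + lin_ext (\<lambda>b. nf (u @ b # t)) (bb x y))"
  by auto
termination
  by (relation "measures [length, inversions]") (auto dest!: descent_eqD[OF sym] simp: inversions_swap)

declare nf.simps [simp del]

lemma nf_sorted: "sorted w \<Longrightarrow> nf w = Poly_Mapping.single w 1"
  by (simp add: nf.simps)

lemma bb_self [simp]: "bb x x = 0"
proof (rule poly_mapping_eqI)
  fix k
  have "Poly_Mapping.lookup (bb x x) k = - Poly_Mapping.lookup (bb x x) k"
    by (metis antisym lookup_uminus)
  then show "Poly_Mapping.lookup (bb x x) k = Poly_Mapping.lookup 0 k" by simp
qed

text \<open>The normal form of the product \<open>u z t\<close> with a Lie algebra element
  \<open>z\<close> in the middle.\<close>

definition insert_at :: "'b list \<Rightarrow> ('b \<Rightarrow>\<^sub>0 complex) \<Rightarrow> 'b list \<Rightarrow> ('b list \<Rightarrow>\<^sub>0 complex)" where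
  "insert_at u z t = lin_ext (\<lambda>b. nf (u @ b # t)) z"

text \<open>The point is that every descent of \<open>w\<close> may be used, not only the one that
  \<open>descent\<close> picks.\<close>

definition confluent :: "'b list \<Rightarrow> bool" where
  "confluent w \<longleftrightarrow> (\<forall>u x y t. w = u @ x # y # t \<longrightarrow> y < x \<longrightarrow>
     nf w = nf (u @ y # x # t) + insert_at u (bb x y) t)"

lemma confluentD:
  "confluent (u @ x # y # t) \<Longrightarrow> y < x \<Longrightarrow>
    nf (u @ x # y # t) = nf (u @ y # x # t) + insert_at u (bb x y) t"
  unfolding confluent_def by blast

lemma insert_at_uminus: "insert_at u (- z) t = - insert_at u z t"
  by (simp add: insert_at_def lin_ext_uminus)

text \<open>If \<open>x < y\<close>, the rule is read backwards with antisymmetry; if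
  \<open>x = y\<close>, both sides vanish. Later arguments need not compare the letters any
  more.\<close>

lemma commute_if_confluent:
  assumes "confluent (u @ x # y # t)" "confluent (u @ y # x # t)"
  shows "nf (u @ x # y # t) - nf (u @ y # x # t) = insert_at u (bb x y) t"
proof (cases x y rule: linorder_cases)
  case less
  then show ?thesis
    using confluentD[OF assms(2)] by (simp add: antisym[of x y] insert_at_uminus)
next
  case equal
  then show ?thesis by (simp add: insert_at_def)
next
  case greater
  then show ?thesis
    using confluentD[OF assms(1)] by simp
qed

text \<open>Summed over the letters of \<open>z\<close>, the swaps produce the commutator of
  \<open>a\<close> and \<open>z\<close>. The swapped words have length
  \<open>length u + length t + 2\<close>, one less than a word with an overlapping triple.\<close>

lemma insert_at_commute:
  assumes "\<And>w. length w < length u + length t + 3 \<Longrightarrow> confluent w"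
  shows "insert_at (u @ [a]) z t - insert_at u z (a # t) = insert_at u (lin_ext (bb a) z) t"
proof -
  have "insert_at (u @ [a]) z t - insert_at u z (a # t) =
      lin_ext (\<lambda>b. nf (u @ a # b # t) - nf (u @ b # a # t)) z"
    by (simp add: insert_at_def lin_ext_diff_fun)
  also have "\<dots> = lin_ext (\<lambda>b. insert_at u (bb a b) t) z"
    by (intro lin_ext_cong commute_if_confluent assms) auto
  also have "\<dots> = insert_at u (lin_ext (bb a) z) t"
    by (simp add: insert_at_def lin_ext_lin_ext)
  finally show ?thesis .
qed

text \<open>The only critical pair; it is resolved by the Jacobi identity.\<close>

lemma confluent_overlap:
  assumes IH: "\<And>v. (v, u @ x # y # z # t) \<in> measures [length, inversions] \<Longrightarrow> confluent v"
    and "z < y" "y < x"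
  shows "nf (u @ y # x # z # t) + insert_at u (bb x y) (z # t) =
    nf (u @ x # z # y # t) + insert_at (u @ [x]) (bb y z) t"
proof -
  have zx: "z < x" using assms by simp
  have inv1: "inversions (u @ y # x # z # t) < inversions (u @ x # y # z # t)"
    using inversions_swap[of y x u "z # t"] assms by simp
  have inv2: "inversions (u @ x # z # y # t) < inversions (u @ x # y # z # t)"
    using inversions_swap[of z y "u @ [x]" t] assms by simp
  have inv3: "inversions (u @ y # z # x # t) < inversions (u @ y # x # z # t)"
    using inversions_swap[of z x "u @ [y]" t] zx by simp
  have inv4: "inversions (u @ z # x # y # t) < inversions (u @ x # z # y # t)"
    using inversions_swap[of z x u "y # t"] zx by simp
  have "confluent (u @ y # x # z # t)" by (rule IH) (simp add: inv1)
  from confluentD[of "u @ [y]" x z t] this zx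
  have 1: "nf (u @ y # x # z # t) = nf (u @ y # z # x # t) + insert_at (u @ [y]) (bb x z) t"
    by simp
  have "confluent (u @ y # z # x # t)" by (rule IH) (use inv1 inv3 in simp)
  from confluentD[OF this] assms
  have 2: "nf (u @ y # z # x # t) = nf (u @ z # y # x # t) + insert_at u (bb y z) (x # t)"
    by simp
  have "confluent (u @ x # z # y # t)" by (rule IH) (simp add: inv2)
  from confluentD[OF this] zx
  have 3: "nf (u @ x # z # y # t) = nf (u @ z # x # y # t) + insert_at u (bb x z) (y # t)"
    by simp
  have "confluent (u @ z # x # y # t)" by (rule IH) (use inv2 inv4 in simp)
  from confluentD[of "u @ [z]" x y t] this assms
  have 4: "nf (u @ z # x # y # t) = nf (u @ z # y # x # t) + insert_at (u @ [z]) (bb x y) t"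
    by simp
  have short: "confluent w" if "length w < length u + length t + 3" for w
    by (rule IH) (use that in simp)
  have swap: "insert_at (u @ [a]) r t - insert_at u r (a # t) = insert_at u (lin_ext (bb a) r) t" for a r
    by (rule insert_at_commute) (rule short)
  \<comment> \<open>Both routes end in the reversed word \<open>z y x\<close>, which cancels; the
    remaining commutators are the three terms of the Jacobi identity.\<close>
  have "(nf (u @ y # x # z # t) + insert_at u (bb x y) (z # t)) -
      (nf (u @ x # z # y # t) + insert_at (u @ [x]) (bb y z) t) =
    - ((insert_at (u @ [x]) (bb y z) t - insert_at u (bb y z) (x # t)) +
       (insert_at (u @ [y]) (bb z x) t - insert_at u (bb z x) (y # t)) +
       (insert_at (u @ [z]) (bb x y) t - insert_at u (bb x y) (z # t)))"
    unfolding 1 2 3 4 antisym[of z x] insert_at_uminus by simp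
  also have "\<dots> = - insert_at u (lin_ext (bb x) (bb y z) + lin_ext (bb y) (bb z x) +
      lin_ext (bb z) (bb x y)) t"
    unfolding swap by (simp add: insert_at_def lin_ext_add)
  also have "\<dots> = 0"
    by (simp add: jacobi insert_at_def)
  finally show ?thesis by simp
qed

text \<open>Each side still contains the descent treated by the other. Once it is rewritten too, the
  sides differ only in the order in which the two brackets are inserted, and
  \<open>lin_ext_swap\<close> shows that this order is immaterial.\<close>

lemma confluent_disjoint:
  assumes IH: "\<And>v. (v, u @ x # y # s @ x' # y' # t) \<in> measures [length, inversions] \<Longrightarrow> confluent v"
    and "y < x" "y' < x'"
  shows "nf (u @ y # x # s @ x' # y' # t) + insert_at u (bb x y) (s @ x' # y' # t) =
    nf (u @ x # y # s @ y' # x' # t) + insert_at (u @ x # y # s) (bb x' y') t"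
proof -
  have inv: "inversions (u @ y # x # s @ x' # y' # t) < inversions (u @ x # y # s @ x' # y' # t)"
    "inversions (u @ x # y # s @ y' # x' # t) < inversions (u @ x # y # s @ x' # y' # t)"
    using inversions_swap[of y x u "s @ x' # y' # t"]
      inversions_swap[of y' x' "u @ x # y # s" t] assms by simp_all
  have "confluent (u @ y # x # s @ x' # y' # t)" by (rule IH) (simp add: inv)
  from confluentD[of "u @ y # x # s" x' y' t] this assms
  have 1: "nf (u @ y # x # s @ x' # y' # t) =
      nf (u @ y # x # s @ y' # x' # t) + insert_at (u @ y # x # s) (bb x' y') t"
    by simp
  have "confluent (u @ x # y # s @ y' # x' # t)" by (rule IH) (simp add: inv)
  from confluentD[OF this] assms
  have 2: "nf (u @ x # y # s @ y' # x' # t) =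
      nf (u @ y # x # s @ y' # x' # t) + insert_at u (bb x y) (s @ y' # x' # t)"
    by simp
  have short: "confluent w" if "length w < length u + length s + length t + 4" for w
    by (rule IH) (use that in simp)
  have "insert_at u (bb x y) (s @ x' # y' # t) - insert_at u (bb x y) (s @ y' # x' # t) =
      lin_ext (\<lambda>b. nf ((u @ b # s) @ x' # y' # t) - nf ((u @ b # s) @ y' # x' # t)) (bb x y)"
    by (simp add: insert_at_def lin_ext_diff_fun)
  also have "\<dots> = lin_ext (\<lambda>b. insert_at (u @ b # s) (bb x' y') t) (bb x y)"
    by (intro lin_ext_cong commute_if_confluent short) auto
  also have "\<dots> = lin_ext (\<lambda>b. insert_at u (bb x y) (s @ b # t)) (bb x' y')"
    by (simp add: insert_at_def lin_ext_swap[of _ "bb x' y'"])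
  also have "\<dots> = lin_ext (\<lambda>b. nf (u @ x # y # (s @ b # t)) - nf (u @ y # x # (s @ b # t))) (bb x' y')"
    by (intro lin_ext_cong commute_if_confluent[symmetric] short) auto
  also have "\<dots> = insert_at (u @ x # y # s) (bb x' y') t - insert_at (u @ y # x # s) (bb x' y') t"
    by (simp add: insert_at_def lin_ext_diff_fun)
  finally show ?thesis
    unfolding 1 2 by (simp add: algebra_simps)
qed

lemma confluent_le:
  assumes IH: "\<And>v. (v, u @ x # y # t) \<in> measures [length, inversions] \<Longrightarrow> confluent v"
    and eq: "u @ x # y # t = u' @ x' # y' # t'" and le: "length u \<le> length u'"
    and "y < x" "y' < x'"
  shows "nf (u @ y # x # t) + insert_at u (bb x y) t =
    nf (u' @ y' # x' # t') + insert_at u' (bb x' y') t'"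
proof -
  obtain s where s: "u' = u @ s" "x # y # t = s @ x' # y' # t'"
    using eq le by (auto simp: append_eq_append_conv2)
  \<comment> \<open>The second descent begins at the same place, one letter later, or after the
    first one.\<close>
  consider "s = []" | "s = [x]" | s' where "s = x # y # s'"
    using s(2) by (cases s; cases "tl s") auto
  then show ?thesis
  proof cases
    case 1
    then show ?thesis using s by simp
  next
    case 2
    then have "x' = y" "t = y' # t'" using s by auto
    then show ?thesis
      using confluent_overlap[of u x y y' t'] IH assms(4,5) s 2 by simp
  next
    case 3
    then have "t = s' @ x' # y' # t'" using s by auto
    then show ?thesis
      using confluent_disjoint[of u x y s' x' y' t'] IH assms(4,5) s 3 by simp
  qed
qed

text \<open>The diamond lemma: an arbitrary descent is compared with the chosen one, by induction on
  length and inversions. By symmetry, \<open>confluent_le\<close> need only treat the case where its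
  first descent is not to the right of the other.\<close>

lemma confluent: "confluent w"
proof (induction w rule: wf_induct_rule[OF wf_measures[of "[length, inversions]"]])
  case (1 w)
  show ?case
    unfolding confluent_def
  proof (intro allI impI)
    fix u x y t assume w: "w = u @ x # y # t" and yx: "y < x"
    have ns: "\<not> sorted w" using w yx by (auto simp: sorted_append)
    obtain u' x' y' t' where d: "descent w = (u', x', y', t')" by (cases "descent w")
    from descent_eqD[OF this ns] have w': "w = u' @ x' # y' # t'" and yx': "y' < x'" by auto
    have IH: "confluent v" if "(v, w) \<in> measures [length, inversions]" for v
      using that by (rule 1)
    have "nf w = nf (u' @ y' # x' # t') + insert_at u' (bb x' y') t'"
      using ns d by (simp add: nf.simps[of w] insert_at_def)
    also have "\<dots> = nf (u @ y # x # t) + insert_at u (bb x y) t"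
    proof (cases "length u \<le> length u'")
      case True
      show ?thesis
        by (rule confluent_le[symmetric, OF IH[unfolded w] _ True yx yx']) (use w w' in simp_all)
    next
      case False
      then have le: "length u' \<le> length u" by simp
      show ?thesis
      proof (rule confluent_le[OF _ _ le yx' yx])
        show "confluent v" if "(v, u' @ x' # y' # t') \<in> measures [length, inversions]" for v
          using that by (intro IH) (simp only: w')
        show "u' @ x' # y' # t' = u @ x # y # t"
          using w w' by simp
      qed
    qed
    finally show "nf w = nf (u @ y # x # t) + insert_at u (bb x y) t" .
  qed
qed

lemma nf_commute:
  "nf (u @ x # y # t) - nf (u @ y # x # t) = lin_ext (\<lambda>b. nf (u @ b # t)) (bb x y)"
  using commute_if_confluent[OF confluent confluent] by (simp add: insert_at_def)

text \<open>Induction along the rewriting, freed from the choice in \<open>descent\<close>: the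
  inductive case treats an arbitrary descent, where \<open>nf_commute\<close> applies.\<close>

lemma rewrite_induct [case_names sorted descent]:
  assumes "\<And>w. sorted w \<Longrightarrow> Q w"
    and "\<And>u x y t. y < x \<Longrightarrow> Q (u @ y # x # t) \<Longrightarrow> (\<And>b. Q (u @ b # t)) \<Longrightarrow> Q (u @ x # y # t)"
  shows "Q w"
proof (induction w rule: wf_induct_rule[OF wf_measures[of "[length, inversions]"]])
  case (1 w)
  show ?case
  proof (cases "sorted w")
    case False
    then obtain u x y t where w: "w = u @ x # y # t" "y < x" by (rule not_sortedE)
    show ?thesis
      unfolding w(1) by (rule assms(2)[OF w(2)]; rule 1) (simp_all add: w inversions_swap)
  qed (rule assms(1))
qed

end


section \<open>Normal forms in a Verma module\<close>

text \<open>A triangular decomposition with a character \<chi> of the nonnegative subalgebra: the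
  closure conditions make both parts subalgebras, and \<open>character\<close> says that \<chi>
  kills brackets. As negative letters come first, an ordered word is a negative word followed by a
  nonnegative one.\<close>

locale verma_basis = lie_basis bb for bb :: "'b::linorder \<Rightarrow> 'b \<Rightarrow> ('b \<Rightarrow>\<^sub>0 complex)" +
  fixes neg :: "'b \<Rightarrow> bool" and \<chi> :: "'b \<Rightarrow> complex"
  assumes neg_less: "neg x \<Longrightarrow> \<not> neg y \<Longrightarrow> x < y"
    and neg_closed: "neg x \<Longrightarrow> neg y \<Longrightarrow> b \<in> Poly_Mapping.keys (bb x y) \<Longrightarrow> neg b"
    and nonneg_closed: "\<not> neg x \<Longrightarrow> \<not> neg y \<Longrightarrow> b \<in> Poly_Mapping.keys (bb x y) \<Longrightarrow> \<not> neg b"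
    and character: "\<not> neg x \<Longrightarrow> \<not> neg y \<Longrightarrow>
      (\<Sum>b\<in>Poly_Mapping.keys (bb x y). Poly_Mapping.lookup (bb x y) b * \<chi> b) = 0"
begin

text \<open>Meaningful for ordered words only, where the letters satisfying \<open>neg\<close> form a prefix.\<close>

definition eval_tail :: "'b list \<Rightarrow> ('b list \<Rightarrow>\<^sub>0 complex)" where
  "eval_tail w = scale (prod_list (map \<chi> (dropWhile neg w))) (Poly_Mapping.single (takeWhile neg w) 1)"

text \<open>The vector that \<open>w\<close> represents in the module induced from \<chi>, written
  in the basis of ordered negative words.\<close>

definition vnf :: "'b list \<Rightarrow> ('b list \<Rightarrow>\<^sub>0 complex)" where
  "vnf w = lin_ext eval_tail (nf w)"

definition project :: "('b list \<Rightarrow>\<^sub>0 complex) \<Rightarrow> ('b list \<Rightarrow>\<^sub>0 complex)" where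
  "project = lin_ext vnf"

lemma vnf_commute:
  "vnf (u @ x # y # t) - vnf (u @ y # x # t) = lin_ext (\<lambda>b. vnf (u @ b # t)) (bb x y)"
proof -
  have "vnf (u @ x # y # t) - vnf (u @ y # x # t) =
      lin_ext eval_tail (nf (u @ x # y # t) - nf (u @ y # x # t))"
    by (simp add: vnf_def lin_ext_diff)
  then show ?thesis
    unfolding nf_commute by (simp add: lin_ext_lin_ext vnf_def)
qed

lemma vnf_swap:
  "vnf (u @ x # y # t) = vnf (u @ y # x # t) + lin_ext (\<lambda>b. vnf (u @ b # t)) (bb x y)"
  using vnf_commute[of u x y t] by (simp add: algebra_simps)

lemma vnf_sorted: "sorted w \<Longrightarrow> vnf w = eval_tail w"
  by (simp add: vnf_def nf_sorted)

lemma eval_tail_append: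
  "(\<And>b. b \<in> set n \<Longrightarrow> neg b) \<Longrightarrow> (\<And>b. b \<in> set t \<Longrightarrow> \<not> neg b) \<Longrightarrow>
    eval_tail (n @ t) = scale (prod_list (map \<chi> t)) (Poly_Mapping.single n 1)"
  by (cases t) (simp_all add: eval_tail_def takeWhile_eq_all_conv[THEN iffD2] dropWhile_eq_Nil_conv[THEN iffD2])

lemma sorted_split:
  assumes "sorted w"
  obtains n t where "w = n @ t" "\<forall>b\<in>set n. neg b" "\<forall>b\<in>set t. \<not> neg b"
    "sorted n"
proof -
  have "\<exists>n t. w = n @ t \<and> (\<forall>b\<in>set n. neg b) \<and> (\<forall>b\<in>set t. \<not> neg b)"
    using assms
  proof (induction w)
    case (Cons a w)
    then obtain n t where *: "w = n @ t" "\<forall>b\<in>set n. neg b" "\<forall>b\<in>set t. \<not> neg b" by auto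
    show ?case
    proof (cases "neg a")
      case True
      then show ?thesis using * by (intro exI[of _ "a # n"] exI[of _ t]) auto
    next
      case False
      have "n = []"
        using Cons.prems * False neg_less[of "hd n" a] by (cases n) auto
      then show ?thesis using * False by (intro exI[of _ "[]"] exI[of _ "a # t"]) auto
    qed
  qed auto
  then obtain n t where "w = n @ t" "\<forall>b\<in>set n. neg b" "\<forall>b\<in>set t. \<not> neg b" by blast
  with assms show ?thesis
    by (intro that[of n t]) (auto simp: sorted_append)
qed

text \<open>Rewriting the tail never touches \<open>n\<close>. A swap does not change the product of
  the weights, and the bracket term contributes a multiple of \<chi> of a bracket, which is
  zero.\<close>

lemma vnf_append_nonneg:
  assumes "sorted n" "\<And>b. b \<in> set n \<Longrightarrow> neg b" "\<And>b. b \<in> set t \<Longrightarrow> \<not> neg b"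
  shows "vnf (n @ t) = scale (prod_list (map \<chi> t)) (Poly_Mapping.single n 1)"
  using assms(3)
proof (induction t rule: rewrite_induct)
  case (sorted t)
  then have "sorted (n @ t)"
    using assms by (auto simp: sorted_append intro!: less_imp_le neg_less)
  then show ?case
    using sorted assms(2) by (simp add: vnf_sorted eval_tail_append)
next
  case (descent u x y t)
  define k where "k = prod_list (map \<chi> u) * prod_list (map \<chi> t)"
  have "lin_ext (\<lambda>b. vnf ((n @ u) @ b # t)) (bb x y) =
      lin_ext (\<lambda>b. scale (k * \<chi> b) (Poly_Mapping.single n 1)) (bb x y)"
  proof (rule lin_ext_cong[OF refl])
    fix b assume "b \<in> Poly_Mapping.keys (bb x y)"
    then have "\<not> neg b" using nonneg_closed descent.prems by auto
    then show "vnf ((n @ u) @ b # t) = scale (k * \<chi> b) (Poly_Mapping.single n 1)"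
      using descent.IH(2)[of b] descent.prems by (auto simp: k_def mult_ac)
  qed
  also have "\<dots> = Poly_Mapping.single n
      (\<Sum>b\<in>Poly_Mapping.keys (bb x y). k * (Poly_Mapping.lookup (bb x y) b * \<chi> b))"
    by (simp add: lin_ext_scale_const mult_ac del: scale_single, simp)
  also have "\<dots> = 0"
    using character[of x y] descent.prems by (simp flip: sum_distrib_left)
  finally show ?case
    using vnf_swap[of "n @ u" x y t] descent.IH(1) descent.prems by (auto simp: mult_ac)
qed

lemma vnf_neg_sorted:
  "sorted n \<Longrightarrow> (\<And>b. b \<in> set n \<Longrightarrow> neg b) \<Longrightarrow> vnf n = Poly_Mapping.single n 1"
  using vnf_append_nonneg[of n "[]"] by simp

text \<open>Rewriting \<open>w\<close> leaves the final letter in place; once \<open>w\<close> is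
  ordered, \<open>x\<close> joins its nonnegative tail. So \<open>vnf\<close> respects the relations
  that define the induced module.\<close>

lemma vnf_snoc:
  assumes "\<not> neg x"
  shows "vnf (w @ [x]) = scale (\<chi> x) (vnf w)"
proof (induction w rule: rewrite_induct)
  case (sorted w)
  then obtain n t where *: "w = n @ t" "\<forall>b\<in>set n. neg b" "\<forall>b\<in>set t. \<not> neg b"
    "sorted n" by (rule sorted_split)
  then show ?case
    using vnf_append_nonneg[of n t] vnf_append_nonneg[of n "t @ [x]"] assms
    by (auto simp: mult.commute)
next
  case (descent u a b t)
  then show ?case
    using vnf_swap[of u a b t] vnf_swap[of u a b "t @ [x]"]
    by (simp add: scale_add lin_ext_scale_fun)
qed

text \<open>A bracket replaces two negative letters by one negative letter, so rewriting never
  empties the word.\<close>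

lemma lookup_vnf_neg:
  assumes "\<And>b. b \<in> set w \<Longrightarrow> neg b" "w \<noteq> []"
  shows "Poly_Mapping.lookup (vnf w) [] = 0"
  using assms
proof (induction w rule: rewrite_induct)
  case (sorted w)
  then show ?case
    by (simp add: vnf_neg_sorted lookup_single)
next
  case (descent u x y t)
  have "Poly_Mapping.lookup (vnf (u @ b # t)) [] = 0" if "b \<in> Poly_Mapping.keys (bb x y)" for b
    using descent that neg_closed[of x y b] by auto
  then have "Poly_Mapping.lookup (lin_ext (\<lambda>b. vnf (u @ b # t)) (bb x y)) [] = 0"
    by (simp add: lookup_lin_ext)
  moreover have "Poly_Mapping.lookup (vnf (u @ y # x # t)) [] = 0"
    using descent by auto
  ultimately show ?case
    by (simp add: vnf_swap[of u x y t] lookup_add)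
qed

lemma keys_vnf:
  "n \<in> Poly_Mapping.keys (vnf w) \<Longrightarrow> sorted n \<and> (\<forall>b\<in>set n. neg b)"
proof (induction w arbitrary: n rule: rewrite_induct)
  case (sorted w)
  then obtain n' t where *: "w = n' @ t" "\<forall>b\<in>set n'. neg b" "\<forall>b\<in>set t. \<not> neg b"
    "sorted n'" by (auto elim: sorted_split)
  then show ?case
    using vnf_append_nonneg[of n' t] sorted(2) by (auto simp: in_keys_iff lookup_single when_def split: if_splits)
next
  case (descent u x y t)
  have "Poly_Mapping.lookup (vnf (u @ y # x # t)) n \<noteq> 0 \<or>
      (\<exists>b. Poly_Mapping.lookup (vnf (u @ b # t)) n \<noteq> 0)"
  proof (rule ccontr)
    assume "\<not> ?thesis"
    then have "Poly_Mapping.lookup (vnf (u @ x # y # t)) n = 0"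
      by (simp add: vnf_swap[of u x y t] lookup_add lookup_lin_ext)
    with descent.prems show False by (simp add: in_keys_iff)
  qed
  then show ?case
    using descent.IH by (auto simp: in_keys_iff)
qed

text \<open>Later applied to the letters \<open>BW (- i)\<close> with \<open>0 < i\<close> and
  \<open>i < m\<close>, to show that their products do not contain the letter
  \<open>BW (- m)\<close>.\<close>

lemma keys_vnf_subset:
  assumes A: "\<And>b. b \<in> A \<Longrightarrow> neg b"
    "\<And>x y. x \<in> A \<Longrightarrow> y \<in> A \<Longrightarrow> Poly_Mapping.keys (bb x y) \<subseteq> A"
  shows "set w \<subseteq> A \<Longrightarrow> n \<in> Poly_Mapping.keys (vnf w) \<Longrightarrow> set n \<subseteq> A"
proof (induction w arbitrary: n rule: rewrite_induct)
  case (sorted w)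
  then have "vnf w = Poly_Mapping.single w 1"
    using A(1) by (intro vnf_neg_sorted) auto
  then show ?case using sorted by simp
next
  case (descent u x y t)
  have "n \<in> Poly_Mapping.keys (vnf (u @ y # x # t)) \<or>
      (\<exists>b\<in>Poly_Mapping.keys (bb x y). n \<in> Poly_Mapping.keys (vnf (u @ b # t)))"
  proof (rule ccontr)
    assume "\<not> ?thesis"
    then have "Poly_Mapping.lookup (vnf (u @ x # y # t)) n = 0"
      by (simp add: vnf_swap[of u x y t] lookup_add lookup_lin_ext in_keys_iff[of n])
    with descent.prems show False by (simp add: in_keys_iff)
  qed
  then show ?case
  proof
    assume *: "n \<in> Poly_Mapping.keys (vnf (u @ y # x # t))"
    have "set (u @ y # x # t) \<subseteq> A"
      using descent.prems(1) by auto
    then show ?thesis using * by (rule descent.IH(1))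
  next
    assume "\<exists>b\<in>Poly_Mapping.keys (bb x y). n \<in> Poly_Mapping.keys (vnf (u @ b # t))"
    then obtain b where b: "b \<in> Poly_Mapping.keys (bb x y)" "n \<in> Poly_Mapping.keys (vnf (u @ b # t))"
      by blast
    have "set (u @ b # t) \<subseteq> A"
      using descent.prems(1) subsetD[OF A(2)[of x y] b(1)] by auto
    then show ?thesis using b(2) by (rule descent.IH(2))
  qed
qed

end

section \<open>Left ideals of the tensor algebra and submodules\<close>

text \<open>Submodules of the Verma module are handled as left ideals of the tensor algebra, which
  avoids cosets.\<close>

definition lideal :: "'a::ring_1 set \<Rightarrow> bool" where
  "lideal N \<longleftrightarrow> 0 \<in> N \<and> (\<forall>x\<in>N. \<forall>y\<in>N. x + y \<in> N) \<and> (\<forall>a. \<forall>x\<in>N. a * x \<in> N)"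

lemma lideal_uminus: "lideal N \<Longrightarrow> x \<in> N \<Longrightarrow> - x \<in> N"
  unfolding lideal_def by (metis mult_minus1)

lemma lideal_diff: "lideal N \<Longrightarrow> x \<in> N \<Longrightarrow> y \<in> N \<Longrightarrow> x - y \<in> N"
  using lideal_uminus[of N y] unfolding lideal_def by (metis diff_conv_add_uminus)

lemma lideal_scale: "lideal N \<Longrightarrow> x \<in> N \<Longrightarrow> scale k x \<in> N"
  unfolding lideal_def by (subst scale_conv_mult) blast

lemma lideal_lin_ext: "lideal N \<Longrightarrow> (\<And>a. a \<in> Poly_Mapping.keys x \<Longrightarrow> f a \<in> N) \<Longrightarrow> lin_ext f x \<in> N"
  by (induction x rule: lin_ext_induct) (auto simp: lideal_scale, auto simp: lideal_def)

abbreviation word :: "'b list \<Rightarrow> ('b list \<Rightarrow>\<^sub>0 complex)" where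
  "word w \<equiv> Poly_Mapping.single w 1"

lemma word_mult [simp]: "word u * word w = word (u @ w)"
  by (simp add: mult_single plus_list_def)

lemma one_eq_word: "1 = word []"
  by (simp add: zero_list_def flip: single_one)

lemma tensor_incl_single [simp]: "tensor_incl (Poly_Mapping.single b 1) = word [b]"
  by (simp add: tensor_incl_def)

context lie_basis
begin

definition bracket :: "'b lie_bracket" where
  "bracket x y = lin_ext (\<lambda>a. lin_ext (bb a) y) x"

definition relation :: "('b \<Rightarrow>\<^sub>0 complex) \<Rightarrow> ('b \<Rightarrow>\<^sub>0 complex) \<Rightarrow> ('b list \<Rightarrow>\<^sub>0 complex)" where
  "relation x y = tensor_incl x * tensor_incl y - tensor_incl y * tensor_incl x - tensor_incl (bracket x y)"

text \<open>Bilinearity reduces the defining relations of the enveloping algebra to pairs of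
  letters.\<close>

lemma relation_eq_lin_ext:
  "relation x y = lin_ext (\<lambda>a. lin_ext (\<lambda>b. word [a, b] - word [b, a] - lin_ext (\<lambda>d. word [d]) (bb a b)) y) x"
proof -
  have "tensor_incl x * tensor_incl y = lin_ext (\<lambda>a. lin_ext (\<lambda>b. word [a, b]) y) x"
    unfolding tensor_incl_def lin_ext_mult_left unfolding lin_ext_mult_right by simp
  moreover have "tensor_incl y * tensor_incl x = lin_ext (\<lambda>a. lin_ext (\<lambda>b. word [b, a]) y) x"
    unfolding tensor_incl_def lin_ext_mult_right unfolding lin_ext_mult_left by simp
  ultimately show ?thesis
    by (simp add: relation_def lin_ext_diff_fun tensor_incl_def bracket_def lin_ext_lin_ext)
qed

end

context verma_basis
begin

lemma project_word [simp]: "project (word w) = vnf w"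
  by (simp add: project_def)

lemma project_linear: "project 0 = 0" "project (x + y) = project x + project y"
  "project (x - y) = project x - project y" "project (scale k x) = scale k (project x)"
  by (simp_all add: project_def lin_ext_add lin_ext_diff lin_ext_scale)

lemma project_lin_ext: "project (lin_ext f x) = lin_ext (\<lambda>a. project (f a)) x"
  by (simp add: project_def lin_ext_lin_ext)

lemma project_eq_0I:
  assumes "\<And>u. project (word u * x) = 0"
  shows "project (a * x) = 0"
proof -
  have "project (lin_ext word a * x) = lin_ext (\<lambda>u. project (word u * x)) a"
    by (simp add: lin_ext_mult_left project_lin_ext del: lin_ext_basis)
  then show ?thesis by (simp add: assms lin_ext_fun_zero)
qed

lemma project_eq_0I2:
  assumes "\<And>u v. project (word u * x * word v) = 0"
  shows "project (a * x * b) = 0"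
proof -
  have "project (a * x * lin_ext word b) = lin_ext (\<lambda>v. project (a * (x * word v))) b"
    by (simp add: lin_ext_mult_right project_lin_ext mult.assoc del: lin_ext_basis)
  also have "\<dots> = 0"
    using project_eq_0I[of "x * word v" a for v] assms by (simp add: lin_ext_fun_zero mult.assoc)
  finally show ?thesis by simp
qed

lemma project_relation: "project (a * relation x y * b) = 0"
proof (rule project_eq_0I2)
  fix u v
  have "word u * relation x y * word v = lin_ext (\<lambda>a. lin_ext (\<lambda>b.
      word (u @ a # b # v) - word (u @ b # a # v) - lin_ext (\<lambda>d. word (u @ d # v)) (bb a b)) y) x"
    unfolding relation_eq_lin_ext
    by (simp add: lin_ext_mult_left lin_ext_mult_right left_diff_distrib right_diff_distrib)
  then show "project (word u * relation x y * word v) = 0"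
    by (simp add: project_lin_ext project_linear vnf_commute lin_ext_fun_zero)
qed

lemma project_character: "\<not> neg x \<Longrightarrow> project (a * (word [x] - scale (\<chi> x) 1)) = 0"
  by (rule project_eq_0I) (simp add: right_diff_distrib scale_mult_right project_linear vnf_snoc del: scale_single)

text \<open>Rewriting stays inside a coset of \<open>L\<close>: a swap costs a relation, and
  evaluating a nonnegative last letter costs a left multiple of
  \<open>word [x] - scale (\<chi> x) 1\<close>.\<close>

lemma word_cong:
  assumes L: "lideal L" and rel: "\<And>a x y b. a * relation x y * b \<in> L"
    and chr: "\<And>x. \<not> neg x \<Longrightarrow> word [x] - scale (\<chi> x) 1 \<in> L"
  shows "word w - vnf w \<in> L"
proof (induction w rule: rewrite_induct)
  case (sorted w)
  then obtain n t where *: "w = n @ t" "\<forall>b\<in>set n. neg b" "\<forall>b\<in>set t. \<not> neg b"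
    "sorted n" by (rule sorted_split)
  have "word (n @ t) - scale (prod_list (map \<chi> t)) (word n) \<in> L"
    using *(3)
  proof (induction t rule: rev_induct)
    case Nil
    then show ?case using L by (simp add: lideal_def)
  next
    case (snoc x t)
    \<comment> \<open>The tail is evaluated from its right end, since \<open>L\<close> absorbs
      factors only on the left.\<close>
    have "word (n @ t) * (word [x] - scale (\<chi> x) 1) + scale (\<chi> x) (word (n @ t) - scale (prod_list (map \<chi> t)) (word n)) \<in> L"
      using L chr[of x] snoc lideal_scale[OF L] unfolding lideal_def by simp
    then show ?case
      by (simp add: right_diff_distrib scale_mult_right scale_diff algebra_simps del: scale_single)
  qed
  then show ?case
    using * vnf_append_nonneg[of n t] by simp
next
  case (descent u x y t)
  have "relation (Poly_Mapping.single x 1) (Poly_Mapping.single y 1) =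
      word [x, y] - word [y, x] - lin_ext (\<lambda>d. word [d]) (bb x y)"
    by (simp add: relation_eq_lin_ext)
  then have "word u * relation (Poly_Mapping.single x 1) (Poly_Mapping.single y 1) * word t =
      word (u @ x # y # t) - word (u @ y # x # t) - lin_ext (\<lambda>b. word (u @ b # t)) (bb x y)"
    by (simp add: left_diff_distrib right_diff_distrib lin_ext_mult_left lin_ext_mult_right)
  with rel have 1: "word (u @ x # y # t) - word (u @ y # x # t) - lin_ext (\<lambda>b. word (u @ b # t)) (bb x y) \<in> L"
    by metis
  have "lin_ext (\<lambda>b. word (u @ b # t) - vnf (u @ b # t)) (bb x y) \<in> L"
    using descent.IH(2) by (intro lideal_lin_ext[OF L])
  then have 2: "lin_ext (\<lambda>b. word (u @ b # t)) (bb x y) - lin_ext (\<lambda>b. vnf (u @ b # t)) (bb x y) \<in> L"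
    by (simp add: lin_ext_diff_fun)
  have "(word (u @ x # y # t) - word (u @ y # x # t) - lin_ext (\<lambda>b. word (u @ b # t)) (bb x y)) +
      (word (u @ y # x # t) - vnf (u @ y # x # t)) +
      (lin_ext (\<lambda>b. word (u @ b # t)) (bb x y) - lin_ext (\<lambda>b. vnf (u @ b # t)) (bb x y)) \<in> L"
    using 1 2 descent.IH(1) L unfolding lideal_def by blast
  then show ?case
    by (simp add: vnf_swap[of u x y t] algebra_simps)
qed

lemma project_cong:
  assumes L: "lideal L" and "\<And>a x y b. a * relation x y * b \<in> L"
    and "\<And>x. \<not> neg x \<Longrightarrow> word [x] - scale (\<chi> x) 1 \<in> L"
  shows "x - project x \<in> L"
proof -
  have "lin_ext (\<lambda>w. word w - vnf w) x \<in> L"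
    by (intro lideal_lin_ext[OF L] word_cong assms)
  then show ?thesis by (simp add: lin_ext_diff_fun project_def)
qed

text \<open>The projection consists of ordered negative words; another negative letter in front
  gives nonempty negative words, to which \<open>lookup_vnf_neg\<close> applies.\<close>

lemma lookup_project_neg:
  assumes "neg b"
  shows "Poly_Mapping.lookup (project (word [b] * project x)) [] = 0"
proof -
  have "Poly_Mapping.lookup (vnf (b # n)) [] = 0" if "w \<in> Poly_Mapping.keys x" "n \<in> Poly_Mapping.keys (vnf w)" for n w
    using keys_vnf[OF that(2)] assms by (intro lookup_vnf_neg) auto
  then have "Poly_Mapping.lookup (lin_ext (\<lambda>w. lin_ext (\<lambda>n. vnf (b # n)) (vnf w)) x) [] = 0"
    by (simp add: lookup_lin_ext)
  moreover have "project (word [b] * project x) = lin_ext (\<lambda>w. lin_ext (\<lambda>n. vnf (b # n)) (vnf w)) x"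
  proof -
    have "project (word [b] * y) = lin_ext (\<lambda>n. vnf (b # n)) y" for y
      using lin_ext_mult_right[of "word [b]" word y] by (simp add: project_lin_ext)
    then show ?thesis
      by (simp add: project_def lin_ext_lin_ext)
  qed
  ultimately show ?thesis by simp
qed

end

section \<open>The enveloping algebra as a quotient of the tensor algebra\<close>

lemma tensor_alg_simps [simp]:
  "carrier tensor_alg = UNIV" "x \<otimes>\<^bsub>tensor_alg\<^esub> y = x * y" "\<one>\<^bsub>tensor_alg\<^esub> = 1"
  "\<zero>\<^bsub>tensor_alg\<^esub> = 0" "x \<oplus>\<^bsub>tensor_alg\<^esub> y = x + y"
  by (simp_all add: tensor_alg_def ring_of_type_algebra_def)

lemma ideal_uea_ideal: "ideal (uea_ideal br) tensor_alg"
  unfolding uea_ideal_def by (intro ring.genideal_ideal ring_tensor_alg) simp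

definition uea_proj :: "'b lie_bracket \<Rightarrow> ('b list \<Rightarrow>\<^sub>0 complex) \<Rightarrow> ('b list \<Rightarrow>\<^sub>0 complex) set" where
  "uea_proj br x = uea_ideal br +>\<^bsub>tensor_alg\<^esub> x"

lemma uea_proj_hom: "ring_hom_ring tensor_alg (uea br) (uea_proj br)"
  using ideal.rcos_ring_hom_ring[OF ideal_uea_ideal[of br]]
  by (simp add: uea_def uea_proj_def[abs_def])

lemma carrier_uea: "carrier (uea br) = range (uea_proj br)"
  by (auto simp: uea_def FactRing_def A_RCOSETS_def' uea_proj_def)

lemma uea_proj_simps [simp]:
  "uea_proj br x \<in> carrier (uea br)"
  "uea_proj br (x + y) = uea_proj br x \<oplus>\<^bsub>uea br\<^esub> uea_proj br y"
  "uea_proj br (x * y) = uea_proj br x \<otimes>\<^bsub>uea br\<^esub> uea_proj br y"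
  "uea_proj br 0 = \<zero>\<^bsub>uea br\<^esub>"
proof -
  interpret ring_hom_ring tensor_alg "uea br" "uea_proj br" by (rule uea_proj_hom)
  show "uea_proj br x \<in> carrier (uea br)"
    "uea_proj br (x + y) = uea_proj br x \<oplus>\<^bsub>uea br\<^esub> uea_proj br y"
    "uea_proj br (x * y) = uea_proj br x \<otimes>\<^bsub>uea br\<^esub> uea_proj br y"
    "uea_proj br 0 = \<zero>\<^bsub>uea br\<^esub>"
    using hom_closed[of x] hom_add[of x y] hom_mult[of x y] hom_zero by simp_all
qed

lemma uea_proj_diff: "uea_proj br (x - y) = uea_proj br x \<ominus>\<^bsub>uea br\<^esub> uea_proj br y"
proof -
  interpret ring "uea br" by (rule ring_uea)
  have "uea_proj br (x - y) \<oplus>\<^bsub>uea br\<^esub> uea_proj br y = uea_proj br x"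
    by (simp flip: uea_proj_simps(2))
  then show ?thesis
    by (metis add.m_closed add.inv_solve_right' uea_proj_simps(1) a_minus_def)
qed

lemma uea_proj_eq_zero_iff: "uea_proj br x = \<zero>\<^bsub>uea br\<^esub> \<longleftrightarrow> x \<in> uea_ideal br"
proof -
  interpret ideal "uea_ideal br" tensor_alg by (rule ideal_uea_ideal)
  have "x \<in> uea_proj br x"
    using a_rcos_self[of x] by (simp add: uea_proj_def)
  then have "x \<in> uea_ideal br" if "uea_proj br x = \<zero>\<^bsub>uea br\<^esub>"
    using that by (simp add: uea_def FactRing_def)
  moreover have "uea_proj br x = \<zero>\<^bsub>uea br\<^esub>" if "x \<in> uea_ideal br"
    using a_rcos_const[OF that] by (simp add: uea_def FactRing_def uea_proj_def)
  ultimately show ?thesis by blast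
qed

text \<open>\<open>M\<close> is only a left ideal, so it is replaced by the set of elements all of
  whose two-sided multiples lie in \<open>M\<close>. This is a two-sided ideal inside
  \<open>M\<close>, and it contains the generators by assumption.\<close>

lemma uea_ideal_minimal:
  fixes br :: "'b lie_bracket"
  assumes "\<And>x y a b. a * (tensor_incl x * tensor_incl y - tensor_incl y * tensor_incl x - tensor_incl (br x y)) * b \<in> M"
    and M: "lideal M"
  shows "uea_ideal br \<subseteq> M"
proof -
  let ?J = "{t. \<forall>a b. a * t * b \<in> M}"
  interpret ring "tensor_alg :: ('b list \<Rightarrow>\<^sub>0 complex) ring" by (rule ring_tensor_alg)
  have neg: "\<ominus>\<^bsub>tensor_alg\<^esub> t = - t" for t :: "'b list \<Rightarrow>\<^sub>0 complex"
    using minus_equality[of "- t" t] by simp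
  have "ideal ?J tensor_alg"
  proof (rule idealI)
    show "subgroup ?J (add_monoid tensor_alg)"
    proof
      fix x :: "'b list \<Rightarrow>\<^sub>0 complex"
      assume "x \<in> ?J"
      then show "inv\<^bsub>add_monoid tensor_alg\<^esub> x \<in> ?J"
        using neg[of x] lideal_uminus[OF M] by (simp add: a_inv_def)
    next
      fix x y :: "'b list \<Rightarrow>\<^sub>0 complex"
      assume "x \<in> ?J" "y \<in> ?J"
      then show "x \<otimes>\<^bsub>add_monoid tensor_alg\<^esub> y \<in> ?J"
        using M by (simp add: distrib_left distrib_right lideal_def)
    qed (use M in \<open>simp_all add: lideal_def\<close>)
    fix a x :: "'b list \<Rightarrow>\<^sub>0 complex"
    assume "a \<in> ?J"
    then show "x \<otimes>\<^bsub>tensor_alg\<^esub> a \<in> ?J" "a \<otimes>\<^bsub>tensor_alg\<^esub> x \<in> ?J"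
      by (simp_all add: mult.assoc) (simp flip: mult.assoc)
  qed (rule ring_tensor_alg)
  then have "uea_ideal br \<subseteq> ?J"
    unfolding uea_ideal_def by (rule genideal_minimal) (use assms(1) in auto)
  moreover have "?J \<subseteq> M" by (metis (mono_tags, lifting) mem_Collect_eq mult_1 mult_1_right subsetI)
  ultimately show ?thesis by blast
qed

lemma uea_ideal_relation:
  "a * (tensor_incl x * tensor_incl y - tensor_incl y * tensor_incl x - tensor_incl (br x y)) * b \<in> uea_ideal br"
proof -
  interpret ideal "uea_ideal br" tensor_alg by (rule ideal_uea_ideal)
  have "tensor_incl x * tensor_incl y - tensor_incl y * tensor_incl x - tensor_incl (br x y) \<in> uea_ideal br"
    unfolding uea_ideal_def by (rule subsetD[OF genideal_self]) auto
  from I_r_closed[OF I_l_closed[OF this, of a], of b] show ?thesis by simp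
qed

lemma left_ideal_image:
  assumes M: "lideal M"
  shows "left_ideal (uea_proj br ` M) (uea br)"
proof -
  interpret U: ring "uea br" by (rule ring_uea)
  have "subgroup (uea_proj br ` M) (add_monoid (uea br))"
  proof (rule U.add.subgroupI)
    fix a assume "a \<in> uea_proj br ` M"
    then obtain x where x: "x \<in> M" "a = uea_proj br x" by blast
    have "\<ominus>\<^bsub>uea br\<^esub> a = uea_proj br (- x)"
      using uea_proj_diff[of br 0 x] x by (simp add: a_minus_def)
    then show "\<ominus>\<^bsub>uea br\<^esub> a \<in> uea_proj br ` M"
      using x lideal_uminus[OF M] by auto
  next
    fix a b assume "a \<in> uea_proj br ` M" "b \<in> uea_proj br ` M"
    then show "a \<oplus>\<^bsub>uea br\<^esub> b \<in> uea_proj br ` M"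
      using M by (auto simp: lideal_def simp flip: uea_proj_simps(2))
  qed (use M in \<open>auto simp: lideal_def\<close>)
  then show ?thesis
    by (intro left_ideal.intro additive_subgroup.intro left_ideal_axioms.intro ring_uea)
       (use M in \<open>auto simp: carrier_uea lideal_def simp flip: uea_proj_simps(3)\<close>)
qed

lemma lideal_vimage:
  assumes "left_ideal I (uea br)"
  shows "lideal (uea_proj br -` I)"
proof -
  interpret left_ideal I "uea br" by (rule assms)
  show ?thesis
    by (auto simp: lideal_def a_closed l_closed)
qed

lemma left_ideal_gen_left_ideal:
  assumes "S \<subseteq> carrier (uea br)"
  shows "left_ideal (gen_left_ideal (uea br) S) (uea br)"
proof -
  interpret U: ring "uea br" by (rule ring_uea)
  let ?F = "{I. left_ideal I (uea br) \<and> S \<subseteq> I}"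
  have "left_ideal (uea_proj br ` UNIV) (uea br)"
    by (rule left_ideal_image) (simp add: lideal_def)
  then have ne: "?F \<noteq> {}"
    using assms by (auto simp: carrier_uea)
  have "subgroup (\<Inter>?F) (add_monoid (uea br))"
    by (rule U.add.subgroups_Inter[OF _ ne]) (auto simp: left_ideal_def additive_subgroup_def)
  then show ?thesis
    unfolding gen_left_ideal_def
    by (intro left_ideal.intro additive_subgroup.intro left_ideal_axioms.intro ring_uea)
       (auto intro: left_ideal.l_closed)
qed

text \<open>Pulled back to the tensor algebra, where membership can be tested by
  \<open>project\<close>.\<close>

definition gen_lideal :: "'b lie_bracket \<Rightarrow> ('b list \<Rightarrow>\<^sub>0 complex) set \<Rightarrow> ('b list \<Rightarrow>\<^sub>0 complex) set" where
  "gen_lideal br S = uea_proj br -` gen_left_ideal (uea br) (uea_proj br ` S)"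

lemma lideal_gen_lideal: "lideal (gen_lideal br S)"
  unfolding gen_lideal_def by (intro lideal_vimage left_ideal_gen_left_ideal) auto

lemma uea_ideal_subset_gen_lideal: "uea_ideal br \<subseteq> gen_lideal br S"
proof
  interpret left_ideal "gen_left_ideal (uea br) (uea_proj br ` S)" "uea br"
    by (intro left_ideal_gen_left_ideal) auto
  fix x assume "x \<in> uea_ideal br"
  then show "x \<in> gen_lideal br S"
    by (simp add: gen_lideal_def uea_proj_eq_zero_iff[THEN iffD2])
qed

lemma subset_gen_lideal: "S \<subseteq> gen_lideal br S"
  by (auto simp: gen_lideal_def gen_left_ideal_def)

lemma gen_lideal_minimal:
  assumes "lideal M" "uea_ideal br \<subseteq> M" "S \<subseteq> M"
  shows "gen_lideal br S \<subseteq> M"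
proof
  fix x assume "x \<in> gen_lideal br S"
  then have "uea_proj br x \<in> uea_proj br ` M"
    using left_ideal_image[OF assms(1), of br] assms(3) by (auto simp: gen_lideal_def gen_left_ideal_def)
  then obtain y where y: "y \<in> M" "uea_proj br x = uea_proj br y" by blast
  interpret U: ring "uea br" by (rule ring_uea)
  \<comment> \<open>Equal images differ by an element of the kernel, which \<open>M\<close>
    contains.\<close>
  have "x - y \<in> uea_ideal br"
    using y by (simp add: uea_proj_diff flip: uea_proj_eq_zero_iff)
  then have "(x - y) + y \<in> M"
    using assms y(1) unfolding lideal_def by blast
  then show "x \<in> M" by simp
qed

section \<open>Submodules of a quotient module\<close>

lemma (in left_ideal) quot_module_group: "group (add_monoid (quot_module R I))"
proof -
  interpret G: group "R A_Mod I" by (rule a_factorgroup_is_group)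
  show ?thesis
    by (rule groupI) (use G.m_closed G.m_assoc G.l_inv_ex G.one_closed G.l_one in
      \<open>simp_all add: quot_module_def A_FactGroup_def'\<close>)
qed

lemma (in left_ideal) coset_eq_self_iff: "x \<in> carrier R \<Longrightarrow> I +> x = I \<longleftrightarrow> x \<in> I"
  using a_rcos_self a_rcos_const by blast

text \<open>The correspondence theorem: along \<open>p\<close>, submodules of the quotient
  correspond to the left ideals of the tensor algebra that contain the preimage of
  \<open>I\<close>.\<close>

lemma irreducible_quot_module_iff:
  fixes br :: "'b lie_bracket"
  assumes I: "left_ideal I (uea br)"
  shows "irreducible_module (uea br) (quot_module (uea br) I) \<longleftrightarrow>
    uea_proj br -` I \<noteq> UNIV \<and>
    (\<forall>N. lideal N \<longrightarrow> uea_proj br -` I \<subseteq> N \<longrightarrow> N = uea_proj br -` I \<or> N = UNIV)"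
proof -
  interpret left_ideal I "uea br" by (rule I)
  let ?M = "quot_module (uea br) I" and ?L = "uea_proj br -` I"
  interpret M: group "add_monoid ?M" by (rule quot_module_group)
  define p where "p x = I +>\<^bsub>uea br\<^esub> uea_proj br x" for x
  have carrier: "carrier ?M = range p"
    by (auto simp: quot_module_def A_RCOSETS_def' carrier_uea p_def)
  have p_zero: "p x = \<zero>\<^bsub>?M\<^esub> \<longleftrightarrow> x \<in> ?L" for x
    using coset_eq_self_iff[of "uea_proj br x"] by (simp add: p_def quot_module_def)
  have p_add: "p (x + y) = p x \<oplus>\<^bsub>?M\<^esub> p y" for x y
    using a_rcos_sum[of "uea_proj br x" "uea_proj br y"] by (simp add: p_def quot_module_def)
  have p_mult: "p (x * y) = uea_proj br x \<odot>\<^bsub>?M\<^esub> p y" for x y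
    using quot_module_smult[of "uea_proj br x" "uea_proj br y"] by (simp add: p_def)
  have L: "lideal ?L" by (rule lideal_vimage[OF I])
  have p_0: "p 0 = \<zero>\<^bsub>?M\<^esub>"
    using p_zero[of 0] L by (simp add: lideal_def del: vimage_eq)
  have p_uminus: "inv\<^bsub>add_monoid ?M\<^esub> p x = p (- x)" for x
    by (rule M.inv_equality) (use p_add[of "- x" x] p_0 carrier in auto)
  have trivial: "carrier ?M = {\<zero>\<^bsub>?M\<^esub>} \<longleftrightarrow> ?L = UNIV"
  proof -
    have "range p = {\<zero>\<^bsub>?M\<^esub>} \<longleftrightarrow> (\<forall>x. p x = \<zero>\<^bsub>?M\<^esub>)"
    proof
      assume *: "range p = {\<zero>\<^bsub>?M\<^esub>}"
      show "\<forall>x. p x = \<zero>\<^bsub>?M\<^esub>"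
      proof
        fix x
        have "p x \<in> range p" by (rule rangeI)
        then show "p x = \<zero>\<^bsub>?M\<^esub>" unfolding * by (rule singletonD)
      qed
    qed (simp add: image_constant_conv)
    also have "\<dots> \<longleftrightarrow> ?L = UNIV"
      unfolding p_zero by blast
    finally show ?thesis unfolding carrier .
  qed
  have submodule_image: "submodule (p ` N) (uea br) ?M" if N: "lideal N" for N
  proof (intro submodule.intro submodule_axioms.intro M.subgroupI)
    show "p ` N \<subseteq> carrier (add_monoid ?M)" by (auto simp: carrier)
    show "p ` N \<noteq> {}" using N by (auto simp: lideal_def)
    show "inv\<^bsub>add_monoid ?M\<^esub> a \<in> p ` N" if "a \<in> p ` N" for a
      using that lideal_uminus[OF N] by (auto simp: p_uminus)
    show "a \<otimes>\<^bsub>add_monoid ?M\<^esub> b \<in> p ` N" if "a \<in> p ` N" "b \<in> p ` N" for a b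
      using that N by (auto simp: lideal_def simp flip: p_add)
    show "a \<odot>\<^bsub>?M\<^esub> x \<in> p ` N" if "a \<in> carrier (uea br)" "x \<in> p ` N" for a x
      using that N by (auto simp: lideal_def carrier_uea simp flip: p_mult)
  qed
  have lideal_preimage: "lideal (p -` N)" if N: "submodule N (uea br) ?M" for N
  proof -
    interpret submodule N "uea br" ?M by (rule N)
    show ?thesis
      using one_closed m_closed by (auto simp: lideal_def p_0 p_add p_mult smult_closed)
  qed
  show ?thesis
  proof
    assume irr: "irreducible_module (uea br) ?M"
    then have "?L \<noteq> UNIV" by (simp add: irreducible_module_def trivial)
    moreover have "N = ?L \<or> N = UNIV" if N: "lideal N" "?L \<subseteq> N" for N
    proof -
      have "p ` N = {\<zero>\<^bsub>?M\<^esub>} \<or> p ` N = carrier ?M"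
        using irr submodule_image[OF N(1)] by (simp add: irreducible_module_def)
      then show ?thesis
      proof
        assume "p ` N = {\<zero>\<^bsub>?M\<^esub>}"
        then have "p x = \<zero>\<^bsub>?M\<^esub>" if "x \<in> N" for x
          using imageI[OF that, of p] by simp
        then have "N \<subseteq> ?L" unfolding p_zero by (rule subsetI)
        then show ?thesis using N(2) by simp
      next
        assume *: "p ` N = carrier ?M"
        have "x \<in> N" for x
        proof -
          obtain y where y: "y \<in> N" "p x = p y"
            using * carrier by (metis imageE rangeI)
          have "p (x - y) = \<zero>\<^bsub>?M\<^esub>"
            using p_add[of x "- y"] p_add[of y "- y"] y p_0 by simp
          then have "(x - y) + y \<in> N"
            using p_zero N y(1) unfolding lideal_def by blast
          then show ?thesis by simp
        qed
        then show ?thesis by blast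
      qed
    qed
    ultimately show "?L \<noteq> UNIV \<and> (\<forall>N. lideal N \<longrightarrow> ?L \<subseteq> N \<longrightarrow> N = ?L \<or> N = UNIV)"
      by blast
  next
    assume *: "?L \<noteq> UNIV \<and> (\<forall>N. lideal N \<longrightarrow> ?L \<subseteq> N \<longrightarrow> N = ?L \<or> N = UNIV)"
    have "carrier ?M \<noteq> {\<zero>\<^bsub>?M\<^esub>}"
      using * by (simp add: trivial)
    moreover have "N = {\<zero>\<^bsub>?M\<^esub>} \<or> N = carrier ?M" if N: "submodule N (uea br) ?M" for N
    proof -
      interpret submodule N "uea br" ?M by (rule N)
      have sub: "N \<subseteq> range p" and zero: "\<zero>\<^bsub>?M\<^esub> \<in> N"
        using subset one_closed carrier by auto
      have "?L \<subseteq> p -` N" using p_zero zero by auto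
      with * lideal_preimage[OF N] have "p -` N = ?L \<or> p -` N = UNIV" by blast
      then show ?thesis
      proof
        assume "p -` N = ?L"
        then have "p x \<in> N \<Longrightarrow> p x = \<zero>\<^bsub>?M\<^esub>" for x
          unfolding p_zero by (simp add: set_eq_iff)
        then have "N \<subseteq> {\<zero>\<^bsub>?M\<^esub>}" using sub by auto
        then show ?thesis using zero by auto
      next
        assume "p -` N = UNIV"
        then have "p x \<in> N" for x by (simp add: set_eq_iff)
        then have "range p \<subseteq> N" by (rule image_subsetI)
        then show ?thesis using sub carrier by simp
      qed
    qed
    ultimately show "irreducible_module (uea br) ?M"
      by (simp add: irreducible_module_def)
  qed
qed

section \<open>Highest weight representations\<close>

locale W22_rep = vector_space scl
  for scl :: "complex \<Rightarrow> 'v::ab_group_add \<Rightarrow> 'v" (infixr \<open>\<star>\<close> 75) +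
  fixes l w :: "int \<Rightarrow> 'v \<Rightarrow> 'v" and z :: "'v \<Rightarrow> 'v"
  assumes l_add: "l m (x + y) = l m x + l m y" and l_scale: "l m (a \<star> x) = a \<star> l m x"
    and w_add: "w m (x + y) = w m x + w m y" and w_scale: "w m (a \<star> x) = a \<star> w m x"
    and z_add: "z (x + y) = z x + z y" and z_scale: "z (a \<star> x) = a \<star> z x"
    and ll: "l m (l n x) = l n (l m x) + of_int (m - n) \<star> l (m + n) x + cocycle m n \<star> z x"
    and lw: "l m (w n x) = w n (l m x) + of_int (m - n) \<star> w (m + n) x + cocycle m n \<star> z x"
    and ww: "w m (w n x) = w n (w m x)"
    and zl: "z (l m x) = l m (z x)" and zw: "z (w m x) = w m (z x)"
begin

definition lin :: "('v \<Rightarrow> 'v) \<Rightarrow> bool" where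
  "lin f \<longleftrightarrow> (\<forall>x y. f (x + y) = f x + f y) \<and> (\<forall>a x. f (a \<star> x) = a \<star> f x)"

lemma lin_addD: "lin f \<Longrightarrow> f (x + y) = f x + f y"
  and lin_scaleD: "lin f \<Longrightarrow> f (b \<star> x) = b \<star> f x"
  by (simp_all add: lin_def)

lemma lin_zeroD: "lin f \<Longrightarrow> f 0 = 0"
  unfolding lin_def by (metis scale_zero_left)

lemma lin_uminusD: "lin f \<Longrightarrow> f (- x) = - f x"
  unfolding lin_def by (metis scale_minus_left scale_one)

lemma lin_diffD: "lin f \<Longrightarrow> f (x - y) = f x - f y"
  using lin_uminusD[of f y] unfolding lin_def by (metis diff_conv_add_uminus)

lemma lin_sumD: "lin f \<Longrightarrow> f (sum g A) = (\<Sum>a\<in>A. f (g a))"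
  by (induction A rule: infinite_finite_induct) (auto simp: lin_zeroD, simp add: lin_def)

lemma lin_lwz [simp, intro]: "lin (l m)" "lin (w m)" "lin z"
  by (simp_all add: lin_def l_add l_scale w_add w_scale z_add z_scale)

lemma lin_id [simp, intro]: "lin (\<lambda>x. x)"
  by (simp add: lin_def)

lemma lin_star [simp, intro]: "lin ((\<star>) b)"
  by (simp add: lin_def algebra_simps)

lemma lin_compose: "lin f \<Longrightarrow> lin g \<Longrightarrow> lin (\<lambda>x. f (g x))"
  by (simp add: lin_def)

lemma lin_diff: "lin f \<Longrightarrow> lin g \<Longrightarrow> lin (\<lambda>x. f x - g x)"
  by (simp add: lin_def algebra_simps)

lemma lin_scale: "lin f \<Longrightarrow> lin (\<lambda>x. a \<star> f x)"
  by (simp add: lin_def algebra_simps)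

lemma lin_sum_fun: "(\<And>i. i \<in> A \<Longrightarrow> lin (f i)) \<Longrightarrow> lin (\<lambda>x. \<Sum>i\<in>A. f i x)"
  by (simp add: lin_def sum.distrib scale_sum_right)

lemmas l_simps = lin_zeroD[OF lin_lwz(1)] lin_diffD[OF lin_lwz(1)] lin_uminusD[OF lin_lwz(1)] l_add l_scale
lemmas w_simps = lin_zeroD[OF lin_lwz(2)] lin_diffD[OF lin_lwz(2)] lin_uminusD[OF lin_lwz(2)] w_add w_scale

lemma lin_span:
  assumes "lin f" "subspace T" "x \<in> span B" "\<And>b. b \<in> B \<Longrightarrow> f b \<in> T"
  shows "f x \<in> T"
  using assms(3)
proof (induction rule: span_induct)
  case base
  show ?case
    using assms(1,2) by (auto simp: subspace_def lin_zeroD) (simp_all add: lin_def)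
qed (rule assms(4))

lemma lin_span_eq:
  assumes "lin f" "lin g" "x \<in> span B" "\<And>b. b \<in> B \<Longrightarrow> f b = g b"
  shows "f x = g x"
  using lin_span[of "\<lambda>x. f x - g x" "{0}" x B] lin_diff[OF assms(1,2)] assms(3,4)
  by (auto simp: subspace_single_0)

text \<open>Only finitely many vectors enter a linear combination, and since the sets increase, one
  of them contains all these vectors.\<close>

lemma span_chain:
  assumes "x \<in> span (\<Union>n. C n)" "\<And>m n. m \<le> n \<Longrightarrow> C m \<subseteq> C n"
  shows "\<exists>n::nat. x \<in> span (C n)"
  using assms(1)
proof (induction rule: span_induct_alt)
  case (step a x y)
  then obtain m n where "x \<in> C m" "y \<in> span (C n)" by blast
  then have "x \<in> span (C (max m n))" "y \<in> span (C (max m n))"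
    using assms(2)[of m "max m n"] span_mono[OF assms(2)[of n "max m n"]]
    by (auto intro: span_base)
  then show ?case by (metis span_add span_scale)
qed (auto intro: span_zero)

lemma w_l: "w k (l (- i) x) = l (- i) (w k x) + of_int (k + i) \<star> w (k - i) x - cocycle (- i) k \<star> z x"
  using lw[of "- i" k x] by (simp add: algebra_simps)

lemma l_w: "l k (w (- i) x) = w (- i) (l k x) + of_int (k + i) \<star> w (k - i) x + cocycle k (- i) \<star> z x"
  using lw[of k "- i" x] by simp

lemma l_l: "l k (l (- i) x) = l (- i) (l k x) + of_int (k + i) \<star> l (k - i) x + cocycle k (- i) \<star> z x"
  using ll[of k "- i" x] by simp

text \<open>Modes are negated, so that words in creation modes are given by lists of positive
  numbers.\<close>

definition lword :: "int list \<Rightarrow> 'v \<Rightarrow> 'v" where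
  "lword \<mu> x = foldr (\<lambda>i. l (- i)) \<mu> x"

definition wword :: "int list \<Rightarrow> 'v \<Rightarrow> 'v" where
  "wword \<mu> x = foldr (\<lambda>i. w (- i)) \<mu> x"

lemma lword_simps [simp]: "lword [] x = x" "lword (i # \<mu>) x = l (- i) (lword \<mu> x)"
  by (simp_all add: lword_def)

lemma wword_simps [simp]: "wword [] x = x" "wword (i # \<mu>) x = w (- i) (wword \<mu> x)"
  by (simp_all add: wword_def)

end

text \<open>The vector \<open>v\<close> need not generate the space: the locale is used for the
  vacuum and for a singular vector inside the same representation.\<close>

locale W22_hw = W22_rep scl l w z
  for scl :: "complex \<Rightarrow> 'v::ab_group_add \<Rightarrow> 'v" (infixr \<open>\<star>\<close> 75) and l w z +
  fixes v :: 'v and c h1 h2 :: complex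
  assumes l_hw: "k > 0 \<Longrightarrow> l k v = 0" and w_hw: "k > 0 \<Longrightarrow> w k v = 0"
    and l0_hw: "l 0 v = h1 \<star> v" and w0_hw: "w 0 v = h2 \<star> v" and z_hw: "z v = c \<star> v"
begin

definition S :: "'v set" where
  "S = span {wword \<mu> v | \<mu>. \<forall>i\<in>set \<mu>. 0 < i}"

text \<open>The bound on the number of \<open>L\<close>'s is strict: \<open>F 0 = {0}\<close> and \<open>F 1 = S\<close>.\<close>

definition F :: "nat \<Rightarrow> 'v set" where
  "F d = span {lword \<mu> s | \<mu> s. (\<forall>i\<in>set \<mu>. 0 < i) \<and> length \<mu> < d \<and> s \<in> S}"

definition \<kappa> :: "int \<Rightarrow> complex" where
  "\<kappa> n = 2 * of_int n * h2 + (of_int n ^ 3 - of_int n) / 12 * c"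

lemma subspace_S [simp]: "subspace S" and subspace_F [simp]: "subspace (F d)"
  by (simp_all add: S_def F_def)

lemma wword_in_S: "\<forall>i\<in>set \<mu>. 0 < i \<Longrightarrow> wword \<mu> v \<in> S"
  unfolding S_def by (rule span_base) blast

lemma v_in_S: "v \<in> S"
  using wword_in_S[of "[]"] by simp

lemma z_S: "s \<in> S \<Longrightarrow> z s = c \<star> s"
  unfolding S_def
proof (erule lin_span_eq[rotated 2])
  fix b assume "b \<in> {wword \<mu> v | \<mu>. \<forall>i\<in>set \<mu>. 0 < i}"
  then obtain \<mu> where "b = wword \<mu> v" by blast
  moreover have "z (wword \<mu> v) = c \<star> wword \<mu> v"
    by (induction \<mu>) (simp_all add: z_hw zw w_scale)
  ultimately show "z b = c \<star> b" by simp
qed auto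

lemma w_neg_S: "i > 0 \<Longrightarrow> s \<in> S \<Longrightarrow> w (- i) s \<in> S"
  unfolding S_def
proof (erule lin_span[rotated 2])
  fix b assume "b \<in> {wword \<mu> v | \<mu>. \<forall>i\<in>set \<mu>. 0 < i}" "i > 0"
  then obtain \<mu> where "b = wword \<mu> v" "\<forall>i\<in>set \<mu>. 0 < i" by blast
  then show "w (- i) b \<in> span {wword \<mu> v | \<mu>. \<forall>i\<in>set \<mu>. 0 < i}"
    using wword_in_S[of "i # \<mu>"] \<open>i > 0\<close> by (simp add: S_def)
qed auto

text \<open>All \<open>w\<close> modes commute, so \<open>w k\<close> moves through a word until it
  meets \<open>v\<close>.\<close>

lemma w_pos_S: "k > 0 \<Longrightarrow> s \<in> S \<Longrightarrow> w k s = 0"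
  unfolding S_def
proof (erule lin_span_eq[rotated 2])
  fix b assume "b \<in> {wword \<mu> v | \<mu>. \<forall>i\<in>set \<mu>. 0 < i}" "k > 0"
  then obtain \<mu> where "b = wword \<mu> v" by blast
  moreover have "w k (wword \<mu> v) = 0"
    by (induction \<mu>) (simp_all add: w_hw \<open>k > 0\<close> ww[of k] w_simps)
  ultimately show "w k b = 0" by simp
qed (auto simp: lin_def w_simps)

lemma w0_S: "s \<in> S \<Longrightarrow> w 0 s = h2 \<star> s"
  unfolding S_def
proof (erule lin_span_eq[rotated 2])
  fix b assume "b \<in> {wword \<mu> v | \<mu>. \<forall>i\<in>set \<mu>. 0 < i}"
  then obtain \<mu> where "b = wword \<mu> v" by blast
  moreover have "w 0 (wword \<mu> v) = h2 \<star> wword \<mu> v"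
    by (induction \<mu>) (simp_all add: w0_hw ww[of 0] w_simps)
  ultimately show "w 0 b = h2 \<star> b" by simp
qed auto

lemma w_S: "s \<in> S \<Longrightarrow> w k s \<in> S"
  using w_neg_S[of "- k" s] w0_S[of s] w_pos_S[of k s]
  by (cases "k < 0"; cases "k = 0") (auto simp: subspace_scale subspace_0)

text \<open>Commutators of \<open>l k\<close> with \<open>w\<close> modes consist of
  \<open>w\<close> modes and scalars, and these preserve \<open>S\<close>.\<close>

lemma l_S: "k \<ge> 0 \<Longrightarrow> s \<in> S \<Longrightarrow> l k s \<in> S"
proof -
  assume "k \<ge> 0" "s \<in> S"
  have "l k (wword \<mu> v) \<in> S" if "\<forall>i\<in>set \<mu>. 0 < i" for \<mu>
    using that
  proof (induction \<mu>)
    case Nil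
    then show ?case
      using \<open>k \<ge> 0\<close> l_hw[of k] v_in_S by (cases "k = 0") (simp_all add: l0_hw subspace_scale subspace_0)
  next
    case (Cons i \<mu>)
    then have "wword \<mu> v \<in> S" "w (- i) (l k (wword \<mu> v)) \<in> S"
      by (simp_all add: wword_in_S w_neg_S)
    then show ?case
      by (simp add: l_w z_S w_S subspace_add subspace_scale)
  qed
  then show ?thesis
    using \<open>s \<in> S\<close> lin_span[of "l k" S s "{wword \<mu> v | \<mu>. \<forall>i\<in>set \<mu>. 0 < i}"]
    by (auto simp: S_def)
qed

lemma lword_in_F: "\<forall>i\<in>set \<mu>. 0 < i \<Longrightarrow> length \<mu> < d \<Longrightarrow> s \<in> S \<Longrightarrow> lword \<mu> s \<in> F d"
  unfolding F_def by (rule span_base) blast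

lemma F_0: "F 0 = {0}"
  by (simp add: F_def)

lemma F_1: "F (Suc 0) = S"
proof -
  have "{lword \<mu> s | \<mu> s. (\<forall>i\<in>set \<mu>. 0 < i) \<and> length \<mu> < Suc 0 \<and> s \<in> S} = S"
    by force
  then show ?thesis
    by (simp add: F_def span_eq_iff[THEN iffD2])
qed

lemma F_mono: "d \<le> e \<Longrightarrow> F d \<subseteq> F e"
  unfolding F_def by (rule span_mono) force

lemma F_Suc: "x \<in> F d \<Longrightarrow> x \<in> F (Suc d)"
  using F_mono[of d "Suc d"] by auto

lemma lin_F:
  assumes "lin f" "subspace T" "x \<in> F d"
    "\<And>\<mu> s. \<forall>i\<in>set \<mu>. 0 < i \<Longrightarrow> length \<mu> < d \<Longrightarrow> s \<in> S \<Longrightarrow> f (lword \<mu> s) \<in> T"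
  shows "f x \<in> T"
  using assms(1,2) assms(3)[unfolded F_def] by (rule lin_span) (use assms(4) in blast)

lemma l_neg_F: "i > 0 \<Longrightarrow> x \<in> F d \<Longrightarrow> l (- i) x \<in> F (Suc d)"
  by (rule lin_F[of "l (- i)" _ x d]) (use lword_in_F[of "i # \<mu>" "Suc d" for \<mu>] in auto)

lemma z_lword: "s \<in> S \<Longrightarrow> z (lword \<mu> s) = c \<star> lword \<mu> s"
  by (induction \<mu>) (simp_all add: z_S zl l_scale)

lemma z_F: "x \<in> F e \<Longrightarrow> z x = c \<star> x"
  unfolding F_def by (erule lin_span_eq[rotated 2]) (auto simp: z_lword)

text \<open>Commuting \<open>w k\<close> past an \<open>l\<close> replaces that \<open>l\<close> by
  a \<open>w\<close> or a scalar, so every correction has fewer \<open>l\<close>'s. The leading term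
  ends in \<open>S\<close>, where positive \<open>w\<close> modes vanish and \<open>w 0\<close> is
  the scalar \<open>h2\<close>. The claims are proved together because \<open>w (k - i)\<close> can
  have any sign.\<close>

lemma w_lword:
  assumes s: "s \<in> S" and "\<forall>i\<in>set \<mu>. 0 < i"
  shows "w k (lword \<mu> s) \<in> F (Suc (length \<mu>))"
    and "k > 0 \<Longrightarrow> w k (lword \<mu> s) \<in> F (length \<mu>)"
    and "w 0 (lword \<mu> s) - h2 \<star> lword \<mu> s \<in> F (length \<mu>)"
proof -
  have "(\<forall>k. w k (lword \<mu> s) \<in> F (Suc (length \<mu>))) \<and> (\<forall>k>0. w k (lword \<mu> s) \<in> F (length \<mu>)) \<and>
      w 0 (lword \<mu> s) - h2 \<star> lword \<mu> s \<in> F (length \<mu>)"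
    using assms(2)
  proof (induction \<mu>)
    case Nil
    then show ?case
      using s by (simp add: w_pos_S w0_S w_S F_1 subspace_0)
  next
    case (Cons i \<mu>)
    define t where "t = lword \<mu> s"
    have t: "t \<in> F (Suc (length \<mu>))" "z t = c \<star> t"
      using Cons.prems s by (simp_all add: t_def lword_in_F z_lword)
    have IH: "w k t \<in> F (Suc (length \<mu>))" "k > 0 \<Longrightarrow> w k t \<in> F (length \<mu>)"
      "w 0 t - h2 \<star> t \<in> F (length \<mu>)" for k
      using Cons by (simp_all add: t_def)
    have rest: "of_int (k + i) \<star> w (k - i) t - (cocycle (- i) k * c) \<star> t \<in> F (Suc (length \<mu>))" for k
      using IH t by (intro subspace_diff subspace_scale) auto
    have eq: "w k (lword (i # \<mu>) s) =
        l (- i) (w k t) + (of_int (k + i) \<star> w (k - i) t - (cocycle (- i) k * c) \<star> t)" for k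
      using w_l[of k i t] t by (simp add: t_def)
    have "l (- i) (w k t) \<in> F (Suc (Suc (length \<mu>)))" for k
      using IH(1) Cons.prems by (intro l_neg_F) auto
    then have 1: "w k (lword (i # \<mu>) s) \<in> F (Suc (length (i # \<mu>)))" for k
      unfolding eq using F_Suc[OF rest[of k]] by (simp add: subspace_add)
    have "l (- i) (w k t) \<in> F (Suc (length \<mu>))" if "k > 0" for k
      using IH(2) that Cons.prems by (intro l_neg_F) auto
    then have 2: "w k (lword (i # \<mu>) s) \<in> F (length (i # \<mu>))" if "k > 0" for k
      unfolding eq using rest[of k] that by (simp add: subspace_add)
    have "l (- i) (w 0 t - h2 \<star> t) \<in> F (Suc (length \<mu>))"
      using IH(3) Cons.prems by (intro l_neg_F) auto
    then have "l (- i) (w 0 t - h2 \<star> t) + (of_int (0 + i) \<star> w (0 - i) t - (cocycle (- i) 0 * c) \<star> t)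
        \<in> F (Suc (length \<mu>))"
      using rest[of 0] by (intro subspace_add) auto
    then have "w 0 (lword (i # \<mu>) s) - h2 \<star> lword (i # \<mu>) s \<in> F (length (i # \<mu>))"
      unfolding eq by (simp add: t_def l_simps algebra_simps)
    with 1 2 show ?case by blast
  qed
  then show "w k (lword \<mu> s) \<in> F (Suc (length \<mu>))"
    "k > 0 \<Longrightarrow> w k (lword \<mu> s) \<in> F (length \<mu>)"
    "w 0 (lword \<mu> s) - h2 \<star> lword \<mu> s \<in> F (length \<mu>)" by auto
qed

lemma w_F: "x \<in> F d \<Longrightarrow> w k x \<in> F d"
  by (rule lin_F[of "w k" _ x d]) (auto intro: subsetD[OF F_mono w_lword(1)])

lemma w_pos_F: "k > 0 \<Longrightarrow> x \<in> F (Suc d) \<Longrightarrow> w k x \<in> F d"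
  by (rule lin_F[of "w k" _ x "Suc d"]) (auto intro: subsetD[OF F_mono w_lword(2)])

text \<open>A nonnegative mode passes \<open>l (- i)\<close> or merges with it into
  \<open>l (k - i)\<close>. If the latter is a negative mode, it merely takes the place of the lost
  \<open>l (- i)\<close>.\<close>

lemma l_nonneg_F:
  assumes "k \<ge> 0" "x \<in> F d"
  shows "l k x \<in> F d"
proof -
  have "\<forall>k\<ge>0. l k (lword \<mu> s) \<in> F (Suc (length \<mu>))" if "\<forall>i\<in>set \<mu>. 0 < i" "s \<in> S" for \<mu> s
    using that(1)
  proof (induction \<mu>)
    case Nil
    then show ?case using that by (simp add: l_S F_1)
  next
    case (Cons i \<mu>)
    define t where "t = lword \<mu> s"
    have t: "t \<in> F (Suc (length \<mu>))" "z t = c \<star> t"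
      using Cons.prems that by (simp_all add: t_def lword_in_F z_lword)
    have "l k (l (- i) t) \<in> F (Suc (Suc (length \<mu>)))" if "k \<ge> 0" for k
    proof -
      have 1: "l (- i) (l k t) \<in> F (Suc (Suc (length \<mu>)))"
        using Cons that by (intro l_neg_F) (simp_all add: t_def)
      have 2: "l (k - i) t \<in> F (Suc (Suc (length \<mu>)))"
      proof (cases "k - i \<ge> 0")
        case True
        then show ?thesis using Cons by (simp add: t_def F_Suc)
      next
        case False
        then show ?thesis using l_neg_F[of "i - k" t] t by simp
      qed
      show ?thesis
        unfolding l_l t(2)
        by (rule subspace_add[OF subspace_F subspace_add[OF subspace_F 1 subspace_scale[OF subspace_F 2]]
          subspace_scale[OF subspace_F subspace_scale[OF subspace_F F_Suc[OF t(1)]]]])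
    qed
    then show ?case by (simp add: t_def)
  qed
  then have "l k (lword \<mu> s) \<in> F d" if "\<forall>i\<in>set \<mu>. 0 < i" "length \<mu> < d" "s \<in> S" for \<mu> s
  proof -
    have "l k (lword \<mu> s) \<in> F (Suc (length \<mu>))"
      using \<open>\<And>s \<mu>. \<forall>i\<in>set \<mu>. 0 < i \<Longrightarrow> s \<in> S \<Longrightarrow> \<forall>k\<ge>0. l k (lword \<mu> s) \<in> F (Suc (length \<mu>))\<close>
        that assms(1) by blast
    then show ?thesis
      using F_mono[of "Suc (length \<mu>)" d] that(2) by auto
  qed
  then show ?thesis
    using assms(2) by (intro lin_F[of "l k" _ x d]) simp_all
qed

lemma F_closed: "x \<in> F d \<Longrightarrow> l k x \<in> F (Suc d)"
  using l_nonneg_F[of k x d] l_neg_F[of "- k" x d] by (cases "k \<ge> 0") (auto intro: F_Suc)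

text \<open>Only the outermost letter of a word matters, because negative modes send every vector
  into \<open>N\<close>. The intended \<open>N\<close> is the space of vectors without vacuum
  component.\<close>

lemma F_minimal:
  assumes N: "subspace N" "v \<in> N" "\<And>i x. i > 0 \<Longrightarrow> l (- i) x \<in> N" "\<And>i x. i > 0 \<Longrightarrow> w (- i) x \<in> N"
  shows "F d \<subseteq> N"
proof
  fix x assume "x \<in> F d"
  have "wword \<mu> v \<in> N" if "\<forall>i\<in>set \<mu>. 0 < i" for \<mu>
    using that N(2,4) by (cases \<mu>) auto
  then have "{wword \<mu> v | \<mu>. \<forall>i\<in>set \<mu>. 0 < i} \<subseteq> N"
    by blast
  then have S: "S \<subseteq> N"
    unfolding S_def by (rule span_minimal[OF _ N(1)])
  have "lword \<mu> s \<in> N" if "\<forall>i\<in>set \<mu>. 0 < i" "s \<in> S" for \<mu> s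
    using that N(3) subsetD[OF S] by (cases \<mu>) auto
  then show "x \<in> N"
    by (intro lin_F[OF lin_id N(1) \<open>x \<in> F d\<close>])
qed

text \<open>Expresses the cocycle through \<kappa>, so that \<open>2 n h2\<close> cancels against
  the contribution of \<open>w 0\<close>.\<close>

lemma cocycle_self: "cocycle (- n) n * c = 2 * of_int n * h2 - \<kappa> n"
  "cocycle n (- n) * c = \<kappa> n - 2 * of_int n * h2"
  by (simp_all add: cocycle_def \<kappa>_def field_simps)

text \<open>Only the factors \<open>l (- n)\<close> count. For \<open>i < n\<close> the commutator
  of \<open>w n\<close> with \<open>l (- i)\<close> is a positive mode, which removes another
  \<open>l\<close>, and the commutator of \<open>l (- n)\<close> with \<open>l (- i)\<close> merges
  two \<open>l\<close>'s. For \<open>i = n\<close> the commutator is, up to words with fewer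
  \<open>l\<close>'s, the scalar \<open>\<kappa> n\<close>.\<close>

lemma euler_lword:
  assumes s: "s \<in> S" and "n > 0" and "\<forall>i\<in>set \<mu>. 0 < i \<and> i \<le> n"
  shows "l (- n) (w n (lword \<mu> s)) - (of_nat (count_list \<mu> n) * \<kappa> n) \<star> lword \<mu> s \<in> F (length \<mu>)"
  using assms(3)
proof (induction \<mu>)
  case Nil
  then show ?case using s \<open>n > 0\<close> by (simp add: w_pos_S l_simps subspace_0)
next
  case (Cons i \<mu>)
  define t where "t = lword \<mu> s"
  define k where "k = of_nat (count_list \<mu> n) * \<kappa> n"
  have pos: "\<forall>i\<in>set \<mu>. 0 < i" and i: "0 < i" "i \<le> n" using Cons.prems by auto
  have t: "t \<in> F (Suc (length \<mu>))" "z t = c \<star> t"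
    using pos s by (simp_all add: t_def lword_in_F z_lword)
  have IH: "l (- n) (w n t) - k \<star> t \<in> F (length \<mu>)"
    using Cons by (simp add: t_def k_def)
  have wt: "w n t \<in> F (length \<mu>)"
    using w_lword(2)[OF s pos \<open>n > 0\<close>] by (simp add: t_def)
  have 1: "l (- i) (l (- n) (w n t) - k \<star> t) \<in> F (Suc (length \<mu>))"
    using IH i by (intro l_neg_F)
  show ?case
  proof (cases "i = n")
    case True
    have 2: "l (- n) (w 0 t - h2 \<star> t) \<in> F (Suc (length \<mu>))"
      using w_lword(3)[OF s pos] \<open>n > 0\<close> by (intro l_neg_F) (auto simp: t_def)
    have "l (- n) (w n (lword (i # \<mu>) s)) - (of_nat (count_list (i # \<mu>) n) * \<kappa> n) \<star> lword (i # \<mu>) s =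
      l (- i) (l (- n) (w n t) - k \<star> t) + (2 * of_int n) \<star> l (- n) (w 0 t - h2 \<star> t)"
      unfolding lword_simps t_def[symmetric] w_l t(2) scale_scale True cocycle_self
      by (simp add: l_simps k_def algebra_simps)
    then show ?thesis
      using 1 2 by (simp add: subspace_add subspace_scale)
  next
    case False
    have 2: "l (- n - i) (w n t) \<in> F (Suc (length \<mu>))"
      using l_neg_F[OF _ wt, of "n + i"] i \<open>n > 0\<close> by simp
    have "w (n - i) t \<in> F (length \<mu>)"
      using w_lword(2)[OF s pos, of "n - i"] i False by (simp add: t_def)
    then have 3: "l (- n) (w (n - i) t) \<in> F (Suc (length \<mu>))"
      using \<open>n > 0\<close> by (intro l_neg_F)
    have cocycle: "cocycle (- i) n = 0" "cocycle (- n) (- i) = 0"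
      using i False by (simp_all add: cocycle_def)
    have *: "l (- n) (l (- i) (w n t)) = l (- i) (l (- n) (w n t)) + of_int (i - n) \<star> l (- n - i) (w n t)"
      using ll[of "- n" "- i" "w n t"] by (simp add: cocycle)
    have "l (- n) (w n (lword (i # \<mu>) s)) - (of_nat (count_list (i # \<mu>) n) * \<kappa> n) \<star> lword (i # \<mu>) s =
      l (- i) (l (- n) (w n t) - k \<star> t) + of_int (i - n) \<star> l (- n - i) (w n t) +
        of_int (n + i) \<star> l (- n) (w (n - i) t)"
      unfolding lword_simps t_def[symmetric] w_l cocycle
      by (simp add: l_simps * k_def False)
    then show ?thesis
      using 1 2 3 by (simp add: subspace_add subspace_scale)
  qed
qed

section \<open>Stripping the \<open>W\<close>'s from a vector\<close>

definition W_span :: "int \<Rightarrow> nat \<Rightarrow> nat \<Rightarrow> 'v set" where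
  "W_span n M d = span {wword \<mu> v | \<mu>. (\<forall>i\<in>set \<mu>. 0 < i \<and> i \<le> n) \<and> count_list \<mu> n < M \<and> length \<mu> \<le> d}"

lemma subspace_W_span [simp]: "subspace (W_span n M d)"
  by (simp add: W_span_def)

lemma wword_in_W_span:
  "\<forall>i\<in>set \<mu>. 0 < i \<and> i \<le> n \<Longrightarrow> count_list \<mu> n < M \<Longrightarrow> length \<mu> \<le> d \<Longrightarrow> wword \<mu> v \<in> W_span n M d"
  unfolding W_span_def by (rule span_base) blast

lemma W_span_mono: "M \<le> M' \<Longrightarrow> d \<le> d' \<Longrightarrow> W_span n M d \<subseteq> W_span n M' d'"
  unfolding W_span_def by (rule span_mono) force

lemma lin_W_span:
  assumes "lin f" "subspace T" "x \<in> W_span n M d"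
    "\<And>\<mu>. \<forall>i\<in>set \<mu>. 0 < i \<and> i \<le> n \<Longrightarrow> count_list \<mu> n < M \<Longrightarrow> length \<mu> \<le> d \<Longrightarrow> f (wword \<mu> v) \<in> T"
  shows "f x \<in> T"
  using assms(1,2) assms(3)[unfolded W_span_def] by (rule lin_span) (use assms(4) in blast)

lemma w_neg_W_span:
  assumes "0 < i" "i \<le> n" "x \<in> W_span n M d"
  shows "w (- i) x \<in> W_span n (if i = n then Suc M else M) (Suc d)"
proof (rule lin_W_span[OF lin_lwz(2) subspace_W_span assms(3)])
  fix \<mu> assume "\<forall>i\<in>set \<mu>. 0 < i \<and> i \<le> n" "count_list \<mu> n < M" "length \<mu> \<le> d"
  then show "w (- i) (wword \<mu> v) \<in> W_span n (if i = n then Suc M else M) (Suc d)"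
    using wword_in_W_span[of "i # \<mu>" n _ "Suc d"] assms(1,2) by simp
qed

text \<open>Here the Euler operator is exact: \<open>w\<close> modes commute, and for
  \<open>i < n\<close> the commutator of \<open>l n\<close> with \<open>w (- i)\<close> is a
  positive mode, which is zero on \<open>S\<close>. As the multiplicity bound in
  \<open>W_span\<close> is strict, the second claim says that \<open>l n\<close> removes a factor of
  index \<open>n\<close>.\<close>

lemma l_wword:
  assumes "n > 0" "\<forall>i\<in>set \<mu>. 0 < i \<and> i \<le> n"
  shows "w (- n) (l n (wword \<mu> v)) = (of_nat (count_list \<mu> n) * \<kappa> n) \<star> wword \<mu> v \<and>
    l n (wword \<mu> v) \<in> W_span n (count_list \<mu> n) (length \<mu>)"
  using assms(2)
proof (induction \<mu>)
  case Nil
  then show ?case using \<open>n > 0\<close> by (simp add: l_hw w_simps subspace_0)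
next
  case (Cons i \<mu>)
  define t where "t = wword \<mu> v"
  define k where "k = of_nat (count_list \<mu> n) * \<kappa> n"
  have i: "0 < i" "i \<le> n" and t: "t \<in> S"
    using Cons.prems by (auto simp: t_def intro!: wword_in_S)
  have IH: "w (- n) (l n t) = k \<star> t" "l n t \<in> W_span n (count_list \<mu> n) (length \<mu>)"
    using Cons by (simp_all add: t_def k_def)
  have swap: "w (- n) (w (- i) (l n t)) = w (- i) (w (- n) (l n t))"
    by (rule ww)
  show ?case
  proof (cases "i = n")
    case True
    have eq: "l n (wword (i # \<mu>) v) = w (- n) (l n t) + \<kappa> n \<star> t"
      unfolding wword_simps t_def[symmetric] l_w z_S[OF t] scale_scale True cocycle_self
      by (simp add: w0_S t algebra_simps)
    have "t \<in> W_span n (Suc (count_list \<mu> n)) (Suc (length \<mu>))"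
      using Cons.prems unfolding t_def by (intro wword_in_W_span) auto
    moreover have "w (- n) (l n t) \<in> W_span n (Suc (count_list \<mu> n)) (Suc (length \<mu>))"
      using w_neg_W_span[OF _ _ IH(2), of n] \<open>n > 0\<close> by simp
    ultimately show ?thesis
      unfolding eq using True IH by (simp add: w_simps subspace_add subspace_scale k_def algebra_simps flip: t_def)
  next
    case False
    have "cocycle n (- i) = 0"
      using i False by (simp add: cocycle_def)
    then have eq: "l n (wword (i # \<mu>) v) = w (- i) (l n t)"
      using w_pos_S[OF _ t, of "n - i"] i False by (simp add: l_w flip: t_def)
    show ?thesis
      unfolding eq swap using w_neg_W_span[OF i IH(2)] False IH
      by (simp add: w_simps k_def flip: t_def)
  qed
qed

lemma W_span_0: "x \<in> W_span 0 M d \<Longrightarrow> \<exists>a. x = a \<star> v"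
proof -
  assume "x \<in> W_span 0 M d"
  moreover have "{wword \<mu> v | \<mu>. (\<forall>i\<in>set \<mu>. 0 < i \<and> i \<le> 0) \<and> count_list \<mu> (0::int) < M \<and> length \<mu> \<le> d} \<subseteq> {v}"
  proof safe
    fix \<mu> :: "int list" assume "\<forall>i\<in>set \<mu>. 0 < i \<and> i \<le> 0"
    then show "wword \<mu> v = v" by (cases \<mu>) auto
  qed
  ultimately have "x \<in> span {v}"
    unfolding W_span_def using span_mono by blast
  then show ?thesis by (auto simp: span_singleton)
qed

lemma list_bound: "\<exists>k. length \<mu> < k \<and> (\<forall>i\<in>set \<mu>. i \<le> int k)"
proof (induction \<mu>)
  case (Cons i \<mu>)
  then obtain k where "length \<mu> < k" "\<forall>i\<in>set \<mu>. i \<le> int k" by blast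
  then show ?case by (intro exI[of _ "Suc (k + nat i)"]) auto
qed auto

text \<open>Finitely many words have bounded indices and lengths, so one number \<open>n\<close> can
  serve as all three bounds.\<close>

lemma S_W_span:
  assumes "x \<in> S"
  obtains n where "x \<in> W_span (int n) n n"
proof -
  define C where "C n = {wword \<mu> v | \<mu>. (\<forall>i\<in>set \<mu>. 0 < i \<and> i \<le> int n) \<and> length \<mu> < n}" for n
  have "{wword \<mu> v | \<mu>. \<forall>i\<in>set \<mu>. 0 < i} \<subseteq> (\<Union>n. C n)"
  proof safe
    fix \<mu> :: "int list" assume "\<forall>i\<in>set \<mu>. 0 < i"
    then show "wword \<mu> v \<in> (\<Union>n. C n)"
      using list_bound[of \<mu>] unfolding C_def by blast
  qed
  then have "x \<in> span (\<Union>n. C n)"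
    using assms span_mono unfolding S_def by blast
  moreover have "C m \<subseteq> C n" if "m \<le> n" for m n
    using that by (force simp: C_def)
  ultimately have "\<exists>n. x \<in> span (C n)"
    by (rule span_chain)
  then obtain n where "x \<in> span (C n)" ..
  moreover have "C n \<subseteq> {wword \<mu> v | \<mu>. (\<forall>i\<in>set \<mu>. 0 < i \<and> i \<le> int n) \<and> count_list \<mu> (int n) < n \<and> length \<mu> \<le> n}"
  proof -
    have "count_list \<mu> (int n) < n" if "length \<mu> < n" for \<mu>
      using that count_le_length[of \<mu> "int n"] by linarith
    then show ?thesis by (force simp: C_def)
  qed
  ultimately have "x \<in> W_span (int n) n n"
    unfolding W_span_def using span_mono by blast
  then show ?thesis by (rule that)
qed

text \<open>Double induction on the largest index and its multiplicity. If the positive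
  \<open>l\<close> mode of that index does not kill \<open>x\<close>, its value continues the
  descent inside \<open>N\<close>. Otherwise the Euler operator kills \<open>x\<close>, and so the
  bound on the multiplicity can be lowered.\<close>

lemma vacuum_in_subspace_W:
  assumes \<kappa>: "\<And>n. n > 0 \<Longrightarrow> \<kappa> n \<noteq> 0"
    and N: "subspace N" "\<And>k y. y \<in> N \<Longrightarrow> l k y \<in> N" "\<And>k y. y \<in> N \<Longrightarrow> w k y \<in> N"
    and x: "x \<in> N" "x \<noteq> 0" "x \<in> W_span (int n) M d"
  shows "v \<in> N"
  using x
proof (induction n arbitrary: x M)
  case 0
  then obtain a where a: "x = a \<star> v" using W_span_0[of x M d] by auto
  with 0 have "a \<noteq> 0" by auto
  then have "v = inverse a \<star> x" by (simp add: a)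
  then show ?case using subspace_scale[OF N(1) 0(1)] by simp
next
  case (Suc n)
  let ?n = "int (Suc n)"
  from Suc.prems show ?case
  proof (induction M arbitrary: x)
    case 0
    then show ?case by (simp add: W_span_def)
  next
    case (Suc M)
    show ?case
    proof (cases "M = 0")
      case True
      \<comment> \<open>The largest index does not occur, so the next smaller one takes over; its
        multiplicity is at most the length bound \<open>d\<close>.\<close>
      have "x \<in> W_span (int n) (Suc d) d"
      proof (rule lin_W_span[OF lin_id subspace_W_span Suc.prems(3)])
        fix \<mu> assume *: "\<forall>i\<in>set \<mu>. 0 < i \<and> i \<le> ?n" "count_list \<mu> ?n < Suc M" "length \<mu> \<le> d"
        have "?n \<notin> set \<mu>" using * True by (simp add: count_list_0_iff)
        then have "i \<le> int n" if "i \<in> set \<mu>" for i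
          using * that by (cases "i = ?n") fastforce+
        moreover have "count_list \<mu> (int n) < Suc d"
          using * count_le_length[of \<mu> "int n"] by linarith
        ultimately show "wword \<mu> v \<in> W_span (int n) (Suc d) d"
          using * by (intro wword_in_W_span) auto
      qed
      then show ?thesis
        using \<open>\<And>x M. x \<in> N \<Longrightarrow> x \<noteq> 0 \<Longrightarrow> x \<in> W_span (int n) M d \<Longrightarrow> v \<in> N\<close> Suc.prems by blast
    next
      case False
      have l_mem: "l ?n x \<in> W_span ?n M d"
      proof (rule lin_W_span[OF lin_lwz(1) subspace_W_span Suc.prems(3)])
        fix \<mu> assume *: "\<forall>i\<in>set \<mu>. 0 < i \<and> i \<le> ?n" "count_list \<mu> ?n < Suc M" "length \<mu> \<le> d"
        then have "l ?n (wword \<mu> v) \<in> W_span ?n (count_list \<mu> ?n) (length \<mu>)"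
          by (intro l_wword[THEN conjunct2]) auto
        then show "l ?n (wword \<mu> v) \<in> W_span ?n M d"
          using W_span_mono[of "count_list \<mu> ?n" M "length \<mu>" d ?n] * by auto
      qed
      show ?thesis
      proof (cases "l ?n x = 0")
        case False
        then show ?thesis
          using Suc.IH[OF _ False l_mem] Suc.prems N(2) by simp
      next
        case True
        \<comment> \<open>Normalizes the Euler operator to the identity on words with exactly
          \<open>M\<close> factors of index \<open>?n\<close>.\<close>
        define a where "a = inverse (of_nat M * \<kappa> ?n)"
        have "x - a \<star> w (- ?n) (l ?n x) \<in> W_span ?n M d"
        proof (rule lin_W_span[OF _ subspace_W_span Suc.prems(3)])
          fix \<mu> assume *: "\<forall>i\<in>set \<mu>. 0 < i \<and> i \<le> ?n" "count_list \<mu> ?n < Suc M" "length \<mu> \<le> d"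
          have eq: "w (- ?n) (l ?n (wword \<mu> v)) = (of_nat (count_list \<mu> ?n) * \<kappa> ?n) \<star> wword \<mu> v"
            using * by (intro l_wword[THEN conjunct1]) auto
          show "wword \<mu> v - a \<star> w (- ?n) (l ?n (wword \<mu> v)) \<in> W_span ?n M d"
          proof (cases "count_list \<mu> ?n = M")
            case True
            have "of_nat M * \<kappa> ?n \<noteq> 0"
              using \<kappa>[of ?n] \<open>M \<noteq> 0\<close> by simp
            then have "a * (of_nat M * \<kappa> ?n) = 1"
              unfolding a_def by (rule left_inverse)
            then show ?thesis
              unfolding eq True scale_scale by (simp add: subspace_0)
          next
            case False
            then have "wword \<mu> v \<in> W_span ?n M d"
              using * by (intro wword_in_W_span) auto
            then show ?thesis
              unfolding eq by (simp add: subspace_diff subspace_scale)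
          qed
        qed (intro lin_diff lin_id lin_scale lin_compose[OF lin_lwz(2) lin_lwz(1)])
        then have "x \<in> W_span ?n M d"
          using True by (simp add: w_simps)
        then show ?thesis
          using Suc.IH Suc.prems by blast
      qed
    qed
  qed
qed

section \<open>Stripping the \<open>L\<close>'s from a vector\<close>

definition L_span :: "int \<Rightarrow> nat \<Rightarrow> nat \<Rightarrow> 'v set" where
  "L_span n M d = span (F d \<union> {lword \<mu> s | \<mu> s.
     (\<forall>i\<in>set \<mu>. 0 < i \<and> i \<le> n) \<and> count_list \<mu> n < M \<and> length \<mu> = d \<and> s \<in> S})"

lemma subspace_L_span [simp]: "subspace (L_span n M d)"
  by (simp add: L_span_def)

lemma F_subset_L_span: "F d \<subseteq> L_span n M d"
  unfolding L_span_def using span_superset by blast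

lemma lword_in_L_span:
  "\<forall>i\<in>set \<mu>. 0 < i \<and> i \<le> n \<Longrightarrow> count_list \<mu> n < M \<Longrightarrow> length \<mu> = d \<Longrightarrow> s \<in> S \<Longrightarrow>
    lword \<mu> s \<in> L_span n M d"
  unfolding L_span_def by (rule span_base) blast

lemma lin_L_span:
  assumes "lin f" "subspace T" "x \<in> L_span n M d" "\<And>y. y \<in> F d \<Longrightarrow> f y \<in> T"
    "\<And>\<mu> s. \<forall>i\<in>set \<mu>. 0 < i \<and> i \<le> n \<Longrightarrow> count_list \<mu> n < M \<Longrightarrow> length \<mu> = d \<Longrightarrow> s \<in> S \<Longrightarrow>
      f (lword \<mu> s) \<in> T"
  shows "f x \<in> T"
  using assms(1,2) assms(3)[unfolded L_span_def] by (rule lin_span) (use assms(4,5) in blast)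

lemma F_L_span:
  assumes "x \<in> F (Suc d)"
  obtains n where "x \<in> L_span (int n) (Suc d) d"
proof -
  define C where "C n = F d \<union> {lword \<mu> s | \<mu> s.
     (\<forall>i\<in>set \<mu>. 0 < i \<and> i \<le> int n) \<and> length \<mu> = d \<and> s \<in> S}" for n
  have count: "count_list \<mu> i < Suc d" if "length \<mu> = d" for \<mu> and i :: int
    using that count_le_length[of \<mu> i] by linarith
  have "{lword \<mu> s | \<mu> s. (\<forall>i\<in>set \<mu>. 0 < i) \<and> length \<mu> < Suc d \<and> s \<in> S} \<subseteq> (\<Union>n. C n)"
  proof safe
    fix \<mu> :: "int list" and s assume *: "\<forall>i\<in>set \<mu>. 0 < i" "length \<mu> < Suc d" "s \<in> S"
    show "lword \<mu> s \<in> (\<Union>n. C n)"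
    proof (cases "length \<mu> = d")
      case True
      then show ?thesis
        using list_bound[of \<mu>] * unfolding C_def by blast
    next
      case False
      then show ?thesis
        using lword_in_F[of \<mu> d s] * by (auto simp: C_def)
    qed
  qed
  then have "x \<in> span (\<Union>n. C n)"
    using assms span_mono unfolding F_def[of "Suc d"] by blast
  moreover have "C m \<subseteq> C n" if "m \<le> n" for m n
    using that by (force simp: C_def)
  ultimately have "\<exists>n. x \<in> span (C n)"
    by (rule span_chain)
  then obtain n where "x \<in> span (C n)" ..
  moreover have "C n \<subseteq> L_span (int n) (Suc d) d"
    using F_subset_L_span lword_in_L_span count by (auto simp: C_def)
  ultimately have "x \<in> L_span (int n) (Suc d) d"
    using span_minimal[OF _ subspace_L_span] by blast
  then show ?thesis by (rule that)
qed

text \<open>The Euler operators kill \<open>x\<close>, yet modulo \<open>F d\<close> they multiply a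
  leading word by \<kappa> times a multiplicity. Going down from the largest index, each index is
  thus excluded from the leading words, and for \<open>d > 0\<close> no such word is left.\<close>

lemma F_if_killed:
  assumes \<kappa>: "\<And>n. n > 0 \<Longrightarrow> \<kappa> n \<noteq> 0" and kill: "\<And>n. n > 0 \<Longrightarrow> w n x = 0"
    and "d > 0" "x \<in> L_span (int n) M d"
  shows "x \<in> F d"
  using assms(4)
proof (induction n arbitrary: M)
  case 0
  then have "(\<lambda>x. x) x \<in> F d"
  proof (rule lin_L_span[OF lin_id subspace_F])
    fix \<mu> s assume "\<forall>i\<in>set \<mu>. 0 < i \<and> i \<le> int 0" "length \<mu> = d"
    then show "lword \<mu> s \<in> F d" using \<open>d > 0\<close> by (cases \<mu>) auto
  qed
  then show ?case by simp
next
  case (Suc n)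
  let ?n = "int (Suc n)"
  from Suc.prems show ?case
  proof (induction M)
    case 0
    then have "x \<in> span (F d)" by (simp add: L_span_def)
    then show ?case unfolding span_eq_iff[THEN iffD2, OF subspace_F] .
  next
    case (Suc M)
    show ?case
    proof (cases "M = 0")
      case True
      have "x \<in> L_span (int n) (Suc d) d"
      proof (rule lin_L_span[OF lin_id subspace_L_span Suc.prems])
        fix \<mu> s assume *: "\<forall>i\<in>set \<mu>. 0 < i \<and> i \<le> ?n" "count_list \<mu> ?n < Suc M" "length \<mu> = d" "s \<in> S"
        have "?n \<notin> set \<mu>" using * True by (simp add: count_list_0_iff)
        then have "i \<le> int n" if "i \<in> set \<mu>" for i
          using * that by (cases "i = ?n") fastforce+
        moreover have "count_list \<mu> (int n) < Suc d"
          using * count_le_length[of \<mu> "int n"] by linarith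
        ultimately show "lword \<mu> s \<in> L_span (int n) (Suc d) d"
          using * by (intro lword_in_L_span) auto
      qed (use F_subset_L_span in blast)
      then show ?thesis
        by (rule \<open>\<And>M. x \<in> L_span (int n) M d \<Longrightarrow> x \<in> F d\<close>)
    next
      case False
      define a where "a = inverse (of_nat M * \<kappa> ?n)"
      have "x - a \<star> l (- ?n) (w ?n x) \<in> L_span ?n M d"
      proof (rule lin_L_span[OF _ subspace_L_span Suc.prems])
        fix y assume y: "y \<in> F d"
        \<comment> \<open>On \<open>F d\<close> the Euler operator loses an \<open>l\<close> through
          \<open>w ?n\<close> before it adds one, so it does not leave \<open>F d\<close>.\<close>
        obtain d' where d': "d = Suc d'" using \<open>d > 0\<close> by (cases d) auto
        have "w ?n y \<in> F d'" using y w_pos_F[of ?n] by (simp add: d')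
        then have "l (- ?n) (w ?n y) \<in> F d" unfolding d' by (intro l_neg_F) auto
        then have "y - a \<star> l (- ?n) (w ?n y) \<in> F d"
          using y by (simp add: subspace_diff subspace_scale)
        then show "y - a \<star> l (- ?n) (w ?n y) \<in> L_span ?n M d"
          using F_subset_L_span by blast
      next
        fix \<mu> s assume *: "\<forall>i\<in>set \<mu>. 0 < i \<and> i \<le> ?n" "count_list \<mu> ?n < Suc M" "length \<mu> = d" "s \<in> S"
        define b where "b = of_nat (count_list \<mu> ?n) * \<kappa> ?n"
        have "l (- ?n) (w ?n (lword \<mu> s)) - b \<star> lword \<mu> s \<in> F d"
          using euler_lword[of s ?n \<mu>] * unfolding b_def by auto
        then have 1: "l (- ?n) (w ?n (lword \<mu> s)) - b \<star> lword \<mu> s \<in> L_span ?n M d"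
          by (rule subsetD[OF F_subset_L_span])
        have 2: "lword \<mu> s - (a * b) \<star> lword \<mu> s \<in> L_span ?n M d"
        proof (cases "count_list \<mu> ?n = M")
          case True
          have "of_nat M * \<kappa> ?n \<noteq> 0"
            using \<kappa>[of ?n] \<open>M \<noteq> 0\<close> by simp
          then have "a * b = 1"
            unfolding a_def b_def True by (rule left_inverse)
          then show ?thesis by (simp add: subspace_0)
        next
          case False
          then have "lword \<mu> s \<in> L_span ?n M d"
            using * by (intro lword_in_L_span) auto
          then show ?thesis
            by (simp add: subspace_diff subspace_scale)
        qed
        have "(lword \<mu> s - (a * b) \<star> lword \<mu> s) -
            a \<star> (l (- ?n) (w ?n (lword \<mu> s)) - b \<star> lword \<mu> s) \<in> L_span ?n M d"
          by (rule subspace_diff[OF subspace_L_span 2 subspace_scale[OF subspace_L_span 1]])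
        then show "lword \<mu> s - a \<star> l (- ?n) (w ?n (lword \<mu> s)) \<in> L_span ?n M d"
          by (simp add: scale_right_diff_distrib)
      qed (intro lin_diff lin_id lin_scale lin_compose[OF lin_lwz(1) lin_lwz(2)])
      then have "x \<in> L_span ?n M d"
        using kill[of ?n] by (simp add: l_simps)
      then show ?thesis by (rule Suc.IH)
    qed
  qed
qed

text \<open>Either a positive \<open>w\<close> mode gives a nonzero vector of \<open>N\<close> with
  fewer \<open>l\<close>'s, or all of them kill \<open>x\<close> and \<open>F_if_killed\<close>
  lowers the bound for \<open>x\<close> itself. At the bottom, \<open>F (Suc 0) = S\<close> contains
  words in the \<open>w\<close>'s only.\<close>

lemma vacuum_in_subspace:
  assumes \<kappa>: "\<And>n. n > 0 \<Longrightarrow> \<kappa> n \<noteq> 0"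
    and N: "subspace N" "\<And>k y. y \<in> N \<Longrightarrow> l k y \<in> N" "\<And>k y. y \<in> N \<Longrightarrow> w k y \<in> N"
    and x: "x \<in> N" "x \<noteq> 0" "x \<in> F d"
  shows "v \<in> N"
  using x
proof (induction d arbitrary: x)
  case 0
  then show ?case by (simp add: F_0)
next
  case (Suc d)
  show ?case
  proof (cases "\<exists>n>0. w n x \<noteq> 0")
    case True
    then obtain n where "n > 0" "w n x \<noteq> 0" by blast
    then show ?thesis
      using Suc.IH[of "w n x"] N(3) Suc.prems w_pos_F by blast
  next
    case False
    show ?thesis
    proof (cases "d = 0")
      case True
      then have "x \<in> S" using Suc.prems by (simp add: F_1)
      then obtain n where "x \<in> W_span (int n) n n" by (rule S_W_span)
      then show ?thesis
        using vacuum_in_subspace_W[OF \<kappa> N] Suc.prems by blast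
    next
      case d: False
      obtain n where "x \<in> L_span (int n) (Suc d) d"
        using F_L_span[OF Suc.prems(3)] .
      then have "x \<in> F d"
        using F_if_killed[OF \<kappa>] False d by blast
      then show ?thesis
        using Suc.IH Suc.prems by blast
    qed
  qed
qed

end

section \<open>The singular vector\<close>

text \<open>The parametrization of \<open>c\<close> and \<open>h2\<close> makes \<kappa> vanish at
  \<open>m\<close>. By \<open>coeff\<close> the free field modes below \<open>m\<close> can be
  solved for; it allows \<alpha> = 0 only when \<open>m = 1\<close>.\<close>

locale W22_singular = W22_hw scl l w z v c h1 h2
  for scl :: "complex \<Rightarrow> 'v::ab_group_add \<Rightarrow> 'v" (infixr \<open>\<star>\<close> 75) and l w z v c h1 h2 +
  fixes \<alpha> :: complex and m :: nat
  assumes m_pos: "m > 0" and c_eq: "c = - 12 * \<alpha> ^ 2" and h2_eq: "2 * h2 = \<alpha> ^ 2 * (of_nat m ^ 2 - 1)"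
    and coeff: "0 < j \<Longrightarrow> j < m \<Longrightarrow> \<alpha> * (of_nat j - of_nat m) \<noteq> 0"
begin

text \<open>
  The creation modes of the free field: \<open>a j\<close> solves
  \<open>W\<^sub>-\<^sub>j = \<alpha> (j - m) a\<^sub>j + (1 / 2) (\<Sum>0 < i < j. a\<^sub>i a\<^sub>j\<^sub>-\<^sub>i)\<close>, which is possible for \<open>j < m\<close> only.
\<close>

function a :: "nat \<Rightarrow> 'v \<Rightarrow> 'v" where
  "a j = (\<lambda>x. inverse (\<alpha> * (of_nat j - of_nat m)) \<star>
     (w (- int j) x - (1 / 2) \<star> (\<Sum>i\<in>{1..<j}. a i (a (j - i) x))))"
  by auto
termination by (relation "measure id") auto

declare a.simps [simp del]

text \<open>The linear term of the free field formula, before division. For \<open>0 < j\<close> and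
  \<open>j < m\<close> it is a multiple of \<open>a j\<close>; at \<open>j = m\<close> the factor
  would be zero, and \<open>d m v\<close> is the singular vector.\<close>

definition d :: "nat \<Rightarrow> 'v \<Rightarrow> 'v" where
  "d j x = w (- int j) x - (1 / 2) \<star> (\<Sum>i\<in>{1..<j}. a i (a (j - i) x))"

lemma a_eq: "a j x = inverse (\<alpha> * (of_nat j - of_nat m)) \<star> d j x"
  by (simp add: a.simps[of j] d_def)

lemma d_eq: "0 < j \<Longrightarrow> j < m \<Longrightarrow> d j x = (\<alpha> * (of_nat j - of_nat m)) \<star> a j x"
  unfolding a_eq scale_scale by (subst right_inverse[OF coeff]) simp_all

lemma lin_a: "lin (a j)"
proof (induction j rule: less_induct)
  case (less j)
  have "lin (\<lambda>x. a i (a (j - i) x))" if "i \<in> {1..<j}" for i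
    using that by (intro lin_compose[OF less less]) auto
  then show ?case
    unfolding a.simps[of j] by (intro lin_scale lin_diff lin_lwz(2) lin_sum_fun)
qed

lemma lin_d: "lin (d j)"
  unfolding d_def[abs_def] by (intro lin_diff lin_scale lin_lwz(2) lin_sum_fun lin_compose[OF lin_a lin_a])

lemmas a_simps = lin_zeroD[OF lin_a] lin_diffD[OF lin_a] lin_uminusD[OF lin_a] lin_sumD[OF lin_a]
  lin_addD[OF lin_a] lin_scaleD[OF lin_a]

text \<open>\<open>a j\<close> is a polynomial in the \<open>w\<close> modes, hence commutes with
  any linear map that commutes with these.\<close>

lemma a_commute:
  assumes f: "lin f" "\<And>n x. f (w n x) = w n (f x)"
  shows "f (a j x) = a j (f x)"
proof (induction j arbitrary: x rule: less_induct)
  case (less j)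
  have "f (\<Sum>i\<in>{1..<j}. a i (a (j - i) x)) = (\<Sum>i\<in>{1..<j}. f (a i (a (j - i) x)))"
    by (rule lin_sumD[OF f(1)])
  also have "\<dots> = (\<Sum>i\<in>{1..<j}. a i (a (j - i) (f x)))"
    using less by (intro sum.cong) auto
  finally show ?case
    by (simp add: a.simps[of j] lin_diffD[OF f(1)] lin_scaleD[OF f(1)] f(2))
qed

lemma a_w: "a j (w n x) = w n (a j x)"
  by (rule a_commute[symmetric]) (simp_all add: ww)

lemma a_a: "a i (a j x) = a j (a i x)"
  by (rule a_commute) (simp_all add: lin_a a_w)

lemma a_mem:
  assumes T: "subspace T" and w: "\<And>i x. 0 < i \<Longrightarrow> i \<le> j \<Longrightarrow> x \<in> T \<Longrightarrow> w (- int i) x \<in> T"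
    and "0 < j" "x \<in> T"
  shows "a j x \<in> T"
  using w assms(3,4)
proof (induction j arbitrary: x rule: less_induct)
  case (less j)
  have "a i (a (j - i) x) \<in> T" if "i \<in> {1..<j}" for i
    using that less by auto
  then show ?case
    using less T by (auto simp: a.simps[of j] intro!: subspace_scale subspace_diff subspace_sum)
qed

text \<open>In contrast to \<open>a_mem\<close>, the subspace contains the whole image of each
  negative \<open>w\<close> mode, so \<open>x\<close> is arbitrary.\<close>

lemma a_range:
  assumes T: "subspace T" and w: "\<And>i x. 0 < i \<Longrightarrow> w (- int i) x \<in> T" and "0 < j"
  shows "a j x \<in> T"
  using assms(3)
proof (induction j arbitrary: x rule: less_induct)
  case (less j)
  then show ?case
    using T w by (auto simp: a.simps[of j] intro!: subspace_scale subspace_diff subspace_sum)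
qed

lemma d_range:
  assumes T: "subspace T" and w: "\<And>i x. 0 < i \<Longrightarrow> w (- int i) x \<in> T" and "0 < j"
  shows "d j x \<in> T"
  unfolding d_def using T w assms(3)
  by (auto intro!: subspace_scale subspace_diff subspace_sum a_range)

lemma a_S: "0 < j \<Longrightarrow> s \<in> S \<Longrightarrow> a j s \<in> S"
  by (rule a_mem) (auto intro: w_S)

text \<open>The commutator of \<open>L\<^sub>k\<close> and \<open>a\<^sub>j\<close>.\<close>

definition \<delta> :: "nat \<Rightarrow> nat \<Rightarrow> 'v \<Rightarrow> 'v" where
  "\<delta> k j s = (if k < j then of_nat j \<star> a (j - k) s
     else if k = j then (- of_nat k * \<alpha> * (of_nat m + of_nat k)) \<star> s else 0)"

lemma a_\<delta>: "a i (\<delta> k j s) = \<delta> k j (a i s)"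
  by (simp add: \<delta>_def a_simps a_a[of i])

lemma sum_reverse: "(\<Sum>i\<in>{1..<n}. f (n - i)) = (\<Sum>i\<in>{1..<n}. f i)" for n :: nat and f :: "nat \<Rightarrow> 'v"
  by (rule sum.reindex_bij_witness[of _ "\<lambda>i. n - i" "\<lambda>i. n - i"]) auto

text \<open>Pairing \<open>i\<close> with \<open>n - i\<close> averages the weight to
  \<open>n / 2\<close>.\<close>

lemma sum_symmetric:
  fixes f :: "nat \<Rightarrow> 'v"
  assumes "\<And>i. i \<in> {1..<n} \<Longrightarrow> f (n - i) = f i"
  shows "(\<Sum>i\<in>{1..<n}. of_nat i \<star> f i) = (of_nat n / 2) \<star> (\<Sum>i\<in>{1..<n}. f i)"
proof -
  have "(\<Sum>i\<in>{1..<n}. of_nat i \<star> f i) = (\<Sum>i\<in>{1..<n}. of_nat (n - i) \<star> f (n - i))"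
    by (rule sum_reverse[symmetric])
  also have "\<dots> = (\<Sum>i\<in>{1..<n}. (of_nat n - of_nat i) \<star> f i)"
    using assms by (intro sum.cong) (auto simp: of_nat_diff)
  also have "\<dots> = of_nat n \<star> (\<Sum>i\<in>{1..<n}. f i) - (\<Sum>i\<in>{1..<n}. of_nat i \<star> f i)"
    by (simp add: scale_left_diff_distrib sum_subtractf scale_sum_right)
  finally have "2 \<star> (\<Sum>i\<in>{1..<n}. of_nat i \<star> f i) = of_nat n \<star> (\<Sum>i\<in>{1..<n}. f i)"
    by (metis (no_types, lifting) add_diff_cancel_left' diff_add_cancel one_add_one scale_left_distrib scale_one)
  then have "(1 / 2) \<star> (2 \<star> (\<Sum>i\<in>{1..<n}. of_nat i \<star> f i)) = (1 / 2) \<star> (of_nat n \<star> (\<Sum>i\<in>{1..<n}. f i))"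
    by simp
  then show ?thesis by simp
qed

lemma \<kappa>_eq: "\<kappa> (int n) = of_nat n * \<alpha> ^ 2 * (of_nat m ^ 2 - of_nat n ^ 2)"
proof -
  have "\<kappa> (int n) = of_nat n * (2 * h2) + (of_nat n ^ 3 - of_nat n) / 12 * c"
    by (simp add: \<kappa>_def)
  then show ?thesis
    unfolding h2_eq c_eq by (simp add: field_simps power2_eq_square power3_eq_cube)
qed

text \<open>Terms below \<open>k\<close> vanish, the one at \<open>k\<close> carries a scalar, and
  those above are shifted by \<open>k\<close>; by \<open>sum_symmetric\<close> their weights
  \<open>k + i\<close> average to \<open>k + (j - k) / 2\<close>.\<close>

lemma sum_\<delta>:
  assumes "0 < k" "k < j"
  shows "(\<Sum>i\<in>{1..<j}. \<delta> k i (a (j - i) s)) =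
    (- of_nat k * \<alpha> * (of_nat m + of_nat k)) \<star> a (j - k) s +
    ((of_nat k + of_nat j) / 2) \<star> (\<Sum>i\<in>{1..<j - k}. a i (a (j - k - i) s))"
proof -
  let ?n = "j - k" and ?f = "\<lambda>i. a i (a (j - k - i) s)"
  have "{1..<j} = {1..<k} \<union> insert k {Suc k..<j}" using assms by auto
  then have "(\<Sum>i\<in>{1..<j}. \<delta> k i (a (j - i) s)) = (\<Sum>i\<in>{1..<k}. \<delta> k i (a (j - i) s)) +
      (\<Sum>i\<in>insert k {Suc k..<j}. \<delta> k i (a (j - i) s))"
    by (simp only:) (rule sum.union_disjoint; auto)
  also have "(\<Sum>i\<in>{1..<k}. \<delta> k i (a (j - i) s)) = 0"
    by (rule sum.neutral) (simp add: \<delta>_def)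
  also have "(\<Sum>i\<in>insert k {Suc k..<j}. \<delta> k i (a (j - i) s)) =
      \<delta> k k (a ?n s) + (\<Sum>i\<in>{Suc k..<j}. \<delta> k i (a (j - i) s))"
    by simp
  also have "(\<Sum>i\<in>{Suc k..<j}. \<delta> k i (a (j - i) s)) = (\<Sum>i\<in>{1..<?n}. of_nat (k + i) \<star> ?f i)"
    by (rule sum.reindex_bij_witness[of _ "\<lambda>i. k + i" "\<lambda>i. i - k"]) (auto simp: \<delta>_def)
  also have "\<dots> = of_nat k \<star> (\<Sum>i\<in>{1..<?n}. ?f i) + (\<Sum>i\<in>{1..<?n}. of_nat i \<star> ?f i)"
    by (simp add: scale_left_distrib sum.distrib scale_sum_right)
  also have "(\<Sum>i\<in>{1..<?n}. of_nat i \<star> ?f i) = (of_nat ?n / 2) \<star> (\<Sum>i\<in>{1..<?n}. ?f i)"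
    by (rule sum_symmetric) (auto simp: a_a)
  also have "of_nat k \<star> (\<Sum>i\<in>{1..<?n}. ?f i) + (of_nat ?n / 2) \<star> (\<Sum>i\<in>{1..<?n}. ?f i) =
      ((of_nat k + of_nat j) / 2) \<star> (\<Sum>i\<in>{1..<?n}. ?f i)"
    using assms by (simp add: of_nat_diff field_simps flip: scale_left_distrib)
  finally show ?thesis by (simp add: \<delta>_def)
qed

text \<open>The commutator agrees with what the derivation \<delta> gives on the free field formula
  for \<open>w (- j)\<close>. The factor \<open>1 / 2\<close> of the quadratic part disappears
  because both of its factors contribute equally.\<close>

lemma l_w_key:
  assumes "0 < k" "0 < j" "j \<le> m" "s \<in> S"
  shows "l (int k) (w (- int j) s) = w (- int j) (l (int k) s) +
    (\<Sum>i\<in>{1..<j}. \<delta> k i (a (j - i) s)) + (\<alpha> * (of_nat j - of_nat m)) \<star> \<delta> k j s"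
proof -
  have lw: "l (int k) (w (- int j) s) = w (- int j) (l (int k) s) +
      (of_int (int k + int j) \<star> w (int k - int j) s + (cocycle (int k) (- int j) * c) \<star> s)"
    using l_w[of "int k" "int j" s] z_S[OF assms(4)] by (simp add: add.assoc)
  have "of_int (int k + int j) \<star> w (int k - int j) s + (cocycle (int k) (- int j) * c) \<star> s =
    (\<Sum>i\<in>{1..<j}. \<delta> k i (a (j - i) s)) + (\<alpha> * (of_nat j - of_nat m)) \<star> \<delta> k j s"
  proof (cases k j rule: linorder_cases)
    case less
    define A where "A = (\<Sum>i\<in>{1..<j - k}. a i (a (j - k - i) s))"
    have "w (int k - int j) s = d (j - k) s + (1 / 2) \<star> A"
      using less by (simp add: d_def A_def of_nat_diff)
    also have "d (j - k) s = (\<alpha> * (of_nat j - of_nat k - of_nat m)) \<star> a (j - k) s"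
      using d_eq[of "j - k" s] less assms by (simp add: of_nat_diff)
    finally have w: "w (int k - int j) s = (\<alpha> * (of_nat j - of_nat k - of_nat m)) \<star> a (j - k) s + (1 / 2) \<star> A" .
    have "cocycle (int k) (- int j) = 0" using less by (simp add: cocycle_def)
    \<comment> \<open>Compares the coefficients of \<open>a (j - k) s\<close>; those of
      \<open>A\<close> agree at once.\<close>
    moreover have "(of_nat k + of_nat j) * (\<alpha> * (of_nat j - of_nat k - of_nat m)) =
        - of_nat k * \<alpha> * (of_nat m + of_nat k) + \<alpha> * (of_nat j - of_nat m) * of_nat j"
      by (simp add: algebra_simps)
    ultimately show ?thesis
      unfolding w sum_\<delta>[OF assms(1) less] A_def[symmetric] using less
      by (simp add: \<delta>_def scale_right_distrib flip: scale_left_distrib) (simp add: scale_left_diff_distrib)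
  next
    case equal
    have "(\<Sum>i\<in>{1..<j}. \<delta> k i (a (j - i) s)) = 0"
      using equal by (intro sum.neutral) (simp add: \<delta>_def)
    moreover have "of_int (int k + int j) \<star> w (int k - int j) s + (cocycle (int k) (- int j) * c) \<star> s =
        \<kappa> (int j) \<star> s"
      using equal cocycle_self(2)[of "int j"] w0_S[OF assms(4)]
      by (simp flip: scale_left_distrib)
    moreover have "\<kappa> (int j) = \<alpha> * (of_nat j - of_nat m) * (- of_nat k * \<alpha> * (of_nat m + of_nat k))"
      unfolding \<kappa>_eq equal by (simp add: algebra_simps power2_eq_square)
    ultimately show ?thesis using equal by (simp add: \<delta>_def)
  next
    case greater
    have "(\<Sum>i\<in>{1..<j}. \<delta> k i (a (j - i) s)) = 0"
      using greater by (intro sum.neutral) (simp add: \<delta>_def)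
    moreover have "w (int k - int j) s = 0" "cocycle (int k) (- int j) = 0"
      using greater w_pos_S[OF _ assms(4)] by (simp_all add: cocycle_def)
    ultimately show ?thesis using greater by (simp add: \<delta>_def)
  qed
  then show ?thesis unfolding lw by (simp add: add.assoc)
qed

text \<open>The derivation hits either factor of the quadratic part, and reversing the sum shows
  that both contributions are equal. Together they cancel the sum in \<open>l_w_key\<close>.\<close>

lemma l_d:
  assumes "0 < k" "0 < j" "j \<le> m" "s \<in> S"
    and IH: "\<And>i s. 0 < i \<Longrightarrow> i < j \<Longrightarrow> s \<in> S \<Longrightarrow> l (int k) (a i s) = a i (l (int k) s) + \<delta> k i s"
  shows "l (int k) (d j s) = d j (l (int k) s) + (\<alpha> * (of_nat j - of_nat m)) \<star> \<delta> k j s"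
proof -
  let ?l = "l (int k)" and ?D = "\<Sum>i\<in>{1..<j}. \<delta> k i (a (j - i) s)"
  have "?l (\<Sum>i\<in>{1..<j}. a i (a (j - i) s)) = (\<Sum>i\<in>{1..<j}. ?l (a i (a (j - i) s)))"
    by (rule lin_sumD) simp
  also have "\<dots> = (\<Sum>i\<in>{1..<j}. a i (a (j - i) (?l s)) + \<delta> k (j - i) (a i s) + \<delta> k i (a (j - i) s))"
    using assms by (intro sum.cong) (auto simp: a_S a_simps a_\<delta>)
  also have "\<dots> = (\<Sum>i\<in>{1..<j}. a i (a (j - i) (?l s))) + (\<Sum>i\<in>{1..<j}. \<delta> k (j - i) (a i s)) + ?D"
    by (simp add: sum.distrib)
  also have "(\<Sum>i\<in>{1..<j}. \<delta> k (j - i) (a i s)) = ?D"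
    using sum_reverse[of "\<lambda>i. \<delta> k i (a (j - i) s)" j] by simp
  finally have "?l (\<Sum>i\<in>{1..<j}. a i (a (j - i) s)) = (\<Sum>i\<in>{1..<j}. a i (a (j - i) (?l s))) + (?D + ?D)"
    by (simp add: add.assoc)
  moreover have "(1 / 2) \<star> (?D + ?D) = ?D"
    by (simp add: scale_right_distrib flip: scale_left_distrib)
  ultimately show ?thesis
    unfolding d_def l_simps l_w_key[OF assms(1-4)]
    by (simp add: scale_right_distrib)
qed

lemma l_a:
  assumes "0 < k" "0 < j" "j < m" "s \<in> S"
  shows "l (int k) (a j s) = a j (l (int k) s) + \<delta> k j s"
  using assms(2-4)
proof (induction j arbitrary: s rule: less_induct)
  case (less j)
  have "l (int k) (d j s) = d j (l (int k) s) + (\<alpha> * (of_nat j - of_nat m)) \<star> \<delta> k j s"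
    using less assms(1) by (intro l_d) auto
  then show ?case
    by (simp only: a_eq l_simps scale_right_distrib scale_scale left_inverse[OF coeff[OF less.prems(1,2)]] scale_one)
qed

lemma l0_d:
  assumes "0 < j" "s \<in> S"
    and IH: "\<And>i s. 0 < i \<Longrightarrow> i < j \<Longrightarrow> s \<in> S \<Longrightarrow> l 0 (a i s) = a i (l 0 s) + of_nat i \<star> a i s"
  shows "l 0 (d j s) = d j (l 0 s) + of_nat j \<star> d j s"
proof -
  have "l 0 (\<Sum>i\<in>{1..<j}. a i (a (j - i) s)) = (\<Sum>i\<in>{1..<j}. l 0 (a i (a (j - i) s)))"
    by (rule lin_sumD) simp
  also have "\<dots> = (\<Sum>i\<in>{1..<j}. a i (a (j - i) (l 0 s)) + of_nat j \<star> a i (a (j - i) s))"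
  proof (intro sum.cong refl)
    fix i assume i: "i \<in> {1..<j}"
    then have "l 0 (a i (a (j - i) s)) = a i (a (j - i) (l 0 s)) +
        (of_nat (j - i) \<star> a i (a (j - i) s) + of_nat i \<star> a i (a (j - i) s))"
      using assms by (simp add: a_S a_simps add.assoc)
    then show "l 0 (a i (a (j - i) s)) = a i (a (j - i) (l 0 s)) + of_nat j \<star> a i (a (j - i) s)"
      using i by (simp add: of_nat_diff flip: scale_left_distrib)
  qed
  also have "\<dots> = (\<Sum>i\<in>{1..<j}. a i (a (j - i) (l 0 s))) + of_nat j \<star> (\<Sum>i\<in>{1..<j}. a i (a (j - i) s))"
    by (simp add: sum.distrib scale_sum_right)
  finally have "l 0 (\<Sum>i\<in>{1..<j}. a i (a (j - i) s)) = \<dots>" .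
  moreover have "l 0 (w (- int j) s) = w (- int j) (l 0 s) + of_nat j \<star> w (- int j) s"
    using l_w[of 0 "int j" s] assms(1) by (simp add: cocycle_def)
  ultimately show ?thesis
    unfolding d_def l_simps by (simp add: scale_right_distrib scale_right_diff_distrib mult.commute)
qed

lemma l0_a:
  assumes "0 < j" "j < m" "s \<in> S"
  shows "l 0 (a j s) = a j (l 0 s) + of_nat j \<star> a j s"
  using assms
proof (induction j arbitrary: s rule: less_induct)
  case (less j)
  have "l 0 (d j s) = d j (l 0 s) + of_nat j \<star> d j s"
    using less by (intro l0_d) auto
  then show ?case
    by (simp add: a_eq l_simps scale_right_distrib mult.commute)
qed

text \<open>Identifies the leading term \<open>w (- m) v\<close>, which keeps the singular vector
  from vanishing in the Verma module.\<close>

lemma singular_vector_decomp: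
  "d m v - w (- int m) v \<in> span {wword \<mu> v | \<mu>. \<forall>i\<in>set \<mu>. 0 < i \<and> i < int m}"
proof -
  let ?B = "{wword \<mu> v | \<mu>. \<forall>i\<in>set \<mu>. 0 < i \<and> i < int m}"
  have w: "w (- i) x \<in> span ?B" if "0 < i" "i < int m" "x \<in> span ?B" for i x
  proof (rule lin_span[OF lin_lwz(2) subspace_span that(3)])
    fix b assume "b \<in> ?B"
    then obtain \<mu> where "b = wword \<mu> v" "\<forall>i\<in>set \<mu>. 0 < i \<and> i < int m" by blast
    then show "w (- i) b \<in> span ?B"
      using that by (intro span_base CollectI exI[of _ "i # \<mu>"]) simp
  qed
  have a: "a j x \<in> span ?B" if "0 < j" "j < m" "x \<in> span ?B" for j x
    using that by (intro a_mem w) auto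
  have "v \<in> span ?B"
    by (intro span_base CollectI exI[of _ "[]"]) simp
  then have "a i (a (m - i) v) \<in> span ?B" if "i \<in> {1..<m}" for i
    using that by (intro a) auto
  then have "- ((1 / 2) \<star> (\<Sum>i\<in>{1..<m}. a i (a (m - i) v))) \<in> span ?B"
    by (intro span_neg span_scale span_sum)
  then show ?thesis by (simp add: d_def)
qed

lemma singular_vector_in_S: "d m v \<in> S"
  unfolding d_def using m_pos
  by (intro subspace_diff subspace_scale subspace_sum subspace_S w_S v_in_S) (auto intro!: a_S v_in_S)

text \<open>For \<open>j = m\<close> the last term of \<open>l_d\<close> has coefficient zero, so a
  positive \<open>l\<close> mode passes \<open>d m\<close> and kills \<open>v\<close>. The remaining
  conditions hold for \<open>w\<close> and \<open>z\<close> on all of \<open>S\<close>, and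
  \<open>l 0\<close> adds the degree \<open>m\<close>.\<close>

lemma singular_vector_hw: "W22_hw scl l w z (d m v) c (h1 + of_nat m) h2"
proof
  show "l k (d m v) = 0" if "k > 0" for k
    using l_d[of "nat k" m v] l_a[of "nat k"] that m_pos v_in_S l_hw[OF that]
    by (simp add: lin_zeroD[OF lin_d])
  have "l 0 (d m v) = d m (l 0 v) + of_nat m \<star> d m v"
    using l0_d l0_a m_pos v_in_S by blast
  then show "l 0 (d m v) = (h1 + of_nat m) \<star> d m v"
    using lin_d[of m] by (simp add: l0_hw lin_def scale_left_distrib)
qed (use singular_vector_in_S in \<open>simp_all add: w_pos_S w0_S z_S\<close>)

end

section \<open>The Verma module of \<open>W(2,2)\<close>\<close>

instantiation W22_basis :: linorder
begin

text \<open>Negative \<open>L\<close>'s precede negative \<open>W\<close>'s, as in the basis of the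
  Verma module, and all negative letters precede the others, as \<open>neg_less\<close>
  demands.\<close>

fun rank_W22_basis :: "W22_basis \<Rightarrow> nat \<times> int" where
  "rank_W22_basis (BL m) = (if m < 0 then 0 else 2, m)"
| "rank_W22_basis (BW m) = (if m < 0 then 1 else 3, m)"
| "rank_W22_basis BC = (4, 0)"

definition less_eq_W22_basis :: "W22_basis \<Rightarrow> W22_basis \<Rightarrow> bool" where
  "a \<le> b \<longleftrightarrow> rank_W22_basis a \<le> rank_W22_basis b"

definition less_W22_basis :: "W22_basis \<Rightarrow> W22_basis \<Rightarrow> bool" where
  "a < b \<longleftrightarrow> rank_W22_basis a < rank_W22_basis b"

instance
proof
  fix a b :: W22_basis
  show "a \<le> b \<Longrightarrow> b \<le> a \<Longrightarrow> a = b"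
    by (cases a; cases b) (auto simp: less_eq_W22_basis_def split: if_splits)
qed (auto simp: less_eq_W22_basis_def less_W22_basis_def simp del: less_eq_prod_simp less_prod_simp)

end

fun W22_neg :: "W22_basis \<Rightarrow> bool" where
  "W22_neg (BL m) \<longleftrightarrow> m < 0"
| "W22_neg (BW m) \<longleftrightarrow> m < 0"
| "W22_neg BC \<longleftrightarrow> False"

fun W22_weight :: "complex \<Rightarrow> complex \<Rightarrow> complex \<Rightarrow> W22_basis \<Rightarrow> complex" where
  "W22_weight c h1 h2 (BL m) = (if m = 0 then h1 else 0)"
| "W22_weight c h1 h2 (BW m) = (if m = 0 then h2 else 0)"
| "W22_weight c h1 h2 BC = c"

lemma keys_W22_basis_bracket:
  assumes "d \<in> Poly_Mapping.keys (W22_basis_bracket a b)"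
  shows "(\<exists>m n. (a = BL m \<and> b = BL n) \<and> (d = BL (m + n) \<or> d = BC \<and> m + n = 0)) \<or>
    (\<exists>m n. (a = BL m \<and> b = BW n \<or> a = BW n \<and> b = BL m) \<and> (d = BW (m + n) \<or> d = BC \<and> m + n = 0))"
  using assms
  by (cases a; cases b)
    (auto simp: in_keys_iff lookup_add lookup_minus lookup_single when_def cocycle_def split: if_splits)

lemma sum_keys_superset:
  "finite A \<Longrightarrow> Poly_Mapping.keys x \<subseteq> A \<Longrightarrow>
    (\<Sum>b\<in>Poly_Mapping.keys x. Poly_Mapping.lookup x b * f b) = (\<Sum>b\<in>A. Poly_Mapping.lookup x b * f b)"
  for f :: "'b \<Rightarrow> complex"
  by (rule sum.mono_neutral_left) (auto simp: in_keys_iff)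

text \<open>If the indices of two nonnegative modes sum to zero, both are zero and so is the
  bracket. Otherwise the bracket is a multiple of a positive mode, whose weight is zero.\<close>

lemma W22_character:
  assumes "\<not> W22_neg a" "\<not> W22_neg b"
  shows "(\<Sum>d\<in>Poly_Mapping.keys (W22_basis_bracket a b).
    Poly_Mapping.lookup (W22_basis_bracket a b) d * W22_weight c h1 h2 d) = 0"
proof (cases "\<exists>m n. a = BL m \<and> b = BL n \<or> a = BL m \<and> b = BW n \<or> a = BW n \<and> b = BL m")
  case True
  then obtain m n where *: "a = BL m \<and> b = BL n \<or> a = BL m \<and> b = BW n \<or> a = BW n \<and> b = BL m"
    by blast
  have "Poly_Mapping.keys (W22_basis_bracket a b) \<subseteq> {BL (m + n), BW (m + n), BC}"
    using keys_W22_basis_bracket[of _ a b] * by auto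
  then have sum: "(\<Sum>d\<in>Poly_Mapping.keys (W22_basis_bracket a b).
      Poly_Mapping.lookup (W22_basis_bracket a b) d * W22_weight c h1 h2 d) =
    (\<Sum>d\<in>{BL (m + n), BW (m + n), BC}.
      Poly_Mapping.lookup (W22_basis_bracket a b) d * W22_weight c h1 h2 d)"
    by (rule sum_keys_superset[rotated]) simp
  show ?thesis
  proof (cases "m + n = 0")
    case True
    then have "m = 0" "n = 0" using * assms by auto
    then show ?thesis
      unfolding sum using * by (auto simp: cocycle_def)
  next
    case False
    then show ?thesis
      unfolding sum using *
      by (auto simp: lookup_add lookup_minus lookup_single when_def cocycle_def add.commute[of n m])
  qed
next
  case False
  have "Poly_Mapping.keys (W22_basis_bracket a b) = {}"
    using keys_W22_basis_bracket[of _ a b] False by blast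
  then show ?thesis by simp
qed

lemma W22_bracket_basis_left: "W22_bracket (Poly_Mapping.single a 1) = lin_ext (W22_basis_bracket a)"
  by (rule ext) (simp add: W22_bracket_def)

lemma verma_basis_W22: "verma_basis W22_basis_bracket W22_neg (W22_weight c h1 h2)"
proof
  fix x y b
  show "W22_basis_bracket y x = - W22_basis_bracket x y"
    by (rule W22_basis_bracket_antisym)
  show "W22_neg x \<Longrightarrow> \<not> W22_neg y \<Longrightarrow> x < y"
    by (cases x; cases y) (auto simp: less_W22_basis_def)
  show "W22_neg x \<Longrightarrow> W22_neg y \<Longrightarrow> b \<in> Poly_Mapping.keys (W22_basis_bracket x y) \<Longrightarrow> W22_neg b"
    "\<not> W22_neg x \<Longrightarrow> \<not> W22_neg y \<Longrightarrow> b \<in> Poly_Mapping.keys (W22_basis_bracket x y) \<Longrightarrow> \<not> W22_neg b"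
    by (drule keys_W22_basis_bracket, auto)+
  show "\<not> W22_neg x \<Longrightarrow> \<not> W22_neg y \<Longrightarrow> (\<Sum>b\<in>Poly_Mapping.keys (W22_basis_bracket x y).
      Poly_Mapping.lookup (W22_basis_bracket x y) b * W22_weight c h1 h2 b) = 0"
    by (rule W22_character)
  fix z
  show "lin_ext (W22_basis_bracket x) (W22_basis_bracket y z) + lin_ext (W22_basis_bracket y) (W22_basis_bracket z x) +
      lin_ext (W22_basis_bracket z) (W22_basis_bracket x y) = 0"
    using W22_basis_jacobi[of x y z] by (simp add: W22_bracket_basis_left)
qed

section \<open>The defining left ideal as the kernel of the projection, and the action of the
  modes\<close>

context
  fixes c h1 h2 :: complex
begin

interpretation V: verma_basis W22_basis_bracket W22_neg "W22_weight c h1 h2"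
  by (rule verma_basis_W22)

lemma bracket_W22: "V.bracket = W22_bracket"
  by (intro ext) (simp add: V.bracket_def W22_bracket_def)

definition verma_gens :: "(W22_basis list \<Rightarrow>\<^sub>0 complex) set" where
  "verma_gens = {word [BL m] | m. m > 0} \<union> {word [BW m] | m. m > 0} \<union>
     {word [BC] - scale c 1, word [BL 0] - scale h1 1, word [BW 0] - scale h2 1}"

definition verma_lideal :: "(W22_basis list \<Rightarrow>\<^sub>0 complex) set" where
  "verma_lideal = gen_lideal W22_bracket verma_gens"

lemma uea_incl_eq: "uea_incl W22_bracket x = uea_proj W22_bracket (tensor_incl x)"
  and uea_scalar_eq: "uea_scalar W22_bracket k = uea_proj W22_bracket (scale k 1)"
  by (simp_all add: uea_incl_def uea_scalar_def uea_proj_def)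

lemma verma_ideal_eq: "verma_ideal c h1 h2 = gen_left_ideal UW22 (uea_proj W22_bracket ` verma_gens)"
proof -
  have image: "f ` {g m | m. m > 0} = {f (g m) | m. m > 0}" for f :: "'x \<Rightarrow> 'y" and g :: "int \<Rightarrow> 'x"
    by blast
  show ?thesis
    unfolding verma_ideal_def Let_def uea_incl_eq uea_scalar_eq tensor_incl_single verma_gens_def
      image_Un image_insert image_empty uea_proj_diff image ..
qed

lemma irreducible_verma_iff:
  "irreducible_module UW22 (verma c h1 h2) \<longleftrightarrow> verma_lideal \<noteq> UNIV \<and>
    (\<forall>N. lideal N \<longrightarrow> verma_lideal \<subseteq> N \<longrightarrow> N = verma_lideal \<or> N = UNIV)"
  unfolding verma_def verma_ideal_eq verma_lideal_def gen_lideal_def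
  by (intro irreducible_quot_module_iff left_ideal_gen_left_ideal) auto

lemma lideal_verma_lideal: "lideal verma_lideal"
  unfolding verma_lideal_def by (rule lideal_gen_lideal)

lemma project_cong_verma: "x - V.project x \<in> verma_lideal"
proof (rule V.project_cong[OF lideal_verma_lideal])
  fix a b x y
  have "a * V.relation x y * b \<in> uea_ideal W22_bracket"
    using uea_ideal_relation[of a x y W22_bracket b] by (simp add: V.relation_def bracket_W22)
  then show "a * V.relation x y * b \<in> verma_lideal"
    unfolding verma_lideal_def by (rule subsetD[OF uea_ideal_subset_gen_lideal])
next
  fix x :: W22_basis assume "\<not> W22_neg x"
  then have "word [x] - scale (W22_weight c h1 h2 x) 1 \<in> verma_gens"
    unfolding verma_gens_def by (cases x) auto
  then show "word [x] - scale (W22_weight c h1 h2 x) 1 \<in> verma_lideal"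
    unfolding verma_lideal_def by (rule subsetD[OF subset_gen_lideal])
qed

text \<open>The elements all of whose left multiples are killed by \<open>project\<close> form a
  left ideal. It contains the relations by \<open>project_relation\<close> and the generators by
  \<open>project_character\<close>.\<close>

lemma project_mult_verma_lideal:
  assumes "x \<in> verma_lideal"
  shows "V.project (a * x) = 0"
proof -
  let ?K = "{x. \<forall>a. V.project (a * x) = 0}"
  have K: "lideal ?K"
    by (auto simp: lideal_def distrib_left V.project_linear simp flip: mult.assoc)
  have "verma_lideal \<subseteq> ?K"
    unfolding verma_lideal_def
  proof (rule gen_lideal_minimal[OF K])
    show "uea_ideal W22_bracket \<subseteq> ?K"
    proof (rule uea_ideal_minimal[OF _ K])
      fix x y and a b :: "W22_basis list \<Rightarrow>\<^sub>0 complex"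
      show "a * (tensor_incl x * tensor_incl y - tensor_incl y * tensor_incl x - tensor_incl (W22_bracket x y)) * b \<in> ?K"
        using V.project_relation[of "a' * a" x y b for a']
        by (simp add: V.relation_def bracket_W22 mult.assoc)
    qed
    have "word [x] - scale (W22_weight c h1 h2 x) 1 \<in> ?K" if "\<not> W22_neg x" for x
      using V.project_character[OF that] by blast
    note gen = this
    show "verma_gens \<subseteq> ?K"
    proof
      fix y assume "y \<in> verma_gens"
      then consider m where "y = word [BL m]" "m > 0" | m where "y = word [BW m]" "m > 0"
        | "y = word [BC] - scale c 1" | "y = word [BL 0] - scale h1 1" | "y = word [BW 0] - scale h2 1"
        unfolding verma_gens_def by blast
      then show "y \<in> ?K"
      proof cases
        case (1 m)
        then show ?thesis using gen[of "BL m"] by simp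
      next
        case (2 m)
        then show ?thesis using gen[of "BW m"] by simp
      next
        case 3
        show ?thesis unfolding 3 using gen[of BC] by simp
      next
        case 4
        show ?thesis unfolding 4 using gen[of "BL 0"] by simp
      next
        case 5
        show ?thesis unfolding 5 using gen[of "BW 0"] by simp
      qed
    qed
  qed
  then show ?thesis using assms by blast
qed

lemma project_absorb: "V.project (a * V.project x) = V.project (a * x)"
  using project_mult_verma_lideal[OF project_cong_verma, of a x]
  by (simp add: right_diff_distrib V.project_linear)

text \<open>This is the Poincare-Birkhoff-Witt theorem for the Verma module: the ordered negative
  words, which \<open>project\<close> fixes, represent a basis.\<close>

lemma mem_verma_lideal_iff: "x \<in> verma_lideal \<longleftrightarrow> V.project x = 0"
  using project_mult_verma_lideal[of x 1] project_cong_verma[of x] by auto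

text \<open>Acts on the whole tensor algebra, with values in the image of \<open>project\<close>,
  which models the Verma module. By \<open>project_absorb\<close> intermediate projections are
  harmless.\<close>

definition act :: "W22_basis \<Rightarrow> (W22_basis list \<Rightarrow>\<^sub>0 complex) \<Rightarrow> (W22_basis list \<Rightarrow>\<^sub>0 complex)" where
  "act b x = V.project (word [b] * x)"

lemma act_linear: "act b (x + y) = act b x + act b y" "act b (scale k x) = scale k (act b x)"
  by (simp_all add: act_def distrib_left scale_mult_right V.project_linear)

lemma act_act: "act a (act b x) = act b (act a x) + lin_ext (\<lambda>d. act d x) (W22_basis_bracket a b)"
proof -
  have "V.relation (Poly_Mapping.single a 1) (Poly_Mapping.single b 1) * x =
      word [a] * (word [b] * x) - word [b] * (word [a] * x) - lin_ext (\<lambda>d. word [d] * x) (W22_basis_bracket a b)"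
    by (simp add: V.relation_eq_lin_ext left_diff_distrib lin_ext_mult_left flip: mult.assoc)
  then have "V.project (word [a] * (word [b] * x) - word [b] * (word [a] * x) -
      lin_ext (\<lambda>d. word [d] * x) (W22_basis_bracket a b)) = 0"
    using V.project_relation[of 1 "Poly_Mapping.single a 1" "Poly_Mapping.single b 1" x] by simp
  then show ?thesis
    unfolding act_def project_absorb by (simp add: V.project_linear V.project_lin_ext algebra_simps)
qed

lemma W22_rep: "W22_rep scale (\<lambda>m. act (BL m)) (\<lambda>m. act (BW m)) (act BC)"
proof
  fix k l :: complex and x y :: "W22_basis list \<Rightarrow>\<^sub>0 complex"
  show "scale k (x + y) = scale k x + scale k y" "scale (k + l) x = scale k x + scale l x"
    "scale k (scale l x) = scale (k * l) x" "scale 1 x = x"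
    by (simp_all add: scale_add scale_add_left)
  fix m n
  show "act (BL m) (act (BL n) x) = act (BL n) (act (BL m) x) +
      scale (of_int (m - n)) (act (BL (m + n)) x) + scale (cocycle m n) (act BC x)"
    by (subst act_act) (simp add: lin_ext_add lin_ext_scale add.assoc del: of_int_diff)
  show "act (BL m) (act (BW n) x) = act (BW n) (act (BL m) x) +
      scale (of_int (m - n)) (act (BW (m + n)) x) + scale (cocycle m n) (act BC x)"
    by (subst act_act) (simp add: lin_ext_add lin_ext_scale add.assoc del: of_int_diff)
  show "act (BW m) (act (BW n) x) = act (BW n) (act (BW m) x)"
    "act BC (act (BL m) x) = act (BL m) (act BC x)" "act BC (act (BW m) x) = act (BW m) (act BC x)"
    by (subst act_act, simp)+
qed (simp_all add: act_linear)

lemma W22_hw: "W22_hw scale (\<lambda>m. act (BL m)) (\<lambda>m. act (BW m)) (act BC) (word []) c h1 h2"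
proof -
  interpret R: W22_rep scale "\<lambda>m. act (BL m)" "\<lambda>m. act (BW m)" "act BC"
    by (rule W22_rep)
  have "act b (word []) = scale (W22_weight c h1 h2 b) (word [])" if "\<not> W22_neg b" for b
    using V.vnf_snoc[OF that, of "[]"] V.vnf_neg_sorted[of "[]"] by (simp add: act_def)
  note hw = this[of "BL k" for k] this[of "BW k" for k] this[of BC]
  show ?thesis
    by unfold_locales (use hw in \<open>simp_all add: not_less del: scale_single\<close>)
qed

text \<open>Each letter raises the filtration by at most one step, and finitely many words have a
  common bound.\<close>

lemma project_mult_in_F:
  assumes "W22_hw scale (\<lambda>m. act (BL m)) (\<lambda>m. act (BW m)) (act BC) v c' h1' h2'"
    and y: "y \<in> W22_hw.F scale (\<lambda>m. act (BL m)) (\<lambda>m. act (BW m)) v e" "V.project y = y"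
  shows "\<exists>e. V.project (a * y) \<in> W22_hw.F scale (\<lambda>m. act (BL m)) (\<lambda>m. act (BW m)) v e"
proof -
  interpret H: W22_hw scale "\<lambda>m. act (BL m)" "\<lambda>m. act (BW m)" "act BC" v c' h1' h2'
    by (rule assms(1))
  have word: "\<exists>e. V.project (word u * y) \<in> H.F e" for u
  proof (induction u)
    case Nil
    have "word [] * y = y" by (simp flip: one_eq_word)
    then show ?case using y by auto
  next
    case (Cons b u)
    then obtain e where x: "V.project (word u * y) \<in> H.F e" (is "?x \<in> _") by blast
    have eq: "V.project (word (b # u) * y) = act b ?x"
      unfolding act_def project_absorb by (simp flip: mult.assoc)
    show ?case
    proof (cases b)
      case (BL m)
      then show ?thesis using H.F_closed[OF x, of m] unfolding eq by blast
    next
      case (BW m)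
      then show ?thesis using H.w_F[OF x, of m] unfolding eq by blast
    next
      case BC
      then show ?thesis
        unfolding eq using H.z_F[OF x] H.subspace_scale[OF H.subspace_F x, of c'] by auto
    qed
  qed
  have "V.project (lin_ext word a * y) = lin_ext (\<lambda>u. V.project (word u * y)) a"
    by (simp add: lin_ext_mult_left V.project_lin_ext del: lin_ext_basis)
  then have "V.project (a * y) = lin_ext (\<lambda>u. V.project (word u * y)) a" by simp
  moreover have "\<exists>e. lin_ext (\<lambda>u. V.project (word u * y)) a \<in> H.F e"
  proof (induction a rule: lin_ext_induct)
    case zero
    show ?case using H.subspace_0[OF H.subspace_F] by blast
  next
    case (add x y)
    then obtain e f where "x \<in> H.F e" "y \<in> H.F f" by blast
    then have "x \<in> H.F (max e f)" "y \<in> H.F (max e f)"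
      using H.F_mono[of e "max e f"] H.F_mono[of f "max e f"] by auto
    then show ?case using H.subspace_add[OF H.subspace_F] by blast
  next
    case (scale k x)
    then show ?case using H.subspace_scale[OF H.subspace_F] by blast
  next
    case (basis u)
    show ?case by (rule word)
  qed
  ultimately show ?thesis by simp
qed

lemma \<kappa>_eq_0_iff:
  assumes "m \<noteq> 0"
  shows "W22_hw.\<kappa> c h2 m = 0 \<longleftrightarrow> (of_int m ^ 2 - 1) / 12 * c + 2 * h2 = 0"
proof -
  interpret H: W22_hw scale "\<lambda>m. act (BL m)" "\<lambda>m. act (BW m)" "act BC" "word []" c h1 h2
    by (rule W22_hw)
  have "H.\<kappa> m = of_int m * ((of_int m ^ 2 - 1) / 12 * c + 2 * h2)"
    by (simp add: H.\<kappa>_def field_simps power2_eq_square power3_eq_cube)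
  then show ?thesis using assms by simp
qed

lemma project_one: "V.project 1 = word []"
  unfolding one_eq_word using V.vnf_neg_sorted[of "[]"] by simp

lemma irreducible_if:
  assumes "\<And>m::int. m \<noteq> 0 \<Longrightarrow> (of_int m ^ 2 - 1) / 12 * c + 2 * h2 \<noteq> 0"
  shows "irreducible_module UW22 (verma c h1 h2)"
proof -
  interpret H: W22_hw scale "\<lambda>m. act (BL m)" "\<lambda>m. act (BW m)" "act BC" "word []" c h1 h2
    by (rule W22_hw)
  have \<kappa>: "H.\<kappa> n \<noteq> 0" if "n > 0" for n
    using \<kappa>_eq_0_iff[of n] assms[of n] that by auto
  have "word [] \<noteq> (0 :: W22_basis list \<Rightarrow>\<^sub>0 complex)"
    by (simp flip: one_eq_word)
  then have "1 \<notin> verma_lideal"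
    by (simp add: mem_verma_lideal_iff project_one)
  moreover have "N = verma_lideal \<or> N = UNIV" if N: "lideal N" "verma_lideal \<subseteq> N" for N
  proof (cases "N \<subseteq> verma_lideal")
    case False
    then obtain x where x: "x \<in> N" "V.project x \<noteq> 0"
      using mem_verma_lideal_iff by blast
    \<comment> \<open>As \<open>N\<close> contains \<open>verma_lideal\<close>, it is stable under
      projection and hence under the operators \<open>act\<close>.\<close>
    have project_N: "V.project y \<in> N" if "y \<in> N" for y
      using lideal_diff[OF N(1) that, of "y - V.project y"] project_cong_verma[of y] N(2) by auto
    have act_N: "act b y \<in> N" if "y \<in> N" for b y
      unfolding act_def using N(1) that by (intro project_N) (simp add: lideal_def)
    have "word [] \<in> H.F 1"
      using H.v_in_S by (simp add: H.F_1)
    moreover have "V.project (word []) = word []"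
      using project_one by (simp flip: one_eq_word)
    \<comment> \<open>The vacuum generates everything: \<open>x\<close> is \<open>x\<close> times
      the empty word.\<close>
    ultimately obtain e where "V.project (x * word []) \<in> H.F e"
      using project_mult_in_F[OF W22_hw, of "word []" 1 x] by blast
    then have e: "V.project x \<in> H.F e" by (simp flip: one_eq_word)
    have "H.subspace N"
      using N(1) lideal_scale[OF N(1)] by (auto simp: H.subspace_def lideal_def)
    then have "word [] \<in> N"
      using H.vacuum_in_subspace[OF \<kappa> _ act_N act_N project_N[OF x(1)] x(2) e] by blast
    then have "a * 1 \<in> N" for a
      using N(1) by (simp add: lideal_def one_eq_word)
    then show ?thesis by auto
  qed (use N(2) in blast)
  ultimately show ?thesis
    unfolding irreducible_verma_iff by blast
qed

lemma wword_eq_project: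
  "foldr (\<lambda>i. act (BW (- i))) \<mu> (word []) = V.project (word (map (\<lambda>i. BW (- i)) \<mu>))"
proof (induction \<mu>)
  case Nil
  show ?case using project_one by (simp add: one_eq_word)
next
  case (Cons i \<mu>)
  then show ?case by (simp only: foldr.simps o_apply act_def project_absorb list.map word_mult append.simps)
qed

text \<open>The singular vector generates a submodule that is nonzero but misses the vacuum.\<close>

lemma not_irreducible:
  assumes m: "m > 0" and c_eq: "c = - 12 * \<alpha> ^ 2" and h2_eq: "2 * h2 = \<alpha> ^ 2 * (of_nat m ^ 2 - 1)"
    and coeff: "\<And>j. 0 < j \<Longrightarrow> j < m \<Longrightarrow> \<alpha> * (of_nat j - of_nat m) \<noteq> 0"
  shows "\<not> irreducible_module UW22 (verma c h1 h2)"
proof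
  assume irr: "irreducible_module UW22 (verma c h1 h2)"
  interpret H: W22_hw scale "\<lambda>m. act (BL m)" "\<lambda>m. act (BW m)" "act BC" "word []" c h1 h2
    by (rule W22_hw)
  interpret H: W22_singular scale "\<lambda>m. act (BL m)" "\<lambda>m. act (BW m)" "act BC" "word []" c h1 h2 \<alpha> m
    by unfold_locales (use assms in auto)
  define x where "x = H.d m (word [])"
  have hw: "W22_hw scale (\<lambda>m. act (BL m)) (\<lambda>m. act (BW m)) (act BC) x c (h1 + of_nat m) h2"
    unfolding x_def by (rule H.singular_vector_hw)
  interpret X: W22_hw scale "\<lambda>m. act (BL m)" "\<lambda>m. act (BW m)" "act BC" x c "h1 + of_nat m" h2
    by (rule hw)
  have project_id: "V.project (V.project y) = V.project y" for y
    using project_absorb[of 1 y] by simp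
  \<comment> \<open>Vectors without vacuum component; negative modes map everything there.\<close>
  let ?E = "{y :: W22_basis list \<Rightarrow>\<^sub>0 complex. Poly_Mapping.lookup y [] = 0}"
  have E: "H.subspace ?E"
    by (simp add: H.subspace_def lookup_add)
  have act_E: "act b y \<in> ?E" if "W22_neg b" for b y
    using V.lookup_project_neg[OF that, of y] by (simp add: act_def project_absorb)
  have "x \<in> ?E"
    unfolding x_def using m act_E by (intro H.d_range[OF E]) auto
  then have F_E: "X.F e \<subseteq> ?E" for e
    using act_E by (intro X.F_minimal[OF E]) auto
  have project_x: "V.project x = x"
  proof -
    have "x \<in> H.span {H.wword \<mu> (word []) | \<mu>. \<forall>i\<in>set \<mu>. 0 < i}"
      using H.singular_vector_in_S by (simp add: x_def H.S_def)
    then show ?thesis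
    proof (rule H.lin_span_eq[rotated 2])
      show "H.lin V.project" by (simp add: H.lin_def V.project_linear)
      show "V.project b = b" if "b \<in> {H.wword \<mu> (word []) | \<mu>. \<forall>i\<in>set \<mu>. 0 < i}" for b
        using that by (auto simp: H.wword_def wword_eq_project project_id simp del: V.project_word)
    qed simp
  qed
  have "x \<noteq> 0"
  proof -
    \<comment> \<open>The coefficient of \<open>x\<close> at this word is 1, since all terms but the
      leading one involve only letters from \<open>?A\<close>.\<close>
    define p where "p = [BW (- int m)]"
    let ?P = "{y :: W22_basis list \<Rightarrow>\<^sub>0 complex. Poly_Mapping.lookup y p = 0}"
    let ?A = "{BW (- i) | i. 0 < i \<and> i < int m}"
    have "V.vnf p = word p"
      unfolding p_def using m by (intro V.vnf_neg_sorted) auto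
    then have 1: "act (BW (- int m)) (word []) = word p"
      by (simp add: act_def p_def)
    have "{H.wword \<mu> (word []) | \<mu>. \<forall>i\<in>set \<mu>. 0 < i \<and> i < int m} \<subseteq> ?P"
    proof safe
      fix \<mu> :: "int list" assume \<mu>: "\<forall>i\<in>set \<mu>. 0 < i \<and> i < int m"
      have "set n \<subseteq> ?A" if "n \<in> Poly_Mapping.keys (V.vnf (map (\<lambda>i. BW (- i)) \<mu>))" for n
        by (rule V.keys_vnf_subset[OF _ _ _ that]) (use \<mu> in auto)
      moreover have "\<not> set p \<subseteq> ?A" by (simp add: p_def)
      ultimately have "p \<notin> Poly_Mapping.keys (V.vnf (map (\<lambda>i. BW (- i)) \<mu>))" by blast
      then show "Poly_Mapping.lookup (H.wword \<mu> (word [])) p = 0"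
        by (simp add: H.wword_def wword_eq_project in_keys_iff)
    qed
    moreover have "H.subspace ?P"
      by (simp add: H.subspace_def lookup_add)
    ultimately have "x - act (BW (- int m)) (word []) \<in> ?P"
      using H.singular_vector_decomp H.span_minimal unfolding x_def by blast
    then have "Poly_Mapping.lookup x p = 1"
      by (simp add: 1 lookup_minus)
    then show ?thesis by auto
  qed
  \<comment> \<open>The preimage in the tensor algebra of the submodule generated by
    \<open>x\<close>.\<close>
  define N where "N = {y. \<exists>e. V.project y \<in> X.F e}"
  have "lideal N"
    unfolding lideal_def
  proof (intro conjI ballI allI)
    show "0 \<in> N"
      using H.subspace_0[OF X.subspace_F] by (auto simp: N_def V.project_linear)
  next
    fix y y' assume "y \<in> N" "y' \<in> N"
    then obtain e f where "V.project y \<in> X.F e" "V.project y' \<in> X.F f" by (auto simp: N_def)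
    then have "V.project y \<in> X.F (max e f)" "V.project y' \<in> X.F (max e f)"
      using X.F_mono[of e "max e f"] X.F_mono[of f "max e f"] by auto
    then have "V.project (y + y') \<in> X.F (max e f)"
      unfolding V.project_linear by (intro H.subspace_add[OF X.subspace_F])
    then show "y + y' \<in> N" unfolding N_def by blast
  next
    fix a y assume "y \<in> N"
    then obtain e where "V.project y \<in> X.F e" by (auto simp: N_def)
    from project_mult_in_F[OF hw this project_id, of a] show "a * y \<in> N"
      by (simp add: N_def project_absorb)
  qed
  moreover have "verma_lideal \<subseteq> N"
    using H.subspace_0[OF X.subspace_F] by (auto simp: N_def mem_verma_lideal_iff)
  ultimately have "N = verma_lideal \<or> N = UNIV"
    using irr unfolding irreducible_verma_iff by simp
  moreover have "1 \<notin> N"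
  proof
    assume "1 \<in> N"
    then obtain e where "word [] \<in> X.F e" by (auto simp: N_def project_one)
    from subsetD[OF F_E this] show False by simp
  qed
  moreover have "x \<in> N"
    using X.v_in_S X.F_1 project_x by (auto simp: N_def)
  moreover have "x \<notin> verma_lideal"
    using \<open>x \<noteq> 0\<close> project_x by (simp add: mem_verma_lideal_iff)
  ultimately show False by auto
qed

end

theorem theorem2p4:
  fixes c h1 h2 :: complex
  shows "irreducible_module (uea W22_bracket) (verma c h1 h2) \<longleftrightarrow>
    (\<forall>m::int. m \<noteq> 0 \<longrightarrow> (of_int m ^ 2 - 1) / 12 * c + 2 * h2 \<noteq> 0)"
proof
  assume irr: "irreducible_module (uea W22_bracket) (verma c h1 h2)"
  show "\<forall>m::int. m \<noteq> 0 \<longrightarrow> (of_int m ^ 2 - 1) / 12 * c + 2 * h2 \<noteq> 0"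
  proof (intro allI impI notI)
    fix m :: int assume "m \<noteq> 0" and m: "(of_int m ^ 2 - 1) / 12 * c + 2 * h2 = 0"
    \<comment> \<open>Only the square of \<open>m\<close> enters the condition, so \<open>m\<close>
      may be replaced by its absolute value.\<close>
    define n where "n = nat \<bar>m\<bar>"
    have "int n ^ 2 = m ^ 2" by (simp add: n_def)
    then have "(of_int (int n ^ 2) :: complex) = of_int (m ^ 2)" by (rule arg_cong)
    then have n2: "(of_int m :: complex) ^ 2 = of_nat n ^ 2" by simp
    have "n > 0" using \<open>m \<noteq> 0\<close> by (simp add: n_def)
    show False
    proof (cases "c = 0")
      case True
      \<comment> \<open>Here \<open>h2 = 0\<close> as well; with degree 1 and \<alpha> = 0 the
        condition on the coefficients is vacuous.\<close>
      then show False
        using not_irreducible[of 1 c 0 h2 h1] m irr by simp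
    next
      case False
      \<comment> \<open>Either square root would do, since only its square enters the formulas for
        \<open>c\<close> and \<open>h2\<close>.\<close>
      define \<alpha> where "\<alpha> = csqrt (- c / 12)"
      have \<alpha>: "\<alpha> ^ 2 = - c / 12" by (simp add: \<alpha>_def)
      with False have "\<alpha> \<noteq> 0" by auto
      have "2 * h2 = \<alpha> ^ 2 * (of_nat n ^ 2 - 1)"
        using m unfolding \<alpha> n2 by (simp add: field_simps add_eq_0_iff)
      moreover have "c = - 12 * \<alpha> ^ 2" by (simp add: \<alpha>)
      ultimately show False
        using not_irreducible[of n c \<alpha> h2 h1] irr \<open>n > 0\<close> \<open>\<alpha> \<noteq> 0\<close> by simp
    qed
  qed
next
  assume "\<forall>m::int. m \<noteq> 0 \<longrightarrow> (of_int m ^ 2 - 1) / 12 * c + 2 * h2 \<noteq> 0"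
  then show "irreducible_module (uea W22_bracket) (verma c h1 h2)"
    by (intro irreducible_if) blast
qed

end
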